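(* For $n\ge3$ let $R_n\subset\mathbb{R}^2$ be the regular $n$-gon (filled) inscribed in a circle of radius $1$. (i) If $n=3$, then $\mathcal{P}_{\min}(R_n)$ consists of the Fagnano orbit of $R_3$. Its length is $\frac{3\sqrt3}{2}$. (ii) If $n\ge5$ is odd, then $\mathcal{P}_{\min}(R_n)$ consists of the $n$ singular $2$-bounce orbits starting at the vertices of $R_n$ (those running back and forth between a vertex and the midpoint of the opposite edge). Their length is $2\left(1+\cos\frac{\pi}{n}\right)=2\,\mathrm{width}(R_n)$. (iii) If $n$ is even, then $\mathcal{P}_{\min}(R_n)$ consists of the $\frac{n}{2}$ bands of $2$-bounce orbits of length $4\cos\frac{\pi}{n}=2\,\mathrm{width}(R_n)$ (for each of the $\frac n2$ pairs of opposite parallel edges, the band of all segments orthogonal to these two edges with one end point on each of them, traversed back and forth). (iv) If $n=3k$ with $k\ge1$ an integer, then there exist $k$ regular $3$-bounce orbits on $R_n$, namely the equilateral triangles with vertices on the midpoints of the edges they hit; these are all the elements of $\mathcal{P}_{3,\mathrm{reg}}(R_n)$. Their length is $3\sqrt3\cos\frac{\pi}{n}$, which is larger than $2\,\mathrm{width}(R_n)$ if $k\ge2$. If $n$ is not divisible by $3$, then $\mathcal{P}_{3,\mathrm{reg}}(R_n)$ is empty.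
   Context: For a compact convex set $T\subset\mathbb{R}^2$ with non-empty interior, an outward support vector at $q\in\partial T$ is a vector $\nu$ with $\langle x-q,\nu\rangle\le0$ for all $x\in T$. A point $q\in\partial T$ is smooth if there is a unique line through $q$ disjoint from the interior of $T$. A generalised billiard orbit on $T$ is a sequence $q_i\in\partial T$, $i\in\mathbb{Z}$ (consecutive points distinct), such that for every $i$ the vector $\frac{q_i-q_{i-1}}{\|q_i-q_{i-1}\|}+\frac{q_i-q_{i+1}}{\|q_i-q_{i+1}\|}$ is an outward support vector of $T$ at $q_i$; it is regular if all $q_i$ (bounce points) are smooth, and singular otherwise. It is closed if $q_{i+n}=q_i$ for all $i$ for some $n\ge2$; for the smallest such $n$ it is an $n$-bounce orbit of length $\ell(c)=\sum_{i=0}^{n-1}\|q_{i+1}-q_i\|$. Closed orbits with the same trace are identified. $\mathcal{P}_{\min}(T)$ is the set of generalised closed billiard orbits on $T$ of minimal length, and $\mathcal{P}_{3,\mathrm{reg}}(T)$ is the set of regular $3$-bounce orbits on $T$. $\mathrm{width}(T)$ is the thickness of the thinnest band (region between two parallel lines) containing $T$. The Fagnano orbit of an acute triangle is the $3$-bounce orbit whose bounce points are the feet of the three altitudes. *)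

theory Defs
  imports "HOL-Analysis.Analysis"
begin

type_synonym plane = "real ^ 2"

section \<open>Generalised billiard orbits\<close>

definition outward_support_vector :: "plane set \<Rightarrow> plane \<Rightarrow> plane \<Rightarrow> bool" where
  "outward_support_vector T q \<nu> \<longleftrightarrow> q \<in> frontier T \<and> (\<forall>x\<in>T. (x - q) \<bullet> \<nu> \<le> 0)"

definition smooth_point :: "plane set \<Rightarrow> plane \<Rightarrow> bool" where
  "smooth_point T q \<longleftrightarrow> q \<in> frontier T \<and>
     (\<exists>!L. affine L \<and> aff_dim L = 1 \<and> q \<in> L \<and> L \<inter> interior T = {})"

definition billiard_orbit :: "plane set \<Rightarrow> (int \<Rightarrow> plane) \<Rightarrow> bool" where
  "billiard_orbit T q \<longleftrightarrow>
     (\<forall>i. q i \<in> frontier T \<and> q i \<noteq> q (i + 1) \<and>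
          outward_support_vector T (q i)
            ((q i - q (i - 1)) /\<^sub>R norm (q i - q (i - 1)) +
             (q i - q (i + 1)) /\<^sub>R norm (q i - q (i + 1))))"

definition regular_orbit :: "plane set \<Rightarrow> (int \<Rightarrow> plane) \<Rightarrow> bool" where
  "regular_orbit T q \<longleftrightarrow> billiard_orbit T q \<and> (\<forall>i. smooth_point T (q i))"

definition singular_orbit :: "plane set \<Rightarrow> (int \<Rightarrow> plane) \<Rightarrow> bool" where
  "singular_orbit T q \<longleftrightarrow> billiard_orbit T q \<and> \<not> (\<forall>i. smooth_point T (q i))"

definition closes_after :: "(int \<Rightarrow> plane) \<Rightarrow> nat \<Rightarrow> bool" where
  "closes_after q n \<longleftrightarrow> n \<ge> 2 \<and> (\<forall>i. q (i + int n) = q i)"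

definition closed_orbits :: "plane set \<Rightarrow> (int \<Rightarrow> plane) set" where
  "closed_orbits T = {q. billiard_orbit T q \<and> (\<exists>n. closes_after q n)}"

definition bounces :: "(int \<Rightarrow> plane) \<Rightarrow> nat" where
  "bounces q = (LEAST n. closes_after q n)"

definition bounce_orbits :: "plane set \<Rightarrow> nat \<Rightarrow> (int \<Rightarrow> plane) set" where
  "bounce_orbits T n = {q \<in> closed_orbits T. bounces q = n}"

definition orbit_length :: "(int \<Rightarrow> plane) \<Rightarrow> real" where
  "orbit_length q = (\<Sum>i<bounces q. norm (q (int i + 1) - q (int i)))"

definition orbit_trace :: "(int \<Rightarrow> plane) \<Rightarrow> plane set" where
  "orbit_trace q = (\<Union>i. closed_segment (q i) (q (i + 1)))"

text \<open>
  Sets of closed orbits are counted up to equality of traces.  The length is not invariant under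
  this identification: if an orbit runs along an edge of \<open>T\<close>, points in the interior of
  that edge may be inserted as additional bounce points (the support vector there is zero), and
  the edge may then be traversed several times before the sequence closes up.  Minimality of the
  length is therefore a condition on sequences, imposed before passing to the quotient.
\<close>
definition same_trace :: "plane set \<Rightarrow> ((int \<Rightarrow> plane) \<times> (int \<Rightarrow> plane)) set" where
  "same_trace T = {(c, d). c \<in> closed_orbits T \<and> d \<in> closed_orbits T \<and> orbit_trace c = orbit_trace d}"

definition min_orbits :: "plane set \<Rightarrow> (int \<Rightarrow> plane) set" where
  "min_orbits T = {c \<in> closed_orbits T. \<forall>d\<in>closed_orbits T. orbit_length c \<le> orbit_length d}"

definition P_min :: "plane set \<Rightarrow> (int \<Rightarrow> plane) set set" where
  "P_min T = min_orbits T // same_trace T"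

definition reg3_orbits :: "plane set \<Rightarrow> (int \<Rightarrow> plane) set" where
  "reg3_orbits T = {c \<in> bounce_orbits T 3. regular_orbit T c}"

definition P_3reg :: "plane set \<Rightarrow> (int \<Rightarrow> plane) set set" where
  "P_3reg T = reg3_orbits T // same_trace T"

definition width :: "plane set \<Rightarrow> real" where
  "width T = Inf {b - a | a b u. norm u = 1 \<and> a \<le> b \<and> T \<subseteq> {x. a \<le> u \<bullet> x \<and> u \<bullet> x \<le> b}}"

section \<open>Regular polygons and their distinguished orbits\<close>

definition vertex :: "nat \<Rightarrow> nat \<Rightarrow> plane" where
  "vertex n j = vector [cos (2 * pi * real j / real n), sin (2 * pi * real j / real n)]"

definition regular_polygon :: "nat \<Rightarrow> plane set" where
  "regular_polygon n = convex hull (vertex n ` {..<n})"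

definition edge :: "nat \<Rightarrow> nat \<Rightarrow> plane set" where
  "edge n j = closed_segment (vertex n j) (vertex n (j + 1))"

definition edge_midpoint :: "nat \<Rightarrow> nat \<Rightarrow> plane" where
  "edge_midpoint n j = midpoint (vertex n j) (vertex n (j + 1))"

definition cyclic_seq :: "plane list \<Rightarrow> int \<Rightarrow> plane" where
  "cyclic_seq xs i = xs ! nat (i mod int (length xs))"

definition altitude_foot :: "plane \<Rightarrow> plane \<Rightarrow> plane \<Rightarrow> plane" where
  "altitude_foot a b c = (THE f. f \<in> affine hull {b, c} \<and> orthogonal (a - f) (c - b))"

definition fagnano_orbit :: "plane \<Rightarrow> plane \<Rightarrow> plane \<Rightarrow> int \<Rightarrow> plane" where
  "fagnano_orbit a b c = cyclic_seq [altitude_foot a b c, altitude_foot b c a, altitude_foot c a b]"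

text \<open>For odd \<open>n\<close>, the edge opposite to vertex \<open>j\<close> is the one with index \<open>j + n div 2\<close>.\<close>
definition vertex_orbit :: "nat \<Rightarrow> nat \<Rightarrow> int \<Rightarrow> plane" where
  "vertex_orbit n j = cyclic_seq [vertex n j, edge_midpoint n (j + n div 2)]"

text \<open>For even \<open>n\<close>, the edges with indices \<open>j\<close> and \<open>j + n div 2\<close> are opposite and parallel.\<close>
definition band :: "nat \<Rightarrow> nat \<Rightarrow> (int \<Rightarrow> plane) set" where
  "band n j = {cyclic_seq [a, b] | a b.
     a \<in> edge n j \<and> b \<in> edge n (j + n div 2) \<and>
     orthogonal (b - a) (vertex n (j + 1) - vertex n j) \<and>
     orthogonal (b - a) (vertex n (j + n div 2 + 1) - vertex n (j + n div 2))}"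

definition midpoint_triangles :: "nat \<Rightarrow> (int \<Rightarrow> plane) set" where
  "midpoint_triangles n = {cyclic_seq [p, q, r] | p q r.
     {p, q, r} \<subseteq> edge_midpoint n ` {..<n} \<and>
     p \<noteq> q \<and> dist p q = dist q r \<and> dist q r = dist r p}"

end

theory Submission
  imports Defs
begin

text \<open>
  Let \<open>h\<close> be the support function of a convex body \<open>T\<close>, and let \<open>u i\<close> be the unit direction of the step
  from \<open>q i\<close> to \<open>q (i + 1)\<close> of a closed billiard orbit.  Summation by parts turns the length of the orbit
  into the sum of the inner products of \<open>q i\<close> with the bounce vectors \<open>u (i - 1) - u i\<close>, and because
  these are support vectors, each summand equals \<open>h (u (i - 1) - u i)\<close>.  So the length is the perimeter,
  measured by \<open>h\<close>, of a closed polygon inscribed in the unit circle, the polygon of directions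
  (\<open>length_dual\<close>).  As the steps of the orbit add up to 0, the hull of this polygon contains 0.

  By Caratheodory's theorem 0 lies in the hull of two antipodal directions or of three directions, and
  the triangle inequality for \<open>h\<close> bounds the length by the perimeter of this digon or triangle.  A digon
  has perimeter \<open>2 * (h v + h (- v))\<close>, at least twice the width of \<open>T\<close>.  On the regular
  \<open>n\<close>-gon every triangle is strictly longer than twice the width, if \<open>n\<close> is even
  (\<open>even_triple_bound\<close>) or at least 5 (\<open>odd_triple_bound\<close>).  A minimal orbit therefore has only two
  directions \<open>v\<close> and \<open>- v\<close>, in which the polygon is thinnest: its trace is a segment
  (\<open>bouncing_ball_trace\<close>), and the directions of minimal width are the normals of the sides for even \<open>n\<close>
  and the directions of the corners for odd \<open>n\<close>.

  For \<open>n = 3\<close> some triangles of directions are shorter than all digons, and the orbits are treated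
  directly.  A closed orbit on the equilateral triangle touches all three sides
  (\<open>touches_every_side\<close>), so it is at least as long as an inscribed triangle; projecting the chords of
  an inscribed triangle to the opposite sides shows that the triangle of midpoints, the Fagnano orbit,
  is the unique shortest one (\<open>inscribed_triangle\<close>).

  For a regular orbit with three bounces, each direction is fixed by the composition of the three
  reflections.  This yields a linear equation for the positions of two consecutive bounce points on
  their sides, which are less than half a side away from the midpoints.  Since the angles between sides
  are multiples of \<open>2 * pi / n\<close>, such small deviations are possible only if the three normals are
  symmetric to each other, and then the deviations vanish (\<open>symmetric_normals\<close>, \<open>offset_zero\<close>): the
  bounce points are the midpoints of three sides whose normals differ by a third of a turn.
\<close>

section \<open>Unit vectors of the plane and support functions\<close>

definition dir :: "real \<Rightarrow> plane" where
  "dir t = vector [cos t, sin t]"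

lemma inner_dir: "dir a \<bullet> dir b = cos (a - b)"
  by (simp add: dir_def inner_vec_def UNIV_2 cos_diff)

lemma norm_dir [simp]: "norm (dir a) = 1"
  by (simp add: norm_eq_sqrt_inner inner_dir)

lemma dir_nonzero [simp]: "dir a \<noteq> 0"
  using norm_dir[of a] by fastforce

lemma plane_eqI: "x $ 1 = y $ 1 \<Longrightarrow> x $ 2 = y $ 2 \<Longrightarrow> x = (y::plane)"
  by (simp add: vec_eq_iff forall_2)

lemma dir_components [simp]: "dir t $ 1 = cos t" "dir t $ 2 = sin t"
  by (simp_all add: dir_def)

lemma dir_plus_pi: "dir (a + pi) = - dir a"
  by (rule plane_eqI) simp_all

lemma dir_add_period: "dir (a + 2 * pi * of_int k) = dir a"
proof (rule plane_eqI)
  show "dir (a + 2 * pi * of_int k) $ 1 = dir a $ 1"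
    using cos_int_2pin[of k] sin_int_2pin[of k] by (simp add: cos_add)
  show "dir (a + 2 * pi * of_int k) $ 2 = dir a $ 2"
    using cos_int_2pin[of k] sin_int_2pin[of k] by (simp add: sin_add)
qed

lemma dir_diff: "dir a - dir b = (2 * sin ((a - b) / 2)) *\<^sub>R dir ((a + b) / 2 + pi / 2)"
proof (rule plane_eqI)
  show "(dir a - dir b) $ 1 = ((2 * sin ((a - b) / 2)) *\<^sub>R dir ((a + b) / 2 + pi / 2)) $ 1"
    using cos_diff_cos[of a b] sin_minus[of "(a - b) / 2"]
    by (simp add: cos_add algebra_simps diff_divide_distrib)
  show "(dir a - dir b) $ 2 = ((2 * sin ((a - b) / 2)) *\<^sub>R dir ((a + b) / 2 + pi / 2)) $ 2"
    using sin_diff_sin[of a b] by (simp add: sin_add)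
qed

lemma dir_sum: "dir a + dir b = (2 * cos ((a - b) / 2)) *\<^sub>R dir ((a + b) / 2)"
proof (rule plane_eqI)
  show "(dir a + dir b) $ 1 = ((2 * cos ((a - b) / 2)) *\<^sub>R dir ((a + b) / 2)) $ 1"
    using cos_plus_cos[of a b] by simp
  show "(dir a + dir b) $ 2 = ((2 * cos ((a - b) / 2)) *\<^sub>R dir ((a + b) / 2)) $ 2"
    using sin_plus_sin[of a b] by simp
qed

lemma unit_vector_dir:
  assumes "norm (w::plane) = 1"
  obtains t where "w = dir t"
proof -
  have "(w $ 1)\<^sup>2 + (w $ 2)\<^sup>2 = 1"
    using assms by (simp add: norm_vec_def L2_set_def UNIV_2 real_sqrt_eq_1_iff)
  then obtain t where "w $ 1 = cos t" "w $ 2 = sin t"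
    using sincos_total_2pi by metis
  then have "w = dir t" by (intro plane_eqI) auto
  then show thesis using that by blast
qed

lemma polar_form:
  fixes w :: plane
  obtains t where "w = norm w *\<^sub>R dir t"
proof (cases "w = 0")
  case True
  then show thesis using that[of 0] by simp
next
  case False
  then have "norm (w /\<^sub>R norm w) = 1" by simp
  then obtain t where "w /\<^sub>R norm w = dir t" by (rule unit_vector_dir)
  then have "w = norm w *\<^sub>R dir t" using False
    by (metis norm_eq_zero scaleR_one scaleR_scaleR right_inverse)
  then show thesis using that by blast
qed

lemma dir_frame:
  "(w::plane) = (w \<bullet> dir t) *\<^sub>R dir t + (w \<bullet> dir (t + pi / 2)) *\<^sub>R dir (t + pi / 2)"
proof -
  have one: "cos t * cos t + sin t * sin t = 1"
    using sin_cos_squared_add2[of t] by simp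
  have "(a * cos t + b * sin t) * cos t - (b * cos t - a * sin t) * sin t = a"
       "(a * cos t + b * sin t) * sin t + (b * cos t - a * sin t) * cos t = b" for a b :: real
    using one by algebra+
  then show ?thesis
    by (intro plane_eqI) (simp_all add: inner_vec_def UNIV_2 cos_add sin_add)
qed

definition support_fun :: "plane set \<Rightarrow> plane \<Rightarrow> real" where
  "support_fun T w = (SUP x\<in>T. x \<bullet> w)"

lemma support_fun_bdd:
  assumes "compact T"
  shows "bdd_above ((\<lambda>x. x \<bullet> w) ` T)"
proof -
  have "compact ((\<lambda>x. x \<bullet> w) ` T)"
    using assms by (intro compact_continuous_image continuous_intros)
  then show ?thesis by (intro bounded_imp_bdd_above compact_imp_bounded)
qed

lemma support_fun_ge: "compact T \<Longrightarrow> x \<in> T \<Longrightarrow> x \<bullet> w \<le> support_fun T w"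
  unfolding support_fun_def by (intro cSUP_upper support_fun_bdd)

lemma support_fun_eq:
  assumes "x \<in> T" "\<And>y. y \<in> T \<Longrightarrow> y \<bullet> w \<le> x \<bullet> w"
  shows "support_fun T w = x \<bullet> w"
  unfolding support_fun_def using assms by (intro cSup_eq_maximum) auto

lemma support_fun_add:
  assumes "compact T" "T \<noteq> {}"
  shows "support_fun T (v + w) \<le> support_fun T v + support_fun T w"
  unfolding support_fun_def[of T "v + w"]
  using assms support_fun_ge[of T]
  by (intro cSUP_least) (auto simp: inner_add_right intro!: add_mono)

lemma support_fun_zero:
  assumes "T \<noteq> {}"
  shows "support_fun T 0 = 0"
proof -
  obtain x where "x \<in> T" using assms by blast
  then show ?thesis using support_fun_eq[of x T 0] by simp
qed

lemma support_fun_scale: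
  assumes "compact T" "T \<noteq> {}" "c \<ge> 0"
  shows "support_fun T (c *\<^sub>R w) = c * support_fun T w"
proof (cases "c = 0")
  case True
  then show ?thesis using support_fun_zero[OF assms(2)] by simp
next
  case False
  then have c: "c > 0" using assms by simp
  have le: "support_fun T (d *\<^sub>R v) \<le> d * support_fun T v" if "d > 0" for d v
    unfolding support_fun_def[of T "d *\<^sub>R v"]
  proof (rule cSUP_least)
    fix x assume "x \<in> T"
    then have "d * (x \<bullet> v) \<le> d * support_fun T v"
      using that support_fun_ge[OF assms(1)] by (intro mult_left_mono) auto
    then show "x \<bullet> d *\<^sub>R v \<le> d * support_fun T v" by simp
  qed (rule assms)
  have "c * support_fun T w = c * support_fun T ((1 / c) *\<^sub>R (c *\<^sub>R w))" using c by simp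
  also have "\<dots> \<le> c * ((1 / c) * support_fun T (c *\<^sub>R w))"
    using c le[of "1 / c" "c *\<^sub>R w"] by (intro mult_left_mono) auto
  also have "\<dots> = support_fun T (c *\<^sub>R w)" using c by simp
  finally show ?thesis using le[OF c, of w] by simp
qed

section \<open>The regular polygon as an intersection of half-planes\<close>

definition half_angle :: "nat \<Rightarrow> real" where
  "half_angle n = pi / real n"

text \<open>
  The polygon is indexed by integers instead of \<open>{..<n}\<close>, so that neighbouring and opposite corners
  and sides need no wrap-around.  Side \<open>j\<close> joins the corners \<open>j\<close> and \<open>j + 1\<close>; the vectors
  \<open>side_normal\<close> and \<open>side_tangent\<close> form its orthonormal frame, in which the line through the side has
  normal coordinate \<open>cos (half_angle n)\<close>, the radius of the inscribed circle.
\<close>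
definition corner :: "nat \<Rightarrow> int \<Rightarrow> plane" where
  "corner n j = dir (2 * of_int j * half_angle n)"

definition side_angle :: "nat \<Rightarrow> int \<Rightarrow> real" where
  "side_angle n j = (2 * of_int j + 1) * half_angle n"

definition side_normal :: "nat \<Rightarrow> int \<Rightarrow> plane" where
  "side_normal n j = dir (side_angle n j)"

definition side_tangent :: "nat \<Rightarrow> int \<Rightarrow> plane" where
  "side_tangent n j = dir (side_angle n j + pi / 2)"

lemma norm_side_normal [simp]: "norm (side_normal n j) = 1"
  by (simp add: side_normal_def)

lemma side_frame:
  "w = (w \<bullet> side_normal n j) *\<^sub>R side_normal n j + (w \<bullet> side_tangent n j) *\<^sub>R side_tangent n j"
  unfolding side_normal_def side_tangent_def by (rule dir_frame)

lemma side_frame_inner [simp]: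
  "side_normal n j \<bullet> side_normal n j = 1" "side_tangent n j \<bullet> side_tangent n j = 1"
  "side_normal n j \<bullet> side_tangent n j = 0" "side_tangent n j \<bullet> side_normal n j = 0"
  by (simp_all add: side_normal_def side_tangent_def inner_dir)

lemma vertex_corner: "vertex n j = corner n (int j)"
  by (simp add: vertex_def corner_def dir_def half_angle_def algebra_simps)

locale regular_ngon =
  fixes n :: nat
  assumes n3: "3 \<le> n"
begin

abbreviation R :: "plane set" where "R \<equiv> regular_polygon n"
abbreviation h :: "plane \<Rightarrow> real" where "h \<equiv> support_fun (regular_polygon n)"
abbreviation \<alpha> :: real where "\<alpha> \<equiv> half_angle n"

lemma angle_pos: "0 < half_angle n"
  using n3 by (simp add: half_angle_def)

lemma angle_le: "half_angle n \<le> pi / 3"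
  unfolding half_angle_def using n3 by (intro divide_left_mono) auto

lemma angle_less: "half_angle n < pi / 2"
  using angle_le pi_gt_zero by linarith

lemmas angle_bounds = angle_pos angle_le angle_less pi_gt_zero

lemma n_times_angle: "real n * half_angle n = pi"
  using n3 by (simp add: half_angle_def)

lemma cos_angle_pos: "0 < cos (half_angle n)"
  using angle_bounds by (intro cos_gt_zero) auto

lemma sin_angle_pos: "0 < sin (half_angle n)"
  using angle_bounds by (intro sin_gt_zero) auto

lemma dir_shift: "dir (a + 2 * of_int (k * int n) * half_angle n) = dir a"
proof -
  have "2 * of_int (k * int n) * half_angle n = 2 * (real n * half_angle n) * of_int k"
    by (simp only: of_int_mult of_int_of_nat_eq mult_ac)
  then show ?thesis using dir_add_period[of a k] by (simp only: n_times_angle)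
qed

lemma corner_shift: "corner n (j + k * int n) = corner n j"
  unfolding corner_def using dir_shift[of "2 * of_int j * half_angle n" k]
  by (simp add: algebra_simps)

lemma side_normal_shift: "side_normal n (j + k * int n) = side_normal n j"
  unfolding side_normal_def side_angle_def
  using dir_shift[of "(2 * of_int j + 1) * half_angle n" k] by (simp add: algebra_simps)

lemma corner_mod: "corner n (j mod int n) = corner n j"
  using corner_shift[of "j mod int n" "j div int n"] by simp

lemma side_normal_mod: "side_normal n (j mod int n) = side_normal n j"
  using side_normal_shift[of "j mod int n" "j div int n"] by simp

lemma corner_in: "corner n j \<in> regular_polygon n"
proof -
  have "corner n j = vertex n (nat (j mod int n))"
    using n3 by (simp add: vertex_corner corner_mod)
  moreover have "nat (j mod int n) < n" using n3 by (simp add: nat_less_iff)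
  ultimately show ?thesis unfolding regular_polygon_def by (auto intro: hull_inc)
qed

lemma convex_polygon: "convex (regular_polygon n)"
  by (simp add: regular_polygon_def)

lemma compact_polygon: "compact (regular_polygon n)"
  by (simp add: regular_polygon_def finite_imp_compact_convex_hull)

lemma polygon_nonempty: "regular_polygon n \<noteq> {}"
  using corner_in by blast

lemma nearest_corner: obtains j :: int where "\<bar>t - 2 * of_int j * half_angle n\<bar> \<le> half_angle n"
proof -
  let ?x = "half_angle n"
  have x: "?x > 0" by (rule angle_pos)
  define k where "k = round (t / (2 * ?x))"
  have "\<bar>of_int k - t / (2 * ?x)\<bar> \<le> 1 / 2"
    unfolding k_def by (rule of_int_round_abs_le)
  then have "2 * ?x * \<bar>of_int k - t / (2 * ?x)\<bar> \<le> 2 * ?x * (1 / 2)"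
    using x by (intro mult_left_mono) auto
  then have "\<bar>2 * ?x * (of_int k - t / (2 * ?x))\<bar> \<le> ?x"
    using x by (simp add: abs_mult)
  moreover have "2 * ?x * (of_int k - t / (2 * ?x))
      = 2 * of_int k * ?x - t"
    using x by (simp add: right_diff_distrib)
  ultimately show thesis using that by (metis abs_minus_commute)
qed

lemma cos_odd_multiple_le: "cos ((2 * of_int m + 1) * half_angle n) \<le> cos (half_angle n)"
proof -
  let ?x = "half_angle n"
  \<comment> \<open>shifting \<open>m\<close> by a multiple of \<open>n\<close> puts the angle into \<open>[pi / n, 2 * pi - pi / n]\<close>\<close>
  define m' where "m' = (m mod int n)"
  have m': "0 \<le> m'" "m' < int n" using n3 by (auto simp: m'_def)
  have "dir ((2 * of_int m + 1) * ?x) = dir ((2 * of_int m' + 1) * ?x)"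
    using side_normal_mod[of m] by (simp add: side_normal_def side_angle_def m'_def)
  then have eq: "cos ((2 * of_int m + 1) * ?x) = cos ((2 * of_int m' + 1) * ?x)"
    by (metis dir_components(1))
  let ?y = "(2 * of_int m' + 1) * ?x"
  have "2 * of_int m' + 1 \<le> 2 * real n - 1" using m' by linarith
  then have "?y \<le> (2 * real n - 1) * ?x" using angle_bounds by (intro mult_right_mono) auto
  then have y2: "?y \<le> 2 * pi - ?x" using n_times_angle by (simp add: left_diff_distrib)
  have y1: "?x \<le> ?y" using m' angle_bounds by (simp add: algebra_simps)
  show ?thesis
  proof (cases "?y \<le> pi")
    case True
    then show ?thesis unfolding eq using y1 angle_bounds by (intro cos_monotone_0_pi_le) auto
  next
    case False
    have "cos (2 * pi - ?y) \<le> cos ?x"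
      using False y2 angle_bounds by (intro cos_monotone_0_pi_le) auto
    then show ?thesis unfolding eq by (simp add: cos_diff)
  qed
qed

lemma corner_inner_side: "corner n i \<bullet> side_normal n j \<le> cos (half_angle n)"
proof -
  have "corner n i \<bullet> side_normal n j = cos (side_angle n j - 2 * of_int i * half_angle n)"
    unfolding corner_def side_normal_def inner_dir
    by (metis cos_minus minus_diff_eq)
  also have "\<dots> = cos ((2 * of_int (j - i) + 1) * half_angle n)"
    by (rule arg_cong[of _ _ cos]) (simp add: side_angle_def algebra_simps)
  finally show ?thesis using cos_odd_multiple_le[of "j - i"] by simp
qed

lemma polygon_below_side:
  assumes "y \<in> regular_polygon n"
  shows "y \<bullet> side_normal n j \<le> cos (half_angle n)"
proof -
  have "regular_polygon n \<subseteq> {y. side_normal n j \<bullet> y \<le> cos (half_angle n)}"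
    unfolding regular_polygon_def
    using corner_inner_side by (intro hull_minimal convex_halfspace_le) (auto simp: vertex_corner inner_commute)
  then show ?thesis using assms by (auto simp: inner_commute)
qed

lemma polygon_norm_le:
  assumes "y \<in> regular_polygon n"
  shows "norm y \<le> 1"
proof -
  have "regular_polygon n \<subseteq> cball 0 1"
    unfolding regular_polygon_def
    by (intro hull_minimal) (auto simp: vertex_corner corner_def)
  then show ?thesis using assms by auto
qed

lemma support_fun_ge_corner:
  "cos (t - 2 * of_int j * half_angle n) \<le> support_fun (regular_polygon n) (dir t)"
  using support_fun_ge[OF compact_polygon corner_in, of j "dir t"]
  unfolding corner_def inner_dir by (metis cos_minus minus_diff_eq)

text \<open>
  The direction of \<open>w\<close> is at most half a central angle away from that of some corner, and corners
  have norm 1.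
\<close>
lemma support_fun_ge_inradius:
  "cos (half_angle n) * norm w \<le> support_fun (regular_polygon n) w"
proof -
  obtain t where t: "w = norm w *\<^sub>R dir t" by (rule polar_form)
  obtain j where j: "\<bar>t - 2 * of_int j * half_angle n\<bar> \<le> half_angle n"
    by (rule nearest_corner)
  have "cos (half_angle n) \<le> cos \<bar>t - 2 * of_int j * half_angle n\<bar>"
    using j angle_bounds by (intro cos_monotone_0_pi_le) auto
  then have "cos (half_angle n) \<le> support_fun (regular_polygon n) (dir t)"
    using support_fun_ge_corner[of t j] by simp
  then have "norm w * cos (half_angle n) \<le> norm w * support_fun (regular_polygon n) (dir t)"
    by (intro mult_left_mono) auto
  also have "\<dots> = support_fun (regular_polygon n) w"
    using support_fun_scale[OF compact_polygon polygon_nonempty, of "norm w" "dir t"] t by simp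
  finally show ?thesis by (simp add: mult.commute)
qed

lemma zero_in_polygon: "0 \<in> regular_polygon n"
proof (rule ccontr)
  assume "0 \<notin> regular_polygon n"
  then obtain a where a: "a \<noteq> 0" "\<forall>x\<in>regular_polygon n. 0 \<le> a \<bullet> x"
    using separating_hyperplane_set_0[OF convex_polygon] by blast
  \<comment> \<open>a half-plane that separates 0 from the polygon would contradict the bound by the inradius\<close>
  have "support_fun (regular_polygon n) (- a) \<le> 0"
    unfolding support_fun_def
    using a polygon_nonempty by (intro cSUP_least) (auto simp: inner_commute)
  moreover have "0 < cos (half_angle n) * norm (- a)" using cos_angle_pos a by simp
  ultimately show False using support_fun_ge_inradius[of "- a"] by linarith
qed

lemma corner_side:
  "corner n j = cos (half_angle n) *\<^sub>R side_normal n j - sin (half_angle n) *\<^sub>R side_tangent n j"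
  "corner n (j + 1) = cos (half_angle n) *\<^sub>R side_normal n j + sin (half_angle n) *\<^sub>R side_tangent n j"
proof -
  let ?x = "half_angle n"
  have d: "dir (a - b) = cos b *\<^sub>R dir a - sin b *\<^sub>R dir (a + pi / 2)"
    "dir (a + b) = cos b *\<^sub>R dir a + sin b *\<^sub>R dir (a + pi / 2)" for a b
    by (intro plane_eqI; simp add: cos_add cos_diff sin_add sin_diff)+
  show "corner n j = cos ?x *\<^sub>R side_normal n j - sin ?x *\<^sub>R side_tangent n j"
    using d(1)[of "side_angle n j" ?x]
    by (simp add: corner_def side_normal_def side_tangent_def side_angle_def algebra_simps)
  show "corner n (j + 1) = cos ?x *\<^sub>R side_normal n j + sin ?x *\<^sub>R side_tangent n j"
    using d(2)[of "side_angle n j" ?x]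
    by (simp add: corner_def side_normal_def side_tangent_def side_angle_def algebra_simps)
qed

text \<open>
  For the converse, a point lies in the cone over some side \<open>j\<close>, hence is \<open>p\<close> times corner \<open>j\<close> plus
  \<open>q\<close> times corner \<open>j + 1\<close> with nonnegative \<open>p\<close> and \<open>q\<close>; the inequality for this one side says
  \<open>p + q \<le> 1\<close>.
\<close>
lemma in_polygon_iff:
  "y \<in> regular_polygon n \<longleftrightarrow> (\<forall>j. y \<bullet> side_normal n j \<le> cos (half_angle n))"
proof
  assume "\<forall>j. y \<bullet> side_normal n j \<le> cos (half_angle n)"
  then have H: "y \<bullet> side_normal n j \<le> cos (half_angle n)" for j by blast
  let ?x = "half_angle n"
  obtain t where t: "y = norm y *\<^sub>R dir t" by (rule polar_form)
  define j where "j = \<lfloor>t / (2 * ?x)\<rfloor>"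
  have x: "?x > 0" by (rule angle_pos)
  have j1: "2 * of_int j * ?x \<le> t" "t \<le> 2 * (of_int j + 1) * ?x"
  proof -
    have "of_int j \<le> t / (2 * ?x)" "t / (2 * ?x) \<le> of_int j + 1" unfolding j_def by linarith+
    then show "2 * of_int j * ?x \<le> t" "t \<le> 2 * (of_int j + 1) * ?x"
      using x by (simp_all add: field_simps)
  qed
  let ?A = "2 * of_int j * ?x" and ?B = "2 * (of_int j + 1) * ?x"
  have s2: "sin (2 * ?x) > 0" using angle_bounds by (intro sin_gt_zero) auto
  have AB: "?B - ?A = 2 * ?x" by (simp add: algebra_simps)
  \<comment> \<open>the sine rule for the parallelogram with sides along \<open>dir (t - a)\<close> and \<open>dir (t + b)\<close>\<close>
  have id: "sin (a + b) *\<^sub>R dir t = sin b *\<^sub>R dir (t - a) + sin a *\<^sub>R dir (t + b)" for a b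
    by (intro plane_eqI) (simp_all add: sin_add sin_diff cos_add cos_diff algebra_simps)
  define p where "p = norm y * sin (?B - t) / sin (2 * ?x)"
  define q where "q = norm y * sin (t - ?A) / sin (2 * ?x)"
  have "y = p *\<^sub>R corner n j + q *\<^sub>R corner n (j + 1)"
  proof -
    have "p *\<^sub>R corner n j + q *\<^sub>R corner n (j + 1)
        = (norm y / sin (2 * ?x)) *\<^sub>R (sin (?B - t) *\<^sub>R dir ?A + sin (t - ?A) *\<^sub>R dir ?B)"
      by (simp add: p_def q_def corner_def algebra_simps)
    also have "\<dots> = (norm y / sin (2 * ?x)) *\<^sub>R (sin (2 * ?x) *\<^sub>R dir t)"
      using id[of "t - ?A" "?B - t"] AB by simp
    also have "\<dots> = y" using s2 t by simp
    finally show ?thesis ..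
  qed
  note y = this
  have "sin (?B - t) \<ge> 0" "sin (t - ?A) \<ge> 0"
    using j1 AB angle_bounds by (intro sin_ge_zero; linarith)+
  then have pq: "p \<ge> 0" "q \<ge> 0" using s2 by (auto simp: p_def q_def)
  have "y \<bullet> side_normal n j = (p + q) * cos ?x"
    unfolding arg_cong[OF y, of "\<lambda>y. y \<bullet> side_normal n j"]
    by (simp add: corner_side[of j] inner_simps distrib_right del: add.commute)
  with H[of j] have "(p + q) * cos ?x \<le> 1 * cos ?x" by simp
  then have "p + q \<le> 1" using cos_angle_pos by simp
  then have "(1 - p - q) *\<^sub>R 0 + p *\<^sub>R corner n j + q *\<^sub>R corner n (j + 1) \<in> convex hull {0, corner n j, corner n (j + 1)}"
    using pq unfolding convex_hull_3
    by (intro CollectI exI[of _ "1 - p - q"] exI[of _ p] exI[of _ q]) auto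
  then have "y \<in> convex hull {0, corner n j, corner n (j + 1)}" using y by simp
  moreover have "convex hull {0, corner n j, corner n (j + 1)} \<subseteq> regular_polygon n"
    using corner_in zero_in_polygon convex_polygon by (intro hull_minimal) auto
  ultimately show "y \<in> regular_polygon n" by blast
qed (simp add: polygon_below_side)

lemma interior_polygon:
  "interior (regular_polygon n) = {y. \<forall>j. y \<bullet> side_normal n j < cos (half_angle n)}"
proof
  show "interior (regular_polygon n) \<subseteq> {y. \<forall>j. y \<bullet> side_normal n j < cos (half_angle n)}"
  proof clarify
    fix y j assume y: "y \<in> interior (regular_polygon n)"
    have "regular_polygon n \<subseteq> {y. side_normal n j \<bullet> y \<le> cos (half_angle n)}"
      using polygon_below_side by (auto simp: inner_commute)
    then have "y \<in> interior {y. side_normal n j \<bullet> y \<le> cos (half_angle n)}"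
      using y interior_mono by blast
    moreover have "side_normal n j \<noteq> 0" by (simp add: side_normal_def)
    ultimately show "y \<bullet> side_normal n j < cos (half_angle n)"
      using interior_halfspace_le[of "side_normal n j" "cos (half_angle n)"] by (auto simp: inner_commute)
  qed
  let ?O = "\<Inter>i\<in>{0..<int n}. {y. side_normal n i \<bullet> y < cos (half_angle n)}"
  have "{y. \<forall>j. y \<bullet> side_normal n j < cos (half_angle n)} = ?O"
  proof (intro set_eqI iffI)
    fix y assume "y \<in> ?O"
    then have "y \<bullet> side_normal n (j mod int n) < cos (half_angle n)" for j
      using n3 by (auto simp: inner_commute)
    then show "y \<in> {y. \<forall>j. y \<bullet> side_normal n j < cos (half_angle n)}"
      by (simp add: side_normal_mod)
  qed (auto simp: inner_commute)
  moreover have "open ?O" by (intro open_INT ballI open_halfspace_lt) auto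
  moreover have "{y. \<forall>j. y \<bullet> side_normal n j < cos (half_angle n)} \<subseteq> regular_polygon n"
    by (auto simp: in_polygon_iff less_imp_le)
  ultimately show "{y. \<forall>j. y \<bullet> side_normal n j < cos (half_angle n)} \<subseteq> interior (regular_polygon n)"
    by (simp add: interior_maximal)
qed

lemma frontier_polygon:
  "q \<in> frontier (regular_polygon n) \<longleftrightarrow>
     q \<in> regular_polygon n \<and> (\<exists>j. q \<bullet> side_normal n j = cos (half_angle n))"
  unfolding frontier_def interior_polygon using compact_polygon
  by (auto simp: compact_imp_closed in_polygon_iff not_less intro: antisym order_refl eq_refl[OF sym])

end

section \<open>Perimeters of closed polygons\<close>

lemma sum_periodic_shift:
  fixes f :: "int \<Rightarrow> 'a::ab_group_add"
  assumes "f (int m) = f 0"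
  shows "(\<Sum>i<m. f (int i + 1)) = (\<Sum>i<m. f (int i))"
proof -
  have "(\<Sum>i<m. f (int i + 1)) + f 0 = (\<Sum>i<Suc m. f (int i))"
    by (subst sum.lessThan_Suc_shift) (simp add: add.commute)
  then show ?thesis using assms by simp
qed

text \<open>
  Of the axioms of a metric, only these two are kept: \<open>D a b\<close> will be the Euclidean distance, but also
  \<open>h (a - b)\<close> for the support function \<open>h\<close> of a body, which is not symmetric in general and may be
  negative.
\<close>
locale closed_polygon =
  fixes D :: "'a \<Rightarrow> 'a \<Rightarrow> real" and s :: "nat \<Rightarrow> 'a" and m :: nat
  assumes triangle: "D x z \<le> D x y + D y z"
    and D_refl: "D x x = 0"
    and closed: "s m = s 0"
begin

abbreviation perimeter :: real where
  "perimeter \<equiv> \<Sum>i<m. D (s i) (s (Suc i))"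

lemma chain: "i \<le> j \<Longrightarrow> D (s i) (s j) \<le> (\<Sum>l=i..<j. D (s l) (s (Suc l)))"
proof (induction j rule: dec_induct)
  case (step j)
  then show ?case using triangle[of "s i" "s (Suc j)" "s j"] by simp
qed (simp add: D_refl)

lemma sorted_triple:
  assumes "i \<le> j" "j \<le> k" "k \<le> m"
  shows "D (s i) (s j) + D (s j) (s k) + D (s k) (s i) \<le> perimeter"
proof -
  let ?S = "\<lambda>a b. \<Sum>l=a..<b. D (s l) (s (Suc l))"
  have "D (s k) (s i) \<le> D (s k) (s m) + D (s 0) (s i)"
    using triangle closed by metis
  also have "\<dots> \<le> ?S k m + ?S 0 i" using assms by (intro add_mono chain) auto
  finally have "D (s i) (s j) + D (s j) (s k) + D (s k) (s i) \<le> ?S i j + ?S j k + (?S k m + ?S 0 i)"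
    using assms by (intro add_mono chain) auto
  also have "\<dots> = ?S 0 m"
    using sum.atLeastLessThan_concat[of 0 i m "\<lambda>l. D (s l) (s (Suc l))"]
      sum.atLeastLessThan_concat[of i j m "\<lambda>l. D (s l) (s (Suc l))"]
      sum.atLeastLessThan_concat[of j k m "\<lambda>l. D (s l) (s (Suc l))"] assms by linarith
  finally show ?thesis by (simp add: lessThan_atLeast0)
qed

lemma pair:
  assumes "i \<le> m" "j \<le> m"
  shows "D (s i) (s j) + D (s j) (s i) \<le> perimeter"
  using sorted_triple[of i j j] sorted_triple[of j i i] assms by (cases "i \<le> j") (auto simp: D_refl)

text \<open>
  The cyclic order in which a polygon visits three of its vertices is not known in advance, and \<open>D\<close>
  need not be symmetric: hence the disjunction.
\<close>
lemma triple:
  assumes "i \<le> m" "j \<le> m" "k \<le> m"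
  shows "D (s i) (s j) + D (s j) (s k) + D (s k) (s i) \<le> perimeter \<or>
         D (s i) (s k) + D (s k) (s j) + D (s j) (s i) \<le> perimeter"
  using assms sorted_triple[of i j k] sorted_triple[of i k j] sorted_triple[of j i k]
    sorted_triple[of j k i] sorted_triple[of k i j] sorted_triple[of k j i]
  by linarith

end

section \<open>The polygon of directions of a closed billiard orbit\<close>

definition step_dir :: "(int \<Rightarrow> plane) \<Rightarrow> int \<Rightarrow> plane" where
  "step_dir q i = (q (i + 1) - q i) /\<^sub>R norm (q (i + 1) - q i)"

lemma closes_after_bounces: "closes_after q n \<Longrightarrow> closes_after q (bounces q)"
  unfolding bounces_def by (rule LeastI)

lemma periodic_mult:
  fixes f :: "int \<Rightarrow> 'a"
  assumes "\<And>i. f (i + int m) = f i"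
  shows "f (i + int m * k) = f i"
proof (induction k rule: int_induct[of _ 0])
  case (step1 k)
  then show ?case using assms[of "i + int m * k"] by (simp add: algebra_simps)
next
  case (step2 k)
  then show ?case using assms[of "i + int m * (k - 1)"] by (simp add: algebra_simps)
qed simp

lemma periodic_mod:
  fixes f :: "int \<Rightarrow> 'a"
  assumes "\<And>i. f (i + int m) = f i"
  shows "f (i mod int m) = f i"
  using periodic_mult[of f m "i mod int m" "i div int m", OF assms] by simp

lemma periodic_index:
  fixes f :: "int \<Rightarrow> 'a"
  assumes "\<And>i. f (i + int m) = f i" "m > 0"
  obtains k where "k < m" "f i = f (int k)"
proof
  show "nat (i mod int m) < m" using assms(2) by (simp add: nat_less_iff)
  show "f i = f (int (nat (i mod int m)))" using assms(2) periodic_mod[of f m i, OF assms(1)] by simp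
qed

lemma int_invariant:
  fixes g :: "int \<Rightarrow> 'a"
  assumes "\<And>k. g (k + 1) = g k"
  shows "g k = g l"
proof -
  have "g k = g 0" for k
  proof (induction k rule: int_induct[of _ 0])
    case (step2 k)
    then show ?case using assms[of "k - 1"] by simp
  qed (use assms in auto)
  then show ?thesis by metis
qed

lemma periodic_switch:
  fixes P :: "int \<Rightarrow> bool"
  assumes "\<And>i. P (i + int m) = P i" "m > 0" "P a" "\<not> P b"
  obtains i where "P (i - 1)" "\<not> P i"
proof (rule ccontr)
  assume no: "\<not> thesis"
  have step: "P i" if "P (i - 1)" for i using no \<open>\<And>i. \<lbrakk>P (i - 1); \<not> P i\<rbrakk> \<Longrightarrow> thesis\<close> that by blast
  have up: "P (a + int k)" for k
  proof (induction k)
    case (Suc k)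
    then show ?case using step[of "a + int (Suc k)"] by (simp add: algebra_simps)
  qed (use assms in simp)
  \<comment> \<open>a translate of \<open>b\<close> by a multiple of the period lies to the right of \<open>a\<close>\<close>
  have "P (b + int m * \<bar>a - b\<bar>)"
  proof -
    have "\<bar>a - b\<bar> * 1 \<le> \<bar>a - b\<bar> * int m" using assms(2) by (intro mult_left_mono) auto
    then have "a \<le> b + int m * \<bar>a - b\<bar>" by (simp add: mult.commute)
    then show ?thesis using up[of "nat (b + int m * \<bar>a - b\<bar> - a)"] by simp
  qed
  then show False using periodic_mult[of P m b "\<bar>a - b\<bar>", OF assms(1)] assms(4) by simp
qed

lemma discrete_ivt:
  fixes f :: "int \<Rightarrow> real"
  assumes "f a \<le> t" "t \<le> f (a + int k)"
  obtains i where "f i \<le> t" "t \<le> f (i + 1)" | "f a = t"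
proof -
  have "f a = t \<or> (\<exists>i. f i \<le> t \<and> t \<le> f (i + 1))"
    using assms
  proof (induction k)
    case (Suc k)
    show ?case
    proof (cases "t \<le> f (a + int k)")
      case False
      then show ?thesis using Suc.prems
        by (intro disjI2 exI[of _ "a + int k"]) (simp add: algebra_simps)
    qed (use Suc in blast)
  qed simp
  then show thesis using that by blast
qed

lemma closed_segment_on_line:
  fixes G v :: "'a::real_vector"
  shows "closed_segment (G + a *\<^sub>R v) (G + b *\<^sub>R v) = (\<lambda>t. G + t *\<^sub>R v) ` closed_segment a b"
proof -
  have "closed_segment (G + a *\<^sub>R v) (G + b *\<^sub>R v) = (+) G ` ((\<lambda>t. t *\<^sub>R v) ` closed_segment a b)"
    using closed_segment_translation[of G "a *\<^sub>R v" "b *\<^sub>R v"]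
      closed_segment_linear_image[of "\<lambda>t. t *\<^sub>R v" a b] by (simp add: linear_scaleR_left)
  then show ?thesis by (simp add: image_image)
qed

locale closed_billiard =
  fixes T :: "plane set" and q :: "int \<Rightarrow> plane"
  assumes compact_T: "compact T" and closed_orbit: "q \<in> closed_orbits T"
begin

abbreviation m :: nat where "m \<equiv> bounces q"
abbreviation u :: "int \<Rightarrow> plane" where "u \<equiv> step_dir q"
abbreviation hT :: "plane \<Rightarrow> real" where "hT \<equiv> support_fun T"

lemma orbit: "billiard_orbit T q"
  using closed_orbit by (simp add: closed_orbits_def)

lemma q_distinct: "q (i + 1) \<noteq> q i"
  using orbit by (metis billiard_orbit_def)

lemma q_frontier: "q i \<in> frontier T"
  using orbit by (simp add: billiard_orbit_def)

lemma q_in: "q i \<in> T"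
  using q_frontier compact_T frontier_subset_eq compact_imp_closed by blast

lemma T_nonempty: "T \<noteq> {}"
  using q_in by blast

lemma closes: "closes_after q m"
  using closed_orbit closes_after_bounces by (auto simp: closed_orbits_def)

lemma m_ge: "m \<ge> 2"
  using closes by (simp add: closes_after_def)

lemma q_periodic: "q (i + int m) = q i"
  using closes by (simp add: closes_after_def)

lemma u_periodic: "u (i + int m) = u i"
  using q_periodic[of i] q_periodic[of "i + 1"] by (simp add: step_dir_def algebra_simps)

lemma norm_u: "norm (u i) = 1"
  using q_distinct by (simp add: step_dir_def)

lemma step: "q (i + 1) - q i = norm (q (i + 1) - q i) *\<^sub>R u i"
  using q_distinct by (simp add: step_dir_def)

lemma support_vector:
  "y \<in> T \<Longrightarrow> y \<bullet> (u (i - 1) - u i) \<le> q i \<bullet> (u (i - 1) - u i)"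
proof -
  assume y: "y \<in> T"
  have "u (i - 1) - u i = (q i - q (i - 1)) /\<^sub>R norm (q i - q (i - 1)) + (q i - q (i + 1)) /\<^sub>R norm (q i - q (i + 1))"
    by (simp add: step_dir_def norm_minus_commute scaleR_right_diff_distrib)
  moreover have "outward_support_vector T (q i) \<dots>" using orbit by (simp add: billiard_orbit_def)
  ultimately show ?thesis using y by (auto simp: outward_support_vector_def inner_diff_left)
qed

lemma support_value: "hT (u (i - 1) - u i) = q i \<bullet> (u (i - 1) - u i)"
  using support_fun_eq[OF q_in support_vector] by blast

lemma sum_normals: "(\<Sum>i<m. u (int i - 1) - u (int i)) = 0"
  using sum_periodic_shift[of "\<lambda>i. u (i - 1)" m] u_periodic[of "-1"]
  by (simp add: sum_subtractf)

text \<open>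
  Summation by parts: each step contributes the inner product of \<open>q (i + 1) - q i\<close> with its own
  direction.
\<close>
lemma length_support: "orbit_length q = (\<Sum>i<m. q (int i) \<bullet> (u (int i - 1) - u (int i)))"
proof -
  have n: "norm (q (i + 1) - q i) = q (i + 1) \<bullet> u i - q i \<bullet> u i" for i
  proof -
    have "(q (i + 1) - q i) \<bullet> u i = norm (q (i + 1) - q i) * (u i \<bullet> u i)"
      using step[of i] by (metis inner_scaleR_left)
    then show ?thesis using norm_u[of i] by (simp add: inner_diff_left dot_square_norm)
  qed
  have "(\<Sum>i<m. q (int i + 1) \<bullet> u (int i)) = (\<Sum>i<m. q (int i) \<bullet> u (int i - 1))"
    using sum_periodic_shift[of "\<lambda>i. q i \<bullet> u (i - 1)" m] u_periodic[of "-1"] q_periodic[of 0] by simp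
  then show ?thesis unfolding orbit_length_def n by (simp add: sum_subtractf inner_diff_right)
qed

text \<open>
  Since the bounce vectors are support vectors, the inner products in the previous sum are values of
  the support function.  The points of the orbit disappear: its length is the perimeter of the polygon
  formed by its directions on the unit circle, measured by the support function of \<open>T\<close>.
\<close>
lemma length_dual: "orbit_length q = (\<Sum>i<m. hT (u (int i) - u (int i + 1)))"
proof -
  have "orbit_length q = (\<Sum>i<m. hT (u (int i - 1) - u (int i)))"
    by (simp add: length_support support_value)
  also have "\<dots> = (\<Sum>i<m. hT (u (int i) - u (int i + 1)))"
    using sum_periodic_shift[of "\<lambda>i. hT (u (i - 1) - u i)" m] u_periodic[of 0] u_periodic[of "-1"] by simp
  finally show ?thesis .
qed

lemma length_pos: "orbit_length q > 0"
  unfolding orbit_length_def using m_ge q_distinct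
  by (intro sum_pos) (auto simp: lessThan_empty_iff)

lemma zero_in_hull_directions: "0 \<in> convex hull (range u)"
proof -
  let ?w = "\<lambda>i. norm (q (int i + 1) - q (int i)) / orbit_length q"
  have "(\<Sum>i<m. ?w i *\<^sub>R u (int i)) \<in> convex hull (range u)"
  proof (rule convex_sum)
    show "(\<Sum>i<m. ?w i) = 1"
      using length_pos by (simp add: orbit_length_def flip: sum_divide_distrib)
  qed (use length_pos in \<open>auto intro: hull_inc\<close>)
  moreover have "(\<Sum>i<m. ?w i *\<^sub>R u (int i)) = (1 / orbit_length q) *\<^sub>R (\<Sum>i<m. q (int i + 1) - q (int i))"
    by (subst step) (simp add: scaleR_sum_right)
  moreover have "(\<Sum>i<m. q (int i + 1) - q (int i)) = 0"
    using sum_periodic_shift[of q m] q_periodic[of 0] by (simp add: sum_subtractf)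
  ultimately show ?thesis by simp
qed

sublocale dual: closed_polygon "\<lambda>a b. hT (a - b)" "\<lambda>i. u (int i)" m
proof
  show "hT (a - c) \<le> hT (a - b) + hT (b - c)" for a b c
    using support_fun_add[OF compact_T T_nonempty, of "a - b" "b - c"] by simp
  show "hT (a - a) = 0" for a using support_fun_zero[OF T_nonempty] by simp
  show "u (int m) = u (int 0)" using u_periodic[of 0] by simp
qed

lemma dual_perimeter: "(\<Sum>i<m. hT (u (int i) - u (int (Suc i)))) = orbit_length q"
  by (simp add: length_dual add.commute)

lemma length_ge_pair:
  "hT (u i - u j) + hT (u j - u i) \<le> orbit_length q"
proof -
  obtain i' where i: "i' < m" "u i = u (int i')"
    using periodic_index[of u m i, OF u_periodic] m_ge by auto
  obtain j' where j: "j' < m" "u j = u (int j')"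
    using periodic_index[of u m j, OF u_periodic] m_ge by auto
  show ?thesis using dual.pair[of i' j'] i j dual_perimeter by simp
qed

lemma length_ge_triple:
  "hT (u i - u j) + hT (u j - u k) + hT (u k - u i) \<le> orbit_length q \<or>
   hT (u i - u k) + hT (u k - u j) + hT (u j - u i) \<le> orbit_length q"
proof -
  obtain i' where i: "i' < m" "u i = u (int i')"
    using periodic_index[of u m i, OF u_periodic] m_ge by auto
  obtain j' where j: "j' < m" "u j = u (int j')"
    using periodic_index[of u m j, OF u_periodic] m_ge by auto
  obtain k' where k: "k' < m" "u k = u (int k')"
    using periodic_index[of u m k, OF u_periodic] m_ge by auto
  show ?thesis using dual.triple[of i' j' k'] i j k dual_perimeter by simp
qed

text \<open>
  By Caratheodory's theorem at most three directions already contain 0 in their convex hull.  Two unit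
  vectors do so only if they are antipodal, and together with an antipodal pair any further direction
  gives a triple.
\<close>
lemma antipodal_pair_or_triple:
  obtains (pair) v where "norm v = 1" "range u = {v, - v}"
  | (triple) i j k where "u i \<noteq> u j" "u j \<noteq> u k" "u k \<noteq> u i" "0 \<in> convex hull {u i, u j, u k}"
proof (cases "\<exists>i j k. u i \<noteq> u j \<and> u j \<noteq> u k \<and> u k \<noteq> u i \<and> 0 \<in> convex hull {u i, u j, u k}")
  case False
  have "0 \<in> {y. \<exists>S. finite S \<and> S \<subseteq> range u \<and> card S \<le> DIM(plane) + 1 \<and> y \<in> convex hull S}"
    using zero_in_hull_directions by (subst (asm) caratheodory)
  then obtain S where S: "finite S" "S \<subseteq> range u" "card S \<le> 3" "0 \<in> convex hull S" by auto
  have norm_S: "norm x = 1" if "x \<in> S" for x using that S(2) norm_u by auto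
  then have nz: "x \<noteq> 0" if "x \<in> S" for x using that by fastforce
  have "card S \<noteq> 0" using S by auto
  moreover have "card S \<noteq> 1"
    using S nz by (auto simp: card_1_singleton_iff)
  moreover have "card S \<noteq> 3"
  proof
    assume "card S = 3"
    then obtain x y z where xyz: "S = {x, y, z}" "x \<noteq> y" "y \<noteq> z" "z \<noteq> x"
      by (metis card_3_iff)
    then obtain i j k where "x = u i" "y = u j" "z = u k" using S(2) by auto
    then show False using False xyz S(4) by metis
  qed
  ultimately have "card S = 2" using S(3) by linarith
  then obtain x y where xy: "S = {x, y}" "x \<noteq> y" by (meson card_2_iff)
  \<comment> \<open>two unit vectors with a vanishing convex combination have equal weights\<close>
  then obtain t where t: "0 \<le> t" "t \<le> 1" "(1 - t) *\<^sub>R x + t *\<^sub>R y = 0"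
    using S(4) by (auto simp: closed_segment_def simp flip: segment_convex_hull)
  have n: "norm x = 1" "norm y = 1" using norm_S xy by auto
  have e: "(1 - t) *\<^sub>R x = - (t *\<^sub>R y)" using t(3) by (simp add: eq_neg_iff_add_eq_0)
  then have "norm ((1 - t) *\<^sub>R x) = norm (t *\<^sub>R y)" by simp
  then have "1 - t = t" using n t by simp
  then have "t = 1/2" by simp
  with e have "2 *\<^sub>R ((1/2) *\<^sub>R x) = 2 *\<^sub>R (- ((1/2) *\<^sub>R y))" by simp
  then have yx: "y = - x" by (simp only: scaleR_minus_right scaleR_scaleR) simp
  have xr: "x \<in> range u" "y \<in> range u" using S(2) xy by auto
  have "range u \<subseteq> {x, - x}"
  proof (rule ccontr)
    assume "\<not> range u \<subseteq> {x, - x}"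
    then obtain i where i: "u i \<noteq> - x" "u i \<noteq> x" by blast
    obtain j k where "x = u j" "y = u k" using xr by auto
    moreover have "0 \<in> convex hull {u i, x, y}"
      using S(4) hull_mono[of "{x, y}" "{u i, x, y}" convex] xy(1) by blast
    ultimately show False using False i xy(2) yx by metis
  qed
  then have "range u = {x, - x}" using xr yx by auto
  then show thesis using pair n by blast
qed (use triple in blast)

text \<open>
  If only the directions \<open>v\<close> and \<open>- v\<close> occur, the orbit moves on one line and turns round only where
  \<open>T\<close> ends in direction \<open>v\<close> or \<open>- v\<close>.  It may contain further bounce points in between, if the line runs
  along the boundary of \<open>T\<close> (as on a square); so the trace is determined by an intermediate value
  argument instead of by listing the bounce points.
\<close>
lemma bouncing_ball_trace:
  assumes v: "norm v = 1" "range u = {v, - v}"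
  obtains A B where "A \<in> T" "B \<in> T" "A \<bullet> v = hT v" "B \<bullet> (- v) = hT (- v)"
    "A - B = (hT v + hT (- v)) *\<^sub>R v" "orbit_trace q = closed_segment A B"
proof -
  have vv: "v \<bullet> v = 1" using v by (simp add: dot_square_norm)
  have nv: "v \<noteq> - v" using v(1) vv by (metis inner_minus_right neg_equal_zero zero_neq_one)
  have cases: "u i = v \<or> u i = - v" for i using v(2) by blast
  have per: "(u (i + int m) = w) = (u i = w)" for i w using u_periodic by simp
  obtain a b where "u a = v" "u b = - v" using v(2) by (metis insertI1 insert_commute rangeE)
  then obtain i j where i: "u (i - 1) = v" "u i \<noteq> v" and j: "u (j - 1) = - v" "u j \<noteq> - v"
    using periodic_switch[of "\<lambda>i. u i = v" m a b, OF per] m_ge nv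
      periodic_switch[of "\<lambda>i. u i = - v" m b a, OF per] by (metis less_le_trans zero_less_numeral)
  have i': "u i = - v" and j': "u j = v" using cases i j by blast+
  have two: "hT (2 *\<^sub>R w) = 2 * hT w" for w
    using support_fun_scale[OF compact_T T_nonempty] by simp
  \<comment> \<open>the bounce vector at a turning point is \<open>2 *\<^sub>R w\<close>\<close>
  have turn: "q k \<bullet> w = hT w" if "u (k - 1) = w" "u k = - w" for k w
  proof -
    have "u (k - 1) - u k = 2 *\<^sub>R w" unfolding that scaleR_2 by simp
    then have "hT (2 *\<^sub>R w) = q k \<bullet> (2 *\<^sub>R w)" using support_value[of k] by metis
    then show ?thesis unfolding two inner_scaleR_right by linarith
  qed
  have A: "q i \<bullet> v = hT v" using turn[of i v] i(1) i' by blast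
  have B: "q j \<bullet> (- v) = hT (- v)" using turn[of j "- v"] j(1) j' by simp
  define f where "f k = q k \<bullet> v" for k
  define G where "G = q 0 - f 0 *\<^sub>R v"
  \<comment> \<open>\<open>G\<close> is the component orthogonal to \<open>v\<close>, which no step changes\<close>
  have line: "q k = G + f k *\<^sub>R v" for k
  proof -
    have "q (k + 1) - f (k + 1) *\<^sub>R v = q k - f k *\<^sub>R v" for k
    proof -
      obtain c where "q (k + 1) - q k = c *\<^sub>R v"
        using step[of k] cases[of k] by (metis scaleR_minus_left scaleR_minus_right)
      then have "q (k + 1) = q k + c *\<^sub>R v" by (simp add: algebra_simps)
      then show ?thesis by (simp add: f_def inner_add_left vv algebra_simps)
    qed
    then have "q k - f k *\<^sub>R v = G" unfolding G_def by (rule int_invariant)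
    then show ?thesis by (simp add: algebra_simps)
  qed
  have f_bounds: "- hT (- v) \<le> f k" "f k \<le> hT v" for k
    using support_fun_ge[OF compact_T q_in, of k v] support_fun_ge[OF compact_T q_in, of k "- v"]
    by (auto simp: f_def)
  have fi: "f i = hT v" and fj: "f j = - hT (- v)" using A B by (auto simp: f_def)
  note seg = closed_segment_on_line[of G _ v]
  have trace: "orbit_trace q = closed_segment (q i) (q j)"
  proof
    have "q k \<in> closed_segment (q i) (q j)" for k
    proof -
      have "f k \<in> closed_segment (f i) (f j)"
        unfolding fi fj using f_bounds[of k] by (auto simp: closed_segment_eq_real_ivl)
      then show ?thesis unfolding line[of i] line[of j] seg using line[of k] by blast
    qed
    then show "orbit_trace q \<subseteq> closed_segment (q i) (q j)"
      unfolding orbit_trace_def by (simp add: UN_subset_iff subset_closed_segment)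
    show "closed_segment (q i) (q j) \<subseteq> orbit_trace q"
    proof
      fix z assume "z \<in> closed_segment (q i) (q j)"
      then obtain t where t: "z = G + t *\<^sub>R v" "t \<in> closed_segment (f i) (f j)"
        unfolding line[of i] line[of j] seg by blast
      then have t2: "f j \<le> t" "t \<le> f i"
        using f_bounds(1)[of i] fj by (auto simp: closed_segment_eq_real_ivl split: if_splits)
      \<comment> \<open>the turning point \<open>i\<close>, repeated at an index not before \<open>j\<close>\<close>
      let ?i = "i + int m * \<bar>j - i\<bar>"
      have "q ?i = q i" using q_periodic by (rule periodic_mult)
      then have "f ?i = f i" by (simp add: f_def)
      moreover have "\<bar>j - i\<bar> * 1 \<le> \<bar>j - i\<bar> * int m" using m_ge by (intro mult_left_mono) auto
      then have "j \<le> ?i" by (simp add: mult.commute)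
      then have "?i = j + int (nat (?i - j))" by simp
      ultimately have "t \<le> f (j + int (nat (?i - j)))" using t2 by simp
      then consider k where "f k \<le> t" "t \<le> f (k + 1)" | "f j = t"
        using discrete_ivt[of f j t, OF t2(1)] by blast
      then have "\<exists>k. t \<in> closed_segment (f k) (f (k + 1))"
      proof cases
        case (1 k)
        then have "t \<in> closed_segment (f k) (f (k + 1))" by (simp add: closed_segment_eq_real_ivl)
        then show ?thesis by blast
      next
        case 2
        then have "t \<in> closed_segment (f j) (f (j + 1))" by simp
        then show ?thesis by blast
      qed
      then obtain k where "t \<in> closed_segment (f k) (f (k + 1))" by blast
      then have "z \<in> closed_segment (q k) (q (k + 1))"
        unfolding line[of k] line[of "k + 1"] seg using t by blast
      then show "z \<in> orbit_trace q" by (auto simp: orbit_trace_def)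
    qed
  qed
  have "q i - q j = (hT v + hT (- v)) *\<^sub>R v"
    unfolding line[of i] line[of j] fi fj by (simp add: algebra_simps)
  then show thesis using that[OF q_in q_in A B] trace by blast
qed

text \<open>
  A lower bound for digons and triangles of directions bounds every closed orbit, by the triangle
  inequality for the support function.  As the bound for triangles is strict, orbits that attain it use
  one antipodal pair of directions only.
\<close>
theorem length_lower_bound:
  assumes wide: "\<And>v. norm v = 1 \<Longrightarrow> w \<le> hT v + hT (- v)"
    and triples: "\<And>a b c. \<lbrakk>norm a = 1; norm b = 1; norm c = 1; a \<noteq> b; b \<noteq> c; c \<noteq> a;
        0 \<in> convex hull {a, b, c}\<rbrakk> \<Longrightarrow> 2 * w < hT (a - b) + hT (b - c) + hT (c - a)"
  shows "2 * w \<le> orbit_length q"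
    and "orbit_length q = 2 * w \<Longrightarrow> \<exists>v. norm v = 1 \<and> range u = {v, - v} \<and> hT v + hT (- v) = w"
proof -
  have *: "2 * w < orbit_length q \<or>
     (\<exists>v. norm v = 1 \<and> range u = {v, - v} \<and> 2 * (hT v + hT (- v)) \<le> orbit_length q)"
  proof (cases rule: antipodal_pair_or_triple)
    case (pair v)
    then obtain i j where ij: "u i = v" "u j = - v" by (metis insertI1 insert_commute rangeE)
    have "hT (2 *\<^sub>R v) = 2 * hT v" "hT (2 *\<^sub>R (- v)) = 2 * hT (- v)" for v
      by (rule support_fun_scale[OF compact_T T_nonempty], simp)+
    then have "2 * (hT v + hT (- v)) \<le> orbit_length q"
      using length_ge_pair[of i j] ij by (simp add: scaleR_2)
    then show ?thesis using pair by blast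
  next
    case (triple i j k)
    have "{u i, u k, u j} = {u i, u j, u k}" by blast
    then show ?thesis
      using length_ge_triple[of i j k] triples[of "u i" "u j" "u k"] triples[of "u i" "u k" "u j"]
        triple norm_u by fastforce
  qed
  then show "2 * w \<le> orbit_length q" using wide by fastforce
  show "\<exists>v. norm v = 1 \<and> range u = {v, - v} \<and> hT v + hT (- v) = w" if "orbit_length q = 2 * w"
    using * that wide by fastforce
qed

end

section \<open>Triangles of directions\<close>

lemma dir_near:
  assumes "norm (w::plane) = 1"
  obtains t where "w = dir (a + t)" "- pi < t" "t \<le> pi"
proof -
  obtain b where b: "w = dir b" using assms by (rule unit_vector_dir)
  define k where "k = \<lceil>(b - a - pi) / (2 * pi)\<rceil>"
  have "(b - a - pi) / (2 * pi) \<le> of_int k" "of_int k < (b - a - pi) / (2 * pi) + 1"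
    unfolding k_def by linarith+
  then have "b - a - pi \<le> 2 * pi * of_int k" "2 * pi * of_int k < b - a - pi + 2 * pi"
    using pi_gt_zero by (simp_all add: field_simps)
  moreover have "w = dir (a + (b - a - 2 * pi * of_int k))"
    using b dir_add_period[of b "- k"] by simp
  ultimately show thesis using that[of "b - a - 2 * pi * of_int k"] by simp
qed

lemma cos_half_abs: "cos (\<bar>y\<bar> / 2) = cos (y / 2 :: real)"
  using cos_abs_real[of "y / 2"] by (simp only: abs_divide abs_numeral)

lemma one_plus_cos_add_le:
  assumes "0 \<le> p" "0 \<le> q" "p + q \<le> (pi::real)"
  shows "1 + cos (p + q) \<le> cos p + cos q"
proof -
  have "cos ((p + q) / 2) \<le> cos \<bar>(p - q) / 2\<bar>"
    using assms by (intro cos_monotone_0_pi_le) auto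
  then have "cos ((p + q) / 2) \<le> cos ((p - q) / 2)" by (simp only: cos_abs_real)
  moreover have "0 \<le> cos ((p + q) / 2)" using assms by (intro cos_ge_zero) auto
  ultimately have "2 * cos ((p + q) / 2) * cos ((p + q) / 2) \<le> 2 * cos ((p + q) / 2) * cos ((p - q) / 2)"
    by (intro mult_left_mono) auto
  moreover have "cos p + cos q = 2 * cos ((p + q) / 2) * cos ((p - q) / 2)" by (rule cos_plus_cos)
  moreover have "1 + cos (p + q) = 2 * cos ((p + q) / 2) * cos ((p + q) / 2)"
    using cos_double_cos[of "(p + q) / 2"] by (simp add: power2_eq_square add_divide_distrib distrib_left)
  ultimately show ?thesis by simp
qed

text \<open>
  Here \<open>s\<close> and \<open>t\<close> are the signed angles of two unit vectors, measured from a ray that contains a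
  positive combination of them.  They lie on different sides of the ray and less than a half turn apart.
\<close>
lemma opposite_signs:
  fixes s t p q :: real
  assumes s: "0 < s" "s < pi" and t: "- pi < t" "t \<le> pi" and pq: "0 < p" "0 < q"
    and sn: "p * sin s + q * sin t = 0" and cs: "0 \<le> p * cos s + q * cos t"
  shows "t < 0" "s - t \<le> pi"
proof -
  have "sin s > 0" using s by (rule sin_gt_zero)
  then have neg: "p * sin s > 0" "q * sin t < 0" using mult_pos_pos[OF pq(1)] sn by fastforce+
  then have "sin t < 0" using pq by (simp add: mult_less_0_iff)
  then show t0: "t < 0" using t sin_ge_zero[of t] by force
  have "sin (- t) > 0" using t t0 by (intro sin_gt_zero) auto
  then have "0 \<le> (p * cos s + q * cos t) * sin (- t)" using cs by (intro mult_nonneg_nonneg) auto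
  also have "\<dots> = p * cos s * sin (- t) - (q * sin t) * cos t" by (simp add: algebra_simps)
  also have "q * sin t = - (p * sin s)" using sn by linarith
  also have "p * cos s * sin (- t) - - (p * sin s) * cos t = p * sin (s - t)"
    by (simp add: sin_diff algebra_simps)
  finally have "0 \<le> sin (s - t)" using pq by (simp add: zero_le_mult_iff)
  moreover have "sin (s - t) < 0" if "s - t > pi"
    using that s t t0 by (intro sin_lt_zero) auto
  ultimately show "s - t \<le> pi" by force
qed

text \<open>
  Measured from \<open>- c\<close>, which lies on the arc between \<open>a\<close> and \<open>b\<close> because 0 is in the hull, the angles of
  \<open>a\<close> and \<open>b\<close> are \<open>s\<close> and \<open>- t\<close> with \<open>s\<close> and \<open>t\<close> of the same sign; the sign is the orientation of the
  triangle.  The central angle \<open>s + t\<close> of the shortest chord is at most a third of the full turn.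
\<close>
lemma shortest_chord_angles:
  fixes a b c :: plane
  assumes unit: "norm a = 1" "norm b = 1" "norm c = 1"
    and distinct: "a \<noteq> b" "b \<noteq> c" "c \<noteq> a"
    and hull: "0 \<in> convex hull {a, b, c}"
    and short: "norm (a - b) \<le> norm (b - c)" "norm (a - b) \<le> norm (c - a)"
  obtains M s t where "c = dir (M + pi)" "a = dir (M + s)" "b = dir (M - t)"
    "0 \<le> s \<and> 0 \<le> t \<or> s \<le> 0 \<and> t \<le> 0" "0 < \<bar>s + t\<bar>" "\<bar>s + t\<bar> \<le> 2 * pi / 3"
proof -
  have "norm (- c) = 1" using unit by simp
  then obtain M where M: "- c = dir M" by (rule unit_vector_dir)
  then have c: "c = dir (M + pi)" unfolding dir_plus_pi by (metis minus_minus)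
  obtain s where s: "a = dir (M + s)" "- pi < s" "s \<le> pi" using dir_near[OF unit(1)] by blast
  obtain t' where t': "b = dir (M + t')" "- pi < t'" "t' \<le> pi" using dir_near[OF unit(2)] by blast
  have sp: "s < pi" "t' < pi" using s t' c distinct by (metis order_less_le)+
  have st: "s \<noteq> t'" using s t' distinct by auto
  obtain p q z where pqz: "0 \<le> p" "0 \<le> q" "0 \<le> z" "p + q + z = 1" "p *\<^sub>R a + q *\<^sub>R b + z *\<^sub>R c = 0"
    using hull by (auto simp: convex_hull_3)
  have "p *\<^sub>R dir (M + s) + q *\<^sub>R dir (M + t') = z *\<^sub>R dir M"
  proof -
    have "p *\<^sub>R a + q *\<^sub>R b = z *\<^sub>R (- c)" using pqz(5) by (simp add: eq_neg_iff_add_eq_0)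
    then show ?thesis by (simp only: s(1) t'(1) M)
  qed
  note eq = arg_cong[OF this, of "\<lambda>y. y \<bullet> dir M"] arg_cong[OF this, of "\<lambda>y. y \<bullet> dir (M + pi / 2)"]
  have cs: "p * cos s + q * cos t' = z"
    using eq(1) by (simp add: inner_add_left inner_dir)
  have sn: "p * sin s + q * sin t' = 0"
    using eq(2) by (simp add: inner_add_left inner_dir cos_diff)
  have zero: "y = 0" if "sin y = 0" "- pi < y" "y < pi" for y :: real
    using that sin_gt_zero[of y] sin_gt_zero[of "- y"] by fastforce
  have main: "(0 \<le> s \<and> t' \<le> 0 \<or> s \<le> 0 \<and> 0 \<le> t') \<and> \<bar>s - t'\<bar> \<le> pi"
  proof (cases "p = 0 \<or> q = 0")
    case True
    then show ?thesis
    proof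
      assume p: "p = 0"
      then have "q \<noteq> 0" using cs pqz by auto
      then have "sin t' = 0" using p sn by simp
      then have "t' = 0" using zero t' sp by simp
      then show ?thesis using s by auto
    next
      assume q: "q = 0"
      then have "p \<noteq> 0" using cs pqz by auto
      then have "sin s = 0" using q sn by simp
      then have "s = 0" using zero s sp by simp
      then show ?thesis using t' by auto
    qed
  next
    case False
    then have pq: "p > 0" "q > 0" using pqz by auto
    have cs0: "0 \<le> p * cos s + q * cos t'" using cs pqz by simp
    consider "s = 0" | "s > 0" | "s < 0" by linarith
    then show ?thesis
    proof cases
      case 1
      then have "sin t' = 0" using sn pq by simp
      then show ?thesis using zero t' sp st 1 by simp
    next
      case 2
      then show ?thesis using opposite_signs[of s t' p q] sp t' pq sn cs0 by auto
    next
      case 3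
      then show ?thesis using opposite_signs[of "- s" "- t'" p q] s sp t' pq sn cs0 by auto
    qed
  qed
  define t where "t = - t'"
  \<comment> \<open>\<open>g\<close> is the angle of the triangle at \<open>c\<close>, half the central angle over the chord from \<open>a\<close> to \<open>b\<close>\<close>
  define g where "g = \<bar>s + t\<bar> / 2"
  have signs: "0 \<le> s \<and> 0 \<le> t \<or> s \<le> 0 \<and> t \<le> 0" and g: "0 < g" "g \<le> pi / 2"
    using main st by (auto simp: t_def g_def)
  have sum: "\<bar>s\<bar> + \<bar>t\<bar> = 2 * g" using signs by (auto simp: g_def)
  have b: "b = dir (M - t)" using t' by (simp add: t_def)
  have "norm (a - b) = 2 * \<bar>sin ((s + t) / 2)\<bar>"
    unfolding s(1) b dir_diff by simp
  moreover have "\<bar>sin ((s + t) / 2)\<bar> = sin g"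
  proof -
    have "sin g \<ge> 0" using g by (intro sin_ge_zero) auto
    moreover have "(s + t) / 2 = g \<or> (s + t) / 2 = - g" by (auto simp: g_def)
    ultimately show ?thesis by auto
  qed
  ultimately have ab: "norm (a - b) = 2 * sin g" by simp
  have half: "cos (y / 2) = sin (pi / 2 - \<bar>y\<bar> / 2)" for y :: real
    by (simp add: sin_diff abs_if)
  have "c = - dir M" using M by (metis minus_minus)
  then have "b - c = dir (M - t) + dir M" "a - c = dir (M + s) + dir M" using b s by auto
  then have bc: "norm (b - c) = 2 * \<bar>cos (t / 2)\<bar>" and ca: "norm (c - a) = 2 * \<bar>cos (s / 2)\<bar>"
    unfolding norm_minus_commute[of c a] dir_sum by simp_all
  have "\<bar>cos (y / 2)\<bar> = sin (pi / 2 - \<bar>y\<bar> / 2)" if "\<bar>y\<bar> \<le> 2 * g" for y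
  proof -
    have "0 \<le> cos (y / 2)" using that g by (intro cos_ge_zero) auto
    then show ?thesis using half[of y] by simp
  qed
  then have "sin g \<le> sin (pi / 2 - \<bar>y\<bar> / 2)" if "y = s \<or> y = t" for y
    using short ab bc ca that sum by force
  then have "g \<le> pi / 2 - \<bar>s\<bar> / 2" "g \<le> pi / 2 - \<bar>t\<bar> / 2"
    using g sum sin_mono_le_eq[of g "pi / 2 - \<bar>s\<bar> / 2"] sin_mono_le_eq[of g "pi / 2 - \<bar>t\<bar> / 2"] by auto
  then have "2 * g \<le> 2 * pi / 3" using sum by linarith
  then show thesis using that[of M s t] c s b signs g by (auto simp: g_def)
qed

lemma rotate_shortest:
  fixes F :: "plane \<Rightarrow> plane \<Rightarrow> real"
  assumes short: "\<And>a b c. \<lbrakk>norm a = 1; norm b = 1; norm c = 1; a \<noteq> b; b \<noteq> c; c \<noteq> a;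
      0 \<in> convex hull {a, b, c}; norm (a - b) \<le> norm (b - c); norm (a - b) \<le> norm (c - a)\<rbrakk>
      \<Longrightarrow> w < F a b + F b c + F c a"
    and abc: "norm a = 1" "norm b = 1" "norm c = 1" "a \<noteq> b" "b \<noteq> c" "c \<noteq> a"
      "0 \<in> convex hull {a, b, c}"
  shows "w < F a b + F b c + F c a"
proof -
  have perm: "{b, c, a} = {a, b, c}" "{c, a, b} = {a, b, c}" by auto
  consider "norm (a - b) \<le> norm (b - c)" "norm (a - b) \<le> norm (c - a)"
    | "norm (b - c) \<le> norm (c - a)" "norm (b - c) \<le> norm (a - b)"
    | "norm (c - a) \<le> norm (a - b)" "norm (c - a) \<le> norm (b - c)" by linarith
  then show ?thesis
  proof cases
    case 1
    then show ?thesis using short[of a b c] abc by simp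
  next
    case 2
    then show ?thesis using short[of b c a] abc perm by simp
  next
    case 3
    then show ?thesis using short[of c a b] abc perm by simp
  qed
qed

lemma sin_plus_cos_gt_one:
  assumes "0 < t" "t < pi / 2"
  shows "1 < sin t + cos (t::real)"
proof -
  have "0 < sin t" "0 < cos t" using assms by (auto intro: sin_gt_zero cos_gt_zero)
  then have "0 < 2 * sin t * cos t" by simp
  moreover have "(sin t + cos t)\<^sup>2 = 1 + 2 * sin t * cos t" by (simp add: power2_sum)
  ultimately have "1\<^sup>2 < (sin t + cos t)\<^sup>2" by simp
  then show ?thesis by (rule power2_less_imp_less) (use \<open>0 < sin t\<close> \<open>0 < cos t\<close> in simp)
qed

text \<open>
  The equation \<open>sin (2 * pi / 5) = sin (3 * pi / 5)\<close> is a quadratic equation for \<open>cos (pi / 5)\<close>.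
\<close>
lemma cos_pi_5_ge: "4 / 5 \<le> cos (pi / 5)"
proof (rule ccontr)
  assume "\<not> 4 / 5 \<le> cos (pi / 5)"
  then have c: "cos (pi / 5) < 4 / 5" by simp
  let ?c = "cos (pi / 5)" and ?s = "sin (pi / 5)"
  have s: "?s > 0" by (intro sin_gt_zero) auto
  have "sin (2 * (pi / 5)) = sin (pi - 2 * (pi / 5))" by (simp only: sin_pi_minus)
  also have "pi - 2 * (pi / 5) = 2 * (pi / 5) + pi / 5" by simp
  also have "sin (2 * (pi / 5) + pi / 5) = 2 * ?s * ?c * ?c + (2 * ?c\<^sup>2 - 1) * ?s"
    by (simp only: sin_add[of "2 * (pi / 5)"] sin_double cos_double_cos)
  finally have "2 * ?s * ?c = 2 * ?s * ?c * ?c + (2 * ?c\<^sup>2 - 1) * ?s" by (simp only: sin_double)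
  then have "?s * (2 * ?c) = ?s * (4 * ?c\<^sup>2 - 1)" by (simp add: power2_eq_square algebra_simps)
  then have "2 * ?c = 4 * ?c\<^sup>2 - 1" using s by simp
  then have "?c * (4 * ?c - 2) = 1" by (simp add: power2_eq_square algebra_simps)
  moreover have "?c > 0" by (intro cos_gt_zero) auto
  then have "?c * (4 * ?c - 2) \<le> ?c * (6 / 5)" using c by (intro mult_left_mono) auto
  ultimately show False using c by simp
qed

context regular_ngon
begin

lemma h_scale: "0 \<le> c \<Longrightarrow> h (c *\<^sub>R w) = c * h w"
  by (rule support_fun_scale[OF compact_polygon polygon_nonempty])

text \<open>
  Twice the right-hand side is the total length of the two long chords.
\<close>
lemma short_triple_perimeter:
  assumes "0 \<le> s \<and> 0 \<le> t \<or> s \<le> 0 \<and> t \<le> 0" "0 < \<bar>s + t\<bar>" "\<bar>s + t\<bar> \<le> 2 * pi / 3"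
  shows "1 + cos (\<bar>s + t\<bar> / 2) \<le> cos (s / 2) + cos (t / 2)"
proof -
  have e: "\<bar>s\<bar> / 2 + \<bar>t\<bar> / 2 = \<bar>s + t\<bar> / 2" using assms(1) by auto
  have "\<bar>s + t\<bar> / 2 \<le> pi" using assms(3) pi_gt_zero by (simp del: pi_gt_zero)
  then have "1 + cos (\<bar>s\<bar> / 2 + \<bar>t\<bar> / 2) \<le> cos (\<bar>s\<bar> / 2) + cos (\<bar>t\<bar> / 2)"
    by (intro one_plus_cos_add_le) (simp_all add: e)
  then show ?thesis unfolding e cos_half_abs .
qed

text \<open>
  Only the short chord is estimated by the inradius at this stage; the long chords, whose directions are
  nearly opposite, keep their values of the support function.
\<close>
lemma short_triple_sum:
  assumes a: "a = dir (M + s)" and b: "b = dir (M - t)" and c: "c = dir (M + pi)"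
    and st: "0 \<le> s \<and> 0 \<le> t \<or> s \<le> 0 \<and> t \<le> 0" "0 < \<bar>s + t\<bar>" "\<bar>s + t\<bar> \<le> 2 * pi / 3"
  shows "2 * cos \<alpha> * sin (\<bar>s + t\<bar> / 2) + 2 * cos (t / 2) * h (dir (M - t / 2))
        + 2 * cos (s / 2) * h (dir (M + s / 2 + pi)) \<le> h (a - b) + h (b - c) + h (c - a)"
proof -
  have "\<bar>s\<bar> \<le> pi" "\<bar>t\<bar> \<le> pi" using st by auto
  then have c0: "0 \<le> cos (s / 2)" "0 \<le> cos (t / 2)" by (auto intro!: cos_ge_zero)
  have g0: "0 \<le> sin (\<bar>s + t\<bar> / 2)" using st by (intro sin_ge_zero) auto
  have "norm (a - b) = 2 * \<bar>sin ((s + t) / 2)\<bar>"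
    unfolding a b dir_diff by simp
  moreover have "\<bar>sin ((s + t) / 2)\<bar> = sin (\<bar>s + t\<bar> / 2)"
  proof (cases "s + t \<ge> 0")
    case True
    then show ?thesis using g0 by simp
  next
    case False
    then have "\<bar>s + t\<bar> / 2 = - ((s + t) / 2)" by (simp add: field_simps)
    then have "sin (\<bar>s + t\<bar> / 2) = - sin ((s + t) / 2)" by (simp only: sin_minus)
    then show ?thesis using g0 by simp
  qed
  ultimately have "cos \<alpha> * (2 * sin (\<bar>s + t\<bar> / 2)) \<le> h (a - b)"
    using support_fun_ge_inradius[of "a - b"] by simp
  moreover have "b - c = (2 * cos (t / 2)) *\<^sub>R dir (M - t / 2)"
    using dir_sum[of "M - t" M] unfolding b c dir_plus_pi by (simp add: field_simps)
  moreover have "c - a = (2 * cos (s / 2)) *\<^sub>R dir (M + s / 2 + pi)"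
    using dir_sum[of "M + s" M] unfolding a c dir_plus_pi
    by (simp add: field_simps)
  ultimately show ?thesis using c0 h_scale by simp
qed

text \<open>
  The support function is at least the inradius times the norm, and a triangle inscribed in the unit
  circle with the centre in its hull has perimeter greater than 4.
\<close>
lemma even_triple_bound:
  assumes "norm a = 1" "norm b = 1" "norm c = 1" "a \<noteq> b" "b \<noteq> c" "c \<noteq> a"
    "0 \<in> convex hull {a, b, c}"
  shows "2 * (2 * cos \<alpha>) < h (a - b) + h (b - c) + h (c - a)"
  using _ assms
proof (rule rotate_shortest)
  fix a b c :: plane
  assume "norm a = 1" "norm b = 1" "norm c = 1" "a \<noteq> b" "b \<noteq> c" "c \<noteq> a"
    "0 \<in> convex hull {a, b, c}" "norm (a - b) \<le> norm (b - c)" "norm (a - b) \<le> norm (c - a)"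
  then obtain M s t where abc: "c = dir (M + pi)" "a = dir (M + s)" "b = dir (M - t)"
    and st: "0 \<le> s \<and> 0 \<le> t \<or> s \<le> 0 \<and> t \<le> 0" "0 < \<bar>s + t\<bar>" "\<bar>s + t\<bar> \<le> 2 * pi / 3"
    by (rule shortest_chord_angles)
  have "\<bar>s\<bar> \<le> pi" "\<bar>t\<bar> \<le> pi" using st by auto
  then have c0: "0 \<le> cos (s / 2)" "0 \<le> cos (t / 2)" by (auto intro!: cos_ge_zero)
  have hx: "cos \<alpha> \<le> h (dir p)" for p using support_fun_ge_inradius[of "dir p"] by simp
  have "1 < sin (\<bar>s + t\<bar> / 2) + cos (\<bar>s + t\<bar> / 2)"
    using st pi_gt_zero by (intro sin_plus_cos_gt_one) auto
  then have "2 < sin (\<bar>s + t\<bar> / 2) + cos (s / 2) + cos (t / 2)"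
    using short_triple_perimeter[OF st] by linarith
  then have "2 * cos \<alpha> * 2 < 2 * cos \<alpha> * (sin (\<bar>s + t\<bar> / 2) + cos (s / 2) + cos (t / 2))"
    using cos_angle_pos by (intro mult_strict_left_mono) auto
  also have "\<dots> = 2 * cos \<alpha> * sin (\<bar>s + t\<bar> / 2) + 2 * cos (t / 2) * cos \<alpha> + 2 * cos (s / 2) * cos \<alpha>"
    by (simp add: algebra_simps)
  also have "\<dots> \<le> 2 * cos \<alpha> * sin (\<bar>s + t\<bar> / 2) + 2 * cos (t / 2) * h (dir (M - t / 2))
        + 2 * cos (s / 2) * h (dir (M + s / 2 + pi))"
    using c0 hx cos_angle_pos by (intro add_mono mult_left_mono) auto
  also have "\<dots> \<le> h (a - b) + h (b - c) + h (c - a)" by (rule short_triple_sum[OF abc(2,3,1) st])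
  finally show "2 * (2 * cos \<alpha>) < h (a - b) + h (b - c) + h (c - a)" by simp
qed

text \<open>
  For odd \<open>n\<close> the point opposite to a corner is the midpoint of a side: a direction at angle \<open>d\<close> from
  a corner has its opposite at the angles \<open>d - \<alpha>\<close> and \<open>d + \<alpha>\<close> from two corners.
\<close>
lemma dir_odd_opposite:
  assumes "odd n"
  shows "cos (d - \<alpha>) \<le> h (dir (2 * of_int j * \<alpha> + d + pi))"
    and "cos (d + \<alpha>) \<le> h (dir (2 * of_int j * \<alpha> + d + pi))"
proof -
  obtain k where k: "n = 2 * k + 1" using assms oddE by blast
  have "(2 * real k + 1) * \<alpha> = pi" using n_times_angle k by (simp add: algebra_simps)
  then have p: "pi = 2 * (real k * \<alpha>) + \<alpha>" by (simp add: algebra_simps)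
  have *: "2 * of_int j * \<alpha> + d + pi - 2 * of_int (j + int k + 1) * \<alpha> = d - \<alpha>"
    by (subst p) (simp add: algebra_simps)
  show "cos (d - \<alpha>) \<le> h (dir (2 * of_int j * \<alpha> + d + pi))"
    using support_fun_ge_corner[of "2 * of_int j * \<alpha> + d + pi" "j + int k + 1"]
    by (simp only: *)
  have *: "2 * of_int j * \<alpha> + d + pi - 2 * of_int (j + int k) * \<alpha> = d + \<alpha>"
    by (subst p) (simp add: algebra_simps)
  show "cos (d + \<alpha>) \<le> h (dir (2 * of_int j * \<alpha> + d + pi))"
    using support_fun_ge_corner[of "2 * of_int j * \<alpha> + d + pi" "j + int k"]
    by (simp only: *)
qed

text \<open>
  Let \<open>d\<close> be the angle from the nearest corner to \<open>dir p\<close>.  Then \<open>dir (p + pi + g)\<close> is at the angles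
  \<open>d + g - \<alpha>\<close> and \<open>d + g + \<alpha>\<close> from two corners.  As \<open>d\<close> varies, the sum of the two cosines is concave
  between the positions where the choice of the corner changes, so its minimum is attained there.
  For \<open>g = 0\<close> this is the bound for the width.
\<close>
lemma odd_opposite_pair:
  assumes "odd n" "0 \<le> g" "g \<le> \<alpha>"
  shows "cos \<alpha> + cos g \<le> h (dir p) + h (dir (p + pi + g))"
proof -
  obtain j where j: "\<bar>p - 2 * of_int j * \<alpha>\<bar> \<le> \<alpha>" by (rule nearest_corner)
  define d where "d = p - 2 * of_int j * \<alpha>"
  have hp: "cos d \<le> h (dir p)" using support_fun_ge_corner[of p j] by (simp add: d_def)
  have "p + pi + g = 2 * of_int j * \<alpha> + (d + g) + pi" by (simp add: d_def)
  then have h1: "cos (d + g - \<alpha>) \<le> h (dir (p + pi + g))" and h2: "cos (d + g + \<alpha>) \<le> h (dir (p + pi + g))"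
    using dir_odd_opposite[OF assms(1), of "d + g" j] by (simp_all only:)
  have d: "- \<alpha> \<le> d" "d \<le> \<alpha>" using j by (auto simp: d_def)
  have mono: "cos b \<le> cos a" if "\<bar>a\<bar> \<le> b" "b \<le> \<alpha>" for a b
  proof -
    have "cos b \<le> cos \<bar>a\<bar>" using that angle_bounds by (intro cos_monotone_0_pi_le) auto
    then show ?thesis by simp
  qed
  consider "0 \<le> d" "d + g \<le> \<alpha>" | "0 \<le> d" "\<alpha> < d + g" | "d < 0" "g \<le> - d" | "d < 0" "- d < g"
    by linarith
  then show ?thesis
  proof cases
    case 1
    have "cos \<alpha> + cos g \<le> 1 + cos (\<alpha> - g)"
      using mono[of "\<alpha> - g" \<alpha>] assms cos_le_one[of g] by linarith
    also have "\<dots> \<le> cos d + cos (\<alpha> - g - d)"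
      using one_plus_cos_add_le[of d "\<alpha> - g - d"] 1 assms angle_bounds by simp
    also have "cos (\<alpha> - g - d) = cos (d + g - \<alpha>)" by (metis cos_minus diff_diff_eq minus_diff_eq add.commute)
    finally show ?thesis using hp h1 by linarith
  next
    case 2
    then have "cos \<alpha> \<le> cos d" "cos g \<le> cos (d + g - \<alpha>)" using mono d assms by auto
    then show ?thesis using hp h1 by linarith
  next
    case 3
    have "cos ((\<alpha> - g) / 2) \<le> cos \<bar>((d + g + \<alpha>) - - d) / 2\<bar>"
      using 3 d assms angle_bounds by (intro cos_monotone_0_pi_le) auto
    then have "cos ((\<alpha> - g) / 2) \<le> cos (((d + g + \<alpha>) - - d) / 2)" by (simp only: cos_abs_real)
    moreover have "0 \<le> cos ((\<alpha> + g) / 2)" using assms angle_bounds by (intro cos_ge_zero) auto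
    ultimately have "2 * cos ((\<alpha> + g) / 2) * cos ((\<alpha> - g) / 2)
        \<le> 2 * cos ((\<alpha> + g) / 2) * cos (((d + g + \<alpha>) - - d) / 2)"
      by (intro mult_left_mono) auto
    also have "\<dots> = cos (d + g + \<alpha>) + cos (- d)"
      unfolding cos_plus_cos[of "d + g + \<alpha>" "- d"] by (simp add: add.commute)
    finally show ?thesis using hp h2 cos_plus_cos[of \<alpha> g] by simp
  next
    case 4
    then have "cos g \<le> cos d" "cos \<alpha> \<le> cos (d + g - \<alpha>)" using mono d assms by auto
    then show ?thesis using hp h1 by linarith
  qed
qed

lemma odd_opposite_pair_abs:
  assumes "odd n" "\<bar>g\<bar> \<le> \<alpha>"
  shows "cos \<alpha> + cos g \<le> h (dir p) + h (dir (p + pi + g))"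
proof (cases "g \<ge> 0")
  case True
  then show ?thesis using odd_opposite_pair assms by simp
next
  case False
  have "dir (p + pi + g + pi + - g) = dir p" using dir_add_period[of p 1] by (simp add: algebra_simps)
  then show ?thesis using odd_opposite_pair[of "- g" "p + pi + g"] assms False by simp
qed

text \<open>
  Let \<open>g\<close> be the angle of the triangle at the vertex opposite to its shortest side.  If \<open>g \<ge> \<alpha> / 2\<close>, the
  Euclidean perimeter is long enough for the estimate by the inradius.  Otherwise the two long sides
  point in directions that differ from opposite ones by \<open>g\<close> only, and the previous lemma replaces one
  factor \<open>cos \<alpha>\<close> by \<open>cos g\<close>; the loss \<open>1 - cos g\<close> is of second order and is paid for by the short
  side.
\<close>
lemma odd_triple_bound:
  assumes "odd n" "5 \<le> n" "norm a = 1" "norm b = 1" "norm c = 1" "a \<noteq> b" "b \<noteq> c" "c \<noteq> a"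
    "0 \<in> convex hull {a, b, c}"
  shows "2 * (1 + cos \<alpha>) < h (a - b) + h (b - c) + h (c - a)"
  using _ assms(3-)
proof (rule rotate_shortest)
  fix a b c :: plane
  assume "norm a = 1" "norm b = 1" "norm c = 1" "a \<noteq> b" "b \<noteq> c" "c \<noteq> a"
    "0 \<in> convex hull {a, b, c}" "norm (a - b) \<le> norm (b - c)" "norm (a - b) \<le> norm (c - a)"
  then obtain M s t where abc: "c = dir (M + pi)" "a = dir (M + s)" "b = dir (M - t)"
    and st: "0 \<le> s \<and> 0 \<le> t \<or> s \<le> 0 \<and> t \<le> 0" "0 < \<bar>s + t\<bar>" "\<bar>s + t\<bar> \<le> 2 * pi / 3"
    by (rule shortest_chord_angles)
  define g where "g = \<bar>s + t\<bar> / 2"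
  have g: "0 < g" "g \<le> pi / 3" using st by (auto simp: g_def)
  have "\<bar>s\<bar> \<le> pi" "\<bar>t\<bar> \<le> pi" using st by auto
  then have c0: "0 \<le> cos (s / 2)" "0 \<le> cos (t / 2)" by (auto intro!: cos_ge_zero)
  have hx: "cos \<alpha> \<le> h (dir p)" for p using support_fun_ge_inradius[of "dir p"] by simp
  have F: "2 * cos \<alpha> * sin g + 2 * cos (t / 2) * h (dir (M - t / 2))
        + 2 * cos (s / 2) * h (dir (M + s / 2 + pi)) \<le> h (a - b) + h (b - c) + h (c - a)"
    using short_triple_sum[OF abc(2,3,1) st] by (simp add: g_def)
  have x5: "\<alpha> \<le> pi / 5" unfolding half_angle_def using assms(2) by (intro divide_left_mono) auto
  have r: "4 / 5 \<le> cos \<alpha>"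
  proof -
    have "cos (pi / 5) \<le> cos \<alpha>" using x5 angle_bounds by (intro cos_monotone_0_pi_le) auto
    then show ?thesis using cos_pi_5_ge by simp
  qed
  have sg: "0 < sin g" using g by (intro sin_gt_zero) auto
  have cg: "0 < cos g" using g by (intro cos_gt_zero) auto
  have sx: "0 < sin \<alpha>" using sin_angle_pos .
  show "2 * (1 + cos \<alpha>) < h (a - b) + h (b - c) + h (c - a)"
  proof (cases "\<alpha> / 2 \<le> g")
    case True
    have "(sin \<alpha>)\<^sup>2 \<le> (3 / 5)\<^sup>2"
      using power_mono[OF r, of 2] sin_squared_eq[of \<alpha>] by (simp add: power2_eq_square)
    then have "sin \<alpha> \<le> 3 / 5" by (rule power2_le_imp_le) simp
    \<comment> \<open>this is where \<open>n \<ge> 5\<close> enters: the factor is negative for \<open>n = 3\<close>\<close>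
    then have "0 < sin \<alpha> * (1 - sin \<alpha> - (sin \<alpha>)\<^sup>2)"
      using sx \<open>(sin \<alpha>)\<^sup>2 \<le> (3 / 5)\<^sup>2\<close> by (intro mult_pos_pos) (auto simp: power2_eq_square)
    then have "1 < (1 - (sin \<alpha>)\<^sup>2) * (1 + sin \<alpha>)"
      by (simp add: algebra_simps power2_eq_square)
    also have "\<dots> = (cos \<alpha>)\<^sup>2 * (1 + sin \<alpha>)" by (simp add: cos_squared_eq)
    also have "\<dots> \<le> (cos \<alpha>)\<^sup>2 * (1 + sin (2 * g))"
    proof -
      have "sin \<alpha> \<le> sin (2 * g)"
      proof (cases "2 * g \<le> pi / 2")
        case True
        then show ?thesis using \<open>\<alpha> / 2 \<le> g\<close> angle_bounds by (intro sin_monotone_2pi_le) auto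
      next
        case False
        have "sin \<alpha> \<le> sin (pi - 2 * g)"
          using False g angle_bounds by (intro sin_monotone_2pi_le) auto
        then show ?thesis by simp
      qed
      then show ?thesis by (intro mult_left_mono) auto
    qed
    also have "\<dots> = (cos \<alpha> * (sin g + cos g))\<^sup>2"
      by (simp add: sin_double power_mult_distrib power2_sum)
    finally have "1\<^sup>2 < (cos \<alpha> * (sin g + cos g))\<^sup>2" by simp
    then have big: "1 < cos \<alpha> * (sin g + cos g)"
      by (rule power2_less_imp_less) (use r sg cg in simp)
    have "cos \<alpha> * (1 + cos g) \<le> cos \<alpha> * (cos (s / 2) + cos (t / 2))"
      using short_triple_perimeter[OF st] r by (intro mult_left_mono) (auto simp: g_def)
    with big have "2 * (1 + cos \<alpha>) < 2 * cos \<alpha> * sin g + 2 * cos (t / 2) * cos \<alpha> + 2 * cos (s / 2) * cos \<alpha>"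
      by (simp add: algebra_simps)
    also have "\<dots> \<le> 2 * cos \<alpha> * sin g + 2 * cos (t / 2) * h (dir (M - t / 2))
        + 2 * cos (s / 2) * h (dir (M + s / 2 + pi))"
      using c0 hx cos_angle_pos by (intro add_mono mult_left_mono) auto
    finally show ?thesis using F by linarith
  next
    case False
    have h0: "0 \<le> h (dir p)" for p using hx[of p] r by linarith
    have "\<bar>s\<bar> \<le> 2 * g" "\<bar>t\<bar> \<le> 2 * g" using st by (auto simp: g_def)
    then have cgs: "cos g \<le> cos (y / 2)" if "y = s \<or> y = t" for y
    proof -
      have "cos g \<le> cos \<bar>y / 2\<bar>"
        using that \<open>\<bar>s\<bar> \<le> 2 * g\<close> \<open>\<bar>t\<bar> \<le> 2 * g\<close> g by (intro cos_monotone_0_pi_le) auto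
      then show ?thesis by (simp only: cos_abs_real)
    qed
    have e: "M - t / 2 + pi + (s + t) / 2 = M + s / 2 + pi" by (simp add: add_divide_distrib)
    have "\<bar>(s + t) / 2\<bar> \<le> \<alpha>" using False angle_bounds by (simp add: g_def)
    then have "cos \<alpha> + cos ((s + t) / 2) \<le> h (dir (M - t / 2)) + h (dir (M + s / 2 + pi))"
      using odd_opposite_pair_abs[OF assms(1), of "(s + t) / 2" "M - t / 2"] by (simp only: e)
    moreover have "cos ((s + t) / 2) = cos g" unfolding g_def by (rule cos_half_abs[symmetric])
    ultimately have "cos g * (cos \<alpha> + cos g) \<le> cos g * h (dir (M - t / 2)) + cos g * h (dir (M + s / 2 + pi))"
      using cg by (simp flip: distrib_left)
    also have "\<dots> \<le> cos (t / 2) * h (dir (M - t / 2)) + cos (s / 2) * h (dir (M + s / 2 + pi))"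
      using cgs h0 by (intro add_mono mult_right_mono) auto
    finally have *: "2 * (cos \<alpha> * sin g + cos g * (cos \<alpha> + cos g)) \<le> h (a - b) + h (b - c) + h (c - a)"
      using F by (simp add: algebra_simps)
    have sg2: "sin g < 2 / 5"
    proof -
      have "sin g \<le> g" using g by (intro sin_x_le_x) auto
      also have "g < 2 / 5" using False x5 pi_less_4 by simp
      finally show ?thesis .
    qed
    have "cos g * cos g \<le> cos g * 1" using cg by (intro mult_left_mono) auto
    then have "1 - cos g \<le> sin g * sin g" using sin_cos_squared_add3[of g] by linarith
    then have "cos \<alpha> * (1 - cos g) \<le> cos \<alpha> * (sin g * sin g)" using r by (intro mult_left_mono) auto
    moreover have "0 < sin g * (cos \<alpha> * (1 - sin g) - sin g)"
    proof -
      have "4 / 5 * (3 / 5) \<le> cos \<alpha> * (1 - sin g)" using r sg2 by (intro mult_mono) auto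
      then show ?thesis using sg sg2 by (intro mult_pos_pos) auto
    qed
    moreover have "cos g * cos g = 1 - sin g * sin g" using sin_cos_squared_add3[of g] by linarith
    moreover have "cos \<alpha> * (1 - cos g) = cos \<alpha> - cos \<alpha> * cos g"
      "sin g * (cos \<alpha> * (1 - sin g) - sin g) = cos \<alpha> * sin g - cos \<alpha> * (sin g * sin g) - sin g * sin g"
      "cos \<alpha> * sin g + cos g * (cos \<alpha> + cos g) = cos \<alpha> * sin g + cos \<alpha> * cos g + cos g * cos g"
      by (simp_all add: algebra_simps)
    ultimately have "1 + cos \<alpha> < cos \<alpha> * sin g + cos g * (cos \<alpha> + cos g)" by linarith
    then have "2 * (1 + cos \<alpha>) < 2 * (cos \<alpha> * sin g + cos g * (cos \<alpha> + cos g))" by simp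
    then show ?thesis using * by (rule less_le_trans)
  qed
qed

lemma even_width_bound: "norm v = 1 \<Longrightarrow> 2 * cos \<alpha> \<le> h v + h (- v)"
  using support_fun_ge_inradius[of v] support_fun_ge_inradius[of "- v"] by simp

lemma even_width_equality:
  assumes "norm v = 1" "h v + h (- v) = 2 * cos \<alpha>"
  obtains j where "v = side_normal n j" "h v = cos \<alpha>" "h (- v) = cos \<alpha>"
proof -
  have hv: "h v = cos \<alpha>" "h (- v) = cos \<alpha>"
    using support_fun_ge_inradius[of v] support_fun_ge_inradius[of "- v"] assms by simp_all
  obtain p where p: "v = dir p" using assms(1) by (rule unit_vector_dir)
  obtain j where j: "\<bar>p - 2 * of_int j * \<alpha>\<bar> \<le> \<alpha>" by (rule nearest_corner)
  have "cos \<bar>p - 2 * of_int j * \<alpha>\<bar> \<le> cos \<alpha>"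
    using support_fun_ge_corner[of p j] hv p by simp
  then have "\<alpha> \<le> \<bar>p - 2 * of_int j * \<alpha>\<bar>" using j angle_bounds by (subst (asm) cos_mono_le_eq) auto
  then have "p = (2 * of_int j + 1) * \<alpha> \<or> p = (2 * of_int (j - 1) + 1) * \<alpha>"
    using j by (auto simp: abs_if algebra_simps split: if_splits)
  then have "v = side_normal n j \<or> v = side_normal n (j - 1)"
    using p by (auto simp: side_normal_def side_angle_def)
  then show thesis using that hv by blast
qed

lemma odd_width_bound:
  assumes "odd n" "norm v = 1"
  shows "1 + cos \<alpha> \<le> h v + h (- v)"
proof -
  obtain p where p: "v = dir p" using assms(2) by (rule unit_vector_dir)
  then show ?thesis using odd_opposite_pair[OF assms(1), of 0 p] angle_bounds by (simp add: dir_plus_pi)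
qed

text \<open>
  The sum of the cosines of \<open>\<bar>d\<bar>\<close> and \<open>\<alpha> - \<bar>d\<bar>\<close> is minimal only at the ends of the range of \<open>d\<close>: there
  either the direction or its opposite points to a corner.
\<close>
lemma odd_width_equality:
  assumes "odd n" "norm v = 1" "h v + h (- v) = 1 + cos \<alpha>"
  obtains j where "v = corner n j \<or> - v = corner n j"
proof -
  obtain p where p: "v = dir p" using assms(2) by (rule unit_vector_dir)
  obtain j where j: "\<bar>p - 2 * of_int j * \<alpha>\<bar> \<le> \<alpha>" by (rule nearest_corner)
  define d where "d = p - 2 * of_int j * \<alpha>"
  have mv: "- v = dir (2 * of_int j * \<alpha> + d + pi)" using p by (simp add: dir_plus_pi d_def)
  have "cos d \<le> h v" using support_fun_ge_corner[of p j] by (simp add: d_def p)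
  moreover have "cos (d - \<alpha>) \<le> h (- v)" "cos (d + \<alpha>) \<le> h (- v)"
    unfolding mv by (rule dir_odd_opposite[OF assms(1)])+
  ultimately have le: "cos \<bar>d\<bar> + cos (\<alpha> - \<bar>d\<bar>) \<le> 1 + cos \<alpha>"
    using assms(3) cos_minus[of "d - \<alpha>"] by (auto simp: abs_if add.commute)
  have d: "\<bar>d\<bar> \<le> \<alpha>" using j by (simp add: d_def)
  have c: "0 < cos (\<alpha> / 2)" using angle_bounds by (intro cos_gt_zero) auto
  have "2 * cos (\<alpha> / 2) * cos ((\<bar>d\<bar> - (\<alpha> - \<bar>d\<bar>)) / 2) \<le> 2 * cos (\<alpha> / 2) * cos (\<alpha> / 2)"
    using le cos_plus_cos[of "\<bar>d\<bar>" "\<alpha> - \<bar>d\<bar>"] cos_double_cos[of "\<alpha> / 2"] by (simp add: power2_eq_square)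
  then have "cos ((\<bar>d\<bar> - (\<alpha> - \<bar>d\<bar>)) / 2) \<le> cos (\<alpha> / 2)" using c by simp
  then have "cos \<bar>(\<bar>d\<bar> - (\<alpha> - \<bar>d\<bar>)) / 2\<bar> \<le> cos (\<alpha> / 2)" by (simp only: cos_abs_real)
  then have "\<alpha> / 2 \<le> \<bar>(\<bar>d\<bar> - (\<alpha> - \<bar>d\<bar>)) / 2\<bar>"
    using d angle_bounds by (subst (asm) cos_mono_le_eq) auto
  then have "d = 0 \<or> d = \<alpha> \<or> d = - \<alpha>" using d by (auto simp: abs_if field_simps split: if_splits)
  moreover have d0: "d = 0 \<Longrightarrow> v = corner n j" using p by (simp add: d_def corner_def)
  moreover obtain k where k: "n = 2 * k + 1" using assms oddE by blast
  have "(2 * real k + 1) * \<alpha> = pi" using n_times_angle k by (simp add: algebra_simps)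
  then have pk: "pi = 2 * (real k * \<alpha>) + \<alpha>" by (simp add: algebra_simps)
  have "2 * of_int j * \<alpha> + \<alpha> + pi = 2 * of_int (j + int k + 1) * \<alpha>"
    "2 * of_int j * \<alpha> + - \<alpha> + pi = 2 * of_int (j + int k) * \<alpha>"
    by (simp_all add: pk algebra_simps)
  then have "dir (2 * of_int j * \<alpha> + \<alpha> + pi) = corner n (j + int k + 1)"
    "dir (2 * of_int j * \<alpha> + - \<alpha> + pi) = corner n (j + int k)"
    unfolding corner_def by (simp_all only:)
  ultimately have "v = corner n j \<or> - v = corner n (j + int k + 1) \<or> - v = corner n (j + int k)"
    using mv p d0 by (elim disjE) (simp_all only: simp_thms)
  then show thesis using that by blast
qed

end

section \<open>Two-bounce orbits, traces and width\<close>

lemma cyclic_seq_pair: "cyclic_seq [a, b] i = (if even i then a else b)"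
proof -
  have "i mod 2 = 0 \<or> i mod 2 = 1" by presburger
  then show ?thesis by (auto simp: cyclic_seq_def even_iff_mod_2_eq_zero)
qed

lemma bounces_eq:
  assumes "closes_after q m" "\<And>k. closes_after q k \<Longrightarrow> m \<le> k"
  shows "bounces q = m"
  unfolding bounces_def using assms by (intro Least_equality)

lemma closed_orbits_pair:
  assumes "a \<in> frontier T" "b \<in> frontier T" "a \<noteq> b"
    and "\<And>y. y \<in> T \<Longrightarrow> y \<bullet> (a - b) \<le> a \<bullet> (a - b)" "\<And>y. y \<in> T \<Longrightarrow> y \<bullet> (b - a) \<le> b \<bullet> (b - a)"
  shows "cyclic_seq [a, b] \<in> bounce_orbits T 2"
    and "orbit_length (cyclic_seq [a, b]) = 2 * norm (a - b)"
proof -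
  let ?q = "cyclic_seq [a, b]"
  have sup: "outward_support_vector T p ((p - p') /\<^sub>R norm (p - p') + (p - p') /\<^sub>R norm (p - p'))"
    if "p \<in> frontier T" "\<And>y. y \<in> T \<Longrightarrow> y \<bullet> (p - p') \<le> p \<bullet> (p - p')" for p p'
  proof -
    have "(y - p) \<bullet> ((p - p') /\<^sub>R norm (p - p')) \<le> 0" if "y \<in> T" for y
    proof -
      have "(y - p) \<bullet> (p - p') \<le> 0" using \<open>\<And>y. y \<in> T \<Longrightarrow> y \<bullet> (p - p') \<le> p \<bullet> (p - p')\<close>[OF that]
        by (simp add: inner_diff_left)
      then show ?thesis by (simp add: mult_nonneg_nonpos)
    qed
    then show ?thesis using that(1)
      by (auto simp only: outward_support_vector_def inner_add_right intro!: add_nonpos_nonpos)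
  qed
  have "billiard_orbit T ?q"
    unfolding billiard_orbit_def cyclic_seq_pair using assms sup[of a b] sup[of b a] by auto
  moreover have c: "closes_after ?q 2" by (simp add: closes_after_def cyclic_seq_pair)
  ultimately have "?q \<in> closed_orbits T" by (auto simp: closed_orbits_def)
  moreover have b: "bounces ?q = 2"
    by (rule bounces_eq[OF c]) (simp add: closes_after_def)
  ultimately show "?q \<in> bounce_orbits T 2" by (simp add: bounce_orbits_def)
  show "orbit_length ?q = 2 * norm (a - b)"
    unfolding orbit_length_def b by (simp add: cyclic_seq_pair lessThan_nat_numeral norm_minus_commute[of b a] numeral_2_eq_2)
qed

lemma orbit_trace_pair: "orbit_trace (cyclic_seq [a, b]) = closed_segment a b"
proof
  show "orbit_trace (cyclic_seq [a, b]) \<subseteq> closed_segment a b"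
    by (auto simp: orbit_trace_def cyclic_seq_pair closed_segment_commute[of b a] split: if_splits)
  show "closed_segment a b \<subseteq> orbit_trace (cyclic_seq [a, b])"
    unfolding orbit_trace_def using UN_upper[of 0 UNIV "\<lambda>i. closed_segment (cyclic_seq [a, b] i) (cyclic_seq [a, b] (i + 1))"]
    by (simp add: cyclic_seq_pair)
qed

lemma trace_class_eq_iff:
  assumes "c \<in> closed_orbits T"
  shows "same_trace T `` {c} = same_trace T `` {d} \<longleftrightarrow> d \<in> closed_orbits T \<and> orbit_trace c = orbit_trace d"
  using assms by (auto simp: same_trace_def)

text \<open>
  Minimal orbits need not belong to the listed families, but each has the trace of a member, and that
  suffices for equality of the sets of classes.
\<close>
lemma trace_quotient_eq:
  assumes "C \<subseteq> A" "A \<subseteq> closed_orbits T" "\<And>c. c \<in> A \<Longrightarrow> \<exists>d\<in>C. orbit_trace c = orbit_trace d"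
  shows "A // same_trace T = C // same_trace T"
proof
  show "A // same_trace T \<subseteq> C // same_trace T"
  proof
    fix X assume "X \<in> A // same_trace T"
    then obtain c where c: "c \<in> A" "X = same_trace T `` {c}" by (auto simp: quotient_def)
    then obtain d where "d \<in> C" "orbit_trace c = orbit_trace d" using assms(3) by blast
    then show "X \<in> C // same_trace T"
      using c assms trace_class_eq_iff[of c T d] by (auto simp: quotient_def)
  qed
qed (use assms(1) in \<open>auto simp: quotient_def\<close>)

lemma bounce_orbits_closed: "c \<in> bounce_orbits T k \<Longrightarrow> c \<in> closed_orbits T"
  by (simp add: bounce_orbits_def)

lemma min_orbits_closed: "min_orbits T \<subseteq> closed_orbits T"
  by (auto simp: min_orbits_def)

lemma min_orbitsI:
  assumes "c \<in> closed_orbits T" "orbit_length c = l" "\<And>d. d \<in> closed_orbits T \<Longrightarrow> l \<le> orbit_length d"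
  shows "c \<in> min_orbits T"
  using assms by (simp add: min_orbits_def)

lemma min_orbits_length_eq: "c \<in> min_orbits T \<Longrightarrow> d \<in> min_orbits T \<Longrightarrow> orbit_length c = orbit_length d"
  by (auto simp: min_orbits_def intro: antisym)

lemma width_eqI:
  assumes "compact T" "T \<noteq> {}"
    and lower: "\<And>v. norm v = 1 \<Longrightarrow> w \<le> support_fun T v + support_fun T (- v)"
    and attained: "norm u = 1" "support_fun T u + support_fun T (- u) = w"
  shows "width T = w"
  unfolding width_def
proof (rule cInf_eq_minimum)
  obtain y where "y \<in> T" using assms(2) by blast
  have b: "- support_fun T (- u) \<le> u \<bullet> y" "u \<bullet> y \<le> support_fun T u" if "y \<in> T" for y
    using support_fun_ge[OF assms(1) that, of u] support_fun_ge[OF assms(1) that, of "- u"]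
    by (auto simp: inner_commute)
  show "w \<in> {b - a |a b u. norm u = 1 \<and> a \<le> b \<and> T \<subseteq> {x. a \<le> u \<bullet> x \<and> u \<bullet> x \<le> b}}"
    using attained b b[OF \<open>y \<in> T\<close>]
    by (intro CollectI exI[of _ "- support_fun T (- u)"] exI[of _ "support_fun T u"] exI[of _ u]) auto
next
  fix t assume "t \<in> {b - a |a b u. norm u = 1 \<and> a \<le> b \<and> T \<subseteq> {x. a \<le> u \<bullet> x \<and> u \<bullet> x \<le> b}}"
  then obtain a b v where t: "t = b - a" "norm v = 1" "T \<subseteq> {x. a \<le> v \<bullet> x \<and> v \<bullet> x \<le> b}" by blast
  have "support_fun T v \<le> b" "support_fun T (- v) \<le> - a"
    unfolding support_fun_def using t(3) assms(2)
    by (intro cSUP_least; auto simp: inner_commute)+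
  then show "w \<le> t" using lower[OF t(2)] t(1) by linarith
qed

section \<open>The sides of the regular polygon\<close>

context regular_ngon
begin

lemma vertex_side:
  "vertex n j = cos \<alpha> *\<^sub>R side_normal n (int j) - sin \<alpha> *\<^sub>R side_tangent n (int j)"
  "vertex n (j + 1) = cos \<alpha> *\<^sub>R side_normal n (int j) + sin \<alpha> *\<^sub>R side_tangent n (int j)"
  using corner_side[of "int j"] by (simp_all add: vertex_corner add.commute)

lemma edge_eq: "edge n j = (\<lambda>t. cos \<alpha> *\<^sub>R side_normal n (int j) + t *\<^sub>R side_tangent n (int j)) ` {- sin \<alpha>..sin \<alpha>}"
proof -
  have "edge n j = closed_segment (cos \<alpha> *\<^sub>R side_normal n (int j) + (- sin \<alpha>) *\<^sub>R side_tangent n (int j))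
      (cos \<alpha> *\<^sub>R side_normal n (int j) + sin \<alpha> *\<^sub>R side_tangent n (int j))"
    unfolding edge_def vertex_side(1)[of j] vertex_side(2)[of j] by simp
  then show ?thesis
    unfolding closed_segment_on_line using sin_angle_pos by (simp add: closed_segment_eq_real_ivl)
qed

lemma edge_midpoint_eq: "edge_midpoint n j = cos \<alpha> *\<^sub>R side_normal n (int j)"
  unfolding edge_midpoint_def vertex_side(1)[of j] vertex_side(2)[of j] midpoint_eq_iff
  by simp

lemma edge_vector: "vertex n (j + 1) - vertex n j = (2 * sin \<alpha>) *\<^sub>R side_tangent n (int j)"
  unfolding vertex_side(1)[of j] vertex_side(2)[of j] by (simp flip: scaleR_2)

lemma adjacent_side_normals:
  "side_normal n (j + 1) = cos (2 * \<alpha>) *\<^sub>R side_normal n j + sin (2 * \<alpha>) *\<^sub>R side_tangent n j"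
  "side_normal n (j - 1) = cos (2 * \<alpha>) *\<^sub>R side_normal n j - sin (2 * \<alpha>) *\<^sub>R side_tangent n j"
proof -
  have e: "side_angle n (j + 1) = side_angle n j + 2 * \<alpha>" "side_angle n (j - 1) = side_angle n j - 2 * \<alpha>"
    by (simp_all add: side_angle_def algebra_simps)
  show "side_normal n (j + 1) = cos (2 * \<alpha>) *\<^sub>R side_normal n j + sin (2 * \<alpha>) *\<^sub>R side_tangent n j"
    unfolding side_normal_def side_tangent_def e
    by (rule plane_eqI) (simp_all add: cos_add sin_add)
  show "side_normal n (j - 1) = cos (2 * \<alpha>) *\<^sub>R side_normal n j - sin (2 * \<alpha>) *\<^sub>R side_tangent n j"
    unfolding side_normal_def side_tangent_def e
    by (rule plane_eqI) (simp_all add: cos_add sin_add cos_diff sin_diff)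
qed

text \<open>
  The bound on the tangential coordinate comes from the inequalities of the two adjacent sides.
\<close>
lemma side_coordinate:
  assumes "y \<in> R" "y \<bullet> side_normal n j = cos \<alpha>"
  obtains t where "\<bar>t\<bar> \<le> sin \<alpha>" "y = cos \<alpha> *\<^sub>R side_normal n j + t *\<^sub>R side_tangent n j"
proof -
  define t where "t = y \<bullet> side_tangent n j"
  have y: "y = cos \<alpha> *\<^sub>R side_normal n j + t *\<^sub>R side_tangent n j"
    using side_frame[of y n j] assms(2) by (simp add: t_def)
  have s2: "0 < sin (2 * \<alpha>)" using angle_bounds by (intro sin_gt_zero) auto
  have "cos \<alpha> * cos (2 * \<alpha>) + t * sin (2 * \<alpha>) \<le> cos \<alpha>"
    "cos \<alpha> * cos (2 * \<alpha>) - t * sin (2 * \<alpha>) \<le> cos \<alpha>"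
    using polygon_below_side[OF assms(1), of "j + 1"] polygon_below_side[OF assms(1), of "j - 1"] assms(2)
    by (simp_all add: adjacent_side_normals inner_simps t_def mult.commute)
  moreover have "cos \<alpha> - cos \<alpha> * cos (2 * \<alpha>) = sin \<alpha> * sin (2 * \<alpha>)"
    unfolding cos_double_sin sin_double by (simp add: power2_eq_square algebra_simps)
  ultimately have "t * sin (2 * \<alpha>) \<le> sin \<alpha> * sin (2 * \<alpha>)" "(- t) * sin (2 * \<alpha>) \<le> sin \<alpha> * sin (2 * \<alpha>)"
    by simp_all
  then have "t \<le> sin \<alpha>" "- t \<le> sin \<alpha>" using s2 by (simp_all only: mult_le_cancel_right_pos)
  then have "\<bar>t\<bar> \<le> sin \<alpha>" by simp
  then show thesis using that y by blast
qed

lemma edge_iff: "y \<in> edge n j \<longleftrightarrow> y \<in> R \<and> y \<bullet> side_normal n (int j) = cos \<alpha>"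
proof
  assume y: "y \<in> edge n j"
  have "edge n j \<subseteq> R" unfolding edge_def vertex_corner
    using corner_in convex_polygon by (intro closed_segment_subset)
  then show "y \<in> R \<and> y \<bullet> side_normal n (int j) = cos \<alpha>" using y
    by (auto simp: edge_eq inner_add_left)
next
  assume "y \<in> R \<and> y \<bullet> side_normal n (int j) = cos \<alpha>"
  then obtain t where "\<bar>t\<bar> \<le> sin \<alpha>" "y = cos \<alpha> *\<^sub>R side_normal n (int j) + t *\<^sub>R side_tangent n (int j)"
    using side_coordinate by blast
  then show "y \<in> edge n j" unfolding edge_eq by (intro image_eqI[of _ _ t]) auto
qed

lemma edge_midpoint_in_edge: "edge_midpoint n j \<in> edge n j"
  unfolding edge_eq edge_midpoint_eq using sin_angle_pos by (intro image_eqI[of _ _ 0]) auto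

lemma edge_frontier: "y \<in> edge n j \<Longrightarrow> y \<in> frontier R"
  by (auto simp: edge_iff frontier_polygon)

lemma side_normal_nat: obtains j where "j < n" "side_normal n i = side_normal n (int j)"
proof
  show "nat (i mod int n) < n" using n3 by (simp add: nat_less_iff)
  show "side_normal n i = side_normal n (int (nat (i mod int n)))" using n3 by (simp add: side_normal_mod)
qed

lemma corner_nat: obtains j where "j < n" "corner n i = vertex n j"
proof
  show "nat (i mod int n) < n" using n3 by (simp add: nat_less_iff)
  show "corner n i = vertex n (nat (i mod int n))" using n3 by (simp add: corner_mod vertex_corner)
qed

text \<open>
  Congruences between indices are read off from vanishing sines throughout.
\<close>
lemma sin_multiple_eq_0: "sin (of_int m * \<alpha>) = 0 \<longleftrightarrow> int n dvd m"
proof -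
  have "sin (of_int m * \<alpha>) = 0 \<longleftrightarrow> (\<exists>i::int. of_int m * \<alpha> = of_int i * pi)"
    by (rule sin_zero_iff_int2)
  also have "\<dots> \<longleftrightarrow> (\<exists>i::int. of_int m * \<alpha> = of_int (i * int n) * \<alpha>)"
    by (simp add: mult.assoc n_times_angle)
  also have "\<dots> \<longleftrightarrow> (\<exists>i. m = i * int n)"
    using angle_pos by (simp only: mult_cancel_right of_int_eq_iff) auto
  finally show ?thesis by (auto simp: dvd_def mult.commute)
qed

lemma corner_inj: "corner n i = corner n j \<longleftrightarrow> int n dvd i - j"
proof -
  have "corner n i = corner n j \<longleftrightarrow> sin (of_int (i - j) * \<alpha>) = 0"
    using dir_diff[of "2 * of_int i * \<alpha>" "2 * of_int j * \<alpha>"]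
    by (simp add: corner_def algebra_simps diff_divide_distrib flip: eq_iff_diff_eq_0[of "dir _"])
  then show ?thesis by (simp only: sin_multiple_eq_0)
qed

lemma side_normal_inj: "side_normal n i = side_normal n j \<longleftrightarrow> int n dvd i - j"
proof -
  have "side_normal n i = side_normal n j \<longleftrightarrow> sin (of_int (i - j) * \<alpha>) = 0"
    using dir_diff[of "side_angle n i" "side_angle n j"]
    by (simp add: side_normal_def side_angle_def algebra_simps diff_divide_distrib flip: eq_iff_diff_eq_0[of "dir _"])
  then show ?thesis by (simp only: sin_multiple_eq_0)
qed

lemma int_dvd_diff_less:
  assumes "int n dvd int i - int j" "i < n" "j < n"
  shows "i = j"
proof -
  have "\<bar>int i - int j\<bar> < int n" using assms by linarith
  then have "int i - int j = 0" using assms(1) zdvd_not_zless[of "\<bar>int i - int j\<bar>" "int n"] by force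
  then show ?thesis by simp
qed

lemma vertex_inj: "i < n \<Longrightarrow> j < n \<Longrightarrow> vertex n i = vertex n j \<longleftrightarrow> i = j"
  using int_dvd_diff_less by (auto simp: vertex_corner corner_inj)

lemma h_side_normal: "h (side_normal n j) = cos \<alpha>"
proof (rule antisym)
  show "h (side_normal n j) \<le> cos \<alpha>"
    unfolding support_fun_def using polygon_nonempty polygon_below_side by (intro cSUP_least)
  show "cos \<alpha> \<le> h (side_normal n j)" using support_fun_ge_inradius[of "side_normal n j"] by simp
qed

lemma opposite_side_even:
  assumes "even n"
  shows "side_normal n (j + int (n div 2)) = - side_normal n j"
proof -
  have "2 * real (n div 2) = real n" using assms by (metis dvd_mult_div_cancel of_nat_mult of_nat_numeral)
  then have "2 * real (n div 2) * \<alpha> = pi" using n_times_angle by simp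
  then have "side_angle n (j + int (n div 2)) = side_angle n j + pi"
    by (simp add: side_angle_def algebra_simps)
  then show ?thesis by (simp add: side_normal_def dir_plus_pi)
qed

lemma opposite_side_odd:
  assumes "odd n"
  shows "side_normal n (j + int (n div 2)) = - corner n j"
proof -
  have "real n = 2 * real (n div 2) + 1" using assms by (metis odd_two_times_div_two_succ of_nat_1 of_nat_add of_nat_mult of_nat_numeral)
  then have "(2 * real (n div 2) + 1) * \<alpha> = pi" using n_times_angle by simp
  then have "side_angle n (j + int (n div 2)) = 2 * of_int j * \<alpha> + pi"
    by (simp add: side_angle_def algebra_simps)
  then show ?thesis by (simp add: side_normal_def corner_def dir_plus_pi)
qed

section \<open>Minimal orbits of polygons with an even number of sides\<close>

lemma band_element:
  assumes "even n" "c \<in> band n j"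
  obtains a b where "c = cyclic_seq [a, b]" "a \<in> edge n j" "b \<in> edge n (j + n div 2)"
    "a - b = (2 * cos \<alpha>) *\<^sub>R side_normal n (int j)"
proof -
  obtain a b where c: "c = cyclic_seq [a, b]" "a \<in> edge n j" "b \<in> edge n (j + n div 2)"
    "orthogonal (b - a) (vertex n (j + 1) - vertex n j)"
    using assms(2) by (auto simp: band_def)
  have "(b - a) \<bullet> side_tangent n (int j) = 0"
    using c(4) sin_angle_pos unfolding orthogonal_def edge_vector by simp
  then have t: "(a - b) \<bullet> side_tangent n (int j) = 0" by (simp add: inner_diff_left)
  have "a \<bullet> side_normal n (int j) = cos \<alpha>" "b \<bullet> side_normal n (int j) = - cos \<alpha>"
    using c(2,3) opposite_side_even[OF assms(1), of "int j"] by (auto simp: edge_iff)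
  then have "(a - b) \<bullet> side_normal n (int j) = 2 * cos \<alpha>" by (simp add: inner_diff_left)
  then have "a - b = (2 * cos \<alpha>) *\<^sub>R side_normal n (int j)"
    using side_frame[of "a - b" n "int j"] t by simp
  then show thesis using that c by blast
qed

lemma bandI:
  assumes "even n" "a \<in> edge n j" "b \<in> edge n (j + n div 2)"
    and "a - b = (2 * cos \<alpha>) *\<^sub>R side_normal n (int j)"
  shows "cyclic_seq [a, b] \<in> band n j"
proof -
  have ba: "b - a = - ((2 * cos \<alpha>) *\<^sub>R side_normal n (int j))" using assms(4) by (metis minus_diff_eq)
  have "side_normal n (int j) = - side_normal n (int (j + n div 2))"
    using opposite_side_even[OF assms(1), of "int j"] by simp
  then have "(b - a) \<bullet> side_tangent n (int (j + n div 2)) = 0"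
    unfolding ba by simp
  then have "orthogonal (b - a) (vertex n (j + n div 2 + 1) - vertex n (j + n div 2))"
    by (simp only: orthogonal_def edge_vector inner_scaleR_right mult_zero_right)
  moreover have "orthogonal (b - a) (vertex n (j + 1) - vertex n j)"
    unfolding orthogonal_def edge_vector ba by simp
  ultimately show ?thesis using assms by (auto simp: band_def)
qed

lemma band_orbit:
  assumes "even n" "c \<in> band n j"
  shows "c \<in> bounce_orbits R 2" "orbit_length c = 4 * cos \<alpha>"
proof -
  obtain a b where c: "c = cyclic_seq [a, b]" and a: "a \<in> edge n j" and b: "b \<in> edge n (j + n div 2)"
    and ab: "a - b = (2 * cos \<alpha>) *\<^sub>R side_normal n (int j)"
    using assms by (rule band_element)
  have ba: "b - a = (2 * cos \<alpha>) *\<^sub>R side_normal n (int (j + n div 2))"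
    using opposite_side_even[OF assms(1), of "int j"] arg_cong[OF ab, of uminus] by simp
  have "a \<noteq> b" using ab cos_angle_pos by (auto simp: side_normal_def)
  moreover have "y \<bullet> (a - b) \<le> a \<bullet> (a - b)" "y \<bullet> (b - a) \<le> b \<bullet> (b - a)" if "y \<in> R" for y
    unfolding ab ba using a b polygon_below_side[OF that] cos_angle_pos by (simp_all add: edge_iff del: of_nat_add)
  ultimately show "c \<in> bounce_orbits R 2"
    unfolding c using a b edge_frontier by (intro closed_orbits_pair) auto
  have "orbit_length c = 2 * norm (a - b)"
    unfolding c using \<open>a \<noteq> b\<close> a b edge_frontier
      \<open>\<And>y. y \<in> R \<Longrightarrow> y \<bullet> (a - b) \<le> a \<bullet> (a - b)\<close> \<open>\<And>y. y \<in> R \<Longrightarrow> y \<bullet> (b - a) \<le> b \<bullet> (b - a)\<close>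
    by (intro closed_orbits_pair) auto
  then show "orbit_length c = 4 * cos \<alpha>" unfolding ab using cos_angle_pos by simp
qed

definition midchord :: "nat \<Rightarrow> int \<Rightarrow> plane" where
  "midchord j = cyclic_seq [edge_midpoint n j, edge_midpoint n (j + n div 2)]"

lemma midchord_in_band: "even n \<Longrightarrow> midchord j \<in> band n j"
  unfolding midchord_def
  using opposite_side_even[of "int j"]
  by (intro bandI edge_midpoint_in_edge) (simp_all add: edge_midpoint_eq flip: scaleR_2)

lemma closed_billiardI: "c \<in> closed_orbits R \<Longrightarrow> closed_billiard R c"
  by unfold_locales (rule compact_polygon)

lemma even_length_ge:
  assumes "c \<in> closed_orbits R"
  shows "4 * cos \<alpha> \<le> orbit_length c"
  using closed_billiard.length_lower_bound(1)[OF closed_billiardI[OF assms], of "2 * cos \<alpha>"]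
    even_width_bound even_triple_bound by simp

text \<open>
  The common direction is normal to a side, and the two turning points lie on that side and the opposite
  one.  As bands are indexed by half of the sides, the roles of the turning points may have to be
  exchanged.
\<close>
lemma even_min_trace:
  assumes "even n" "c \<in> closed_orbits R" "orbit_length c = 4 * cos \<alpha>"
  obtains j d where "j < n div 2" "d \<in> band n j" "orbit_trace c = orbit_trace d"
proof -
  interpret closed_billiard R c using assms(2) by (rule closed_billiardI)
  have "orbit_length c = 2 * (2 * cos \<alpha>)" using assms(3) by simp
  then obtain v where v: "norm v = 1" "range u = {v, - v}" "h v + h (- v) = 2 * cos \<alpha>"
    using length_lower_bound(2)[of "2 * cos \<alpha>"] even_width_bound even_triple_bound by blast
  obtain A B where AB: "A \<in> R" "B \<in> R" "A \<bullet> v = h v" "B \<bullet> (- v) = h (- v)"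
    "A - B = (h v + h (- v)) *\<^sub>R v" "orbit_trace c = closed_segment A B"
    using v(1,2) by (rule bouncing_ball_trace)
  obtain i where i: "v = side_normal n i" "h v = cos \<alpha>" "h (- v) = cos \<alpha>"
    using v(1,3) by (rule even_width_equality)
  obtain j where j: "j < n" "v = side_normal n (int j)" using side_normal_nat[of i] i by metis
  show thesis
  proof (cases "j < n div 2")
    case True
    have "cyclic_seq [A, B] \<in> band n j"
      using AB i j v opposite_side_even[OF assms(1), of "int j"]
      by (intro bandI[OF assms(1)]) (auto simp: edge_iff)
    then show thesis using that True AB(6) orbit_trace_pair by metis
  next
    case False
    define k where "k = j - n div 2"
    have k: "j = k + n div 2" "k < n div 2" using False j(1) assms(1) by (auto simp: k_def)
    have vk: "v = - side_normal n (int k)"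
      using j(2) opposite_side_even[OF assms(1), of "int k"] unfolding k(1) by simp
    then have Nk: "side_normal n (int k) = - v" by simp
    have "B - A = (2 * cos \<alpha>) *\<^sub>R side_normal n (int k)"
      using arg_cong[OF AB(5), of uminus] v(3) vk by simp
    then have "cyclic_seq [B, A] \<in> band n k"
      using AB(1-4) i(2,3) j(2) Nk unfolding k(1)
      by (intro bandI[OF assms(1)]) (auto simp: edge_iff)
    then show thesis using that k AB(6) orbit_trace_pair closed_segment_commute by metis
  qed
qed

text \<open>
  A segment determines the unordered pair of its end points, hence the normal of the sides up to sign.
\<close>
lemma band_classes_inj:
  assumes "even n" "i < n div 2" "j < n div 2" "band n i // same_trace R = band n j // same_trace R"
  shows "i = j"
proof -
  have "same_trace R `` {midchord i} \<in> band n i // same_trace R"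
    using midchord_in_band[OF assms(1)] by (rule quotientI)
  then obtain d where d: "d \<in> band n j" "same_trace R `` {midchord i} = same_trace R `` {d}"
    unfolding assms(4) by (auto simp: quotient_def)
  have mi: "midchord i \<in> closed_orbits R"
    using band_orbit(1)[OF assms(1) midchord_in_band[OF assms(1)]] by (rule bounce_orbits_closed)
  then have tr: "orbit_trace (midchord i) = orbit_trace d"
    using d(2) trace_class_eq_iff by blast
  obtain a b where ab: "midchord i = cyclic_seq [a, b]" "a - b = (2 * cos \<alpha>) *\<^sub>R side_normal n (int i)"
    using band_element[OF assms(1) midchord_in_band[OF assms(1), of i]] by metis
  obtain a' b' where ab': "d = cyclic_seq [a', b']" "a' - b' = (2 * cos \<alpha>) *\<^sub>R side_normal n (int j)"
    using band_element[OF assms(1) d(1)] by metis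
  have "{a, b} = {a', b'}" using tr unfolding ab(1) ab'(1) orbit_trace_pair by simp
  then have "a - b = a' - b' \<or> a - b = - (a' - b')" by (auto simp: doubleton_eq_iff)
  then have "side_normal n (int i) = side_normal n (int j) \<or> side_normal n (int i) = side_normal n (int (j + n div 2))"
    using cos_angle_pos opposite_side_even[OF assms(1), of "int j"]
    unfolding ab(2) ab'(2) by (auto simp flip: scaleR_minus_right)
  then have "int n dvd int i - int j \<or> int n dvd int i - int (j + n div 2)"
    by (simp only: side_normal_inj)
  then show ?thesis
  proof
    assume "int n dvd int i - int j"
    then show ?thesis using int_dvd_diff_less assms(2,3) by simp
  next
    assume "int n dvd int i - int (j + n div 2)"
    moreover have "i < n" "j + n div 2 < n" using assms(2,3) by auto
    ultimately have "i = j + n div 2" by (rule int_dvd_diff_less)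
    then show ?thesis using assms(2) by simp
  qed
qed

theorem even_case:
  assumes "even n"
  defines "C \<equiv> (\<Union>j<n div 2. band n j)"
  shows "C \<subseteq> bounce_orbits R 2" "C \<subseteq> min_orbits R" "P_min R = C // same_trace R"
    "card ((\<lambda>j. band n j // same_trace R) ` {..<n div 2}) = n div 2"
    "\<forall>c\<in>C. orbit_length c = 4 * cos \<alpha>" "width R = 2 * cos \<alpha>"
proof -
  show 1: "C \<subseteq> bounce_orbits R 2" using band_orbit(1)[OF assms(1)] by (auto simp: C_def)
  show 5: "\<forall>c\<in>C. orbit_length c = 4 * cos \<alpha>" using band_orbit(2)[OF assms(1)] by (auto simp: C_def)
  show 2: "C \<subseteq> min_orbits R"
    using 1 5 even_length_ge by (auto intro!: min_orbitsI bounce_orbits_closed)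
  have m: "midchord 0 \<in> C" unfolding C_def using n3 midchord_in_band[OF assms(1), of 0] by auto
  show "P_min R = C // same_trace R"
    unfolding P_min_def
  proof (rule trace_quotient_eq[OF 2 min_orbits_closed])
    fix c assume c: "c \<in> min_orbits R"
    then have "orbit_length c = 4 * cos \<alpha>" using min_orbits_length_eq[OF c] 2 5 m by (metis subsetD)
    then obtain j d where "j < n div 2" "d \<in> band n j" "orbit_trace c = orbit_trace d"
      using even_min_trace assms(1) c min_orbits_closed by blast
    then show "\<exists>d\<in>C. orbit_trace c = orbit_trace d" by (auto simp: C_def)
  qed
  have "inj_on (\<lambda>j. band n j // same_trace R) {..<n div 2}"
    using band_classes_inj[OF assms(1)] by (auto intro!: inj_onI)
  then show "card ((\<lambda>j. band n j // same_trace R) ` {..<n div 2}) = n div 2"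
    by (simp add: card_image)
  have "h (- side_normal n 0) = cos \<alpha>"
    using h_side_normal[of "int (n div 2)"] opposite_side_even[OF assms(1), of 0] by simp
  then show "width R = 2 * cos \<alpha>"
    using even_width_bound h_side_normal[of 0]
    by (intro width_eqI[OF compact_polygon polygon_nonempty, where u = "side_normal n 0"]) auto
qed

end

context regular_ngon
begin

section \<open>Smooth boundary points\<close>

definition side_line :: "int \<Rightarrow> plane set" where
  "side_line j = {y. side_normal n j \<bullet> y = cos \<alpha>}"

lemma side_line:
  "affine (side_line j)" "aff_dim (side_line j) = 1" "side_line j \<inter> interior R = {}"
proof -
  show "affine (side_line j)" unfolding side_line_def by (rule affine_hyperplane)
  have "side_normal n j \<noteq> 0" by (simp add: side_normal_def)
  then show "aff_dim (side_line j) = 1"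
    using aff_dim_hyperplane[of "side_normal n j" "cos \<alpha>"] by (simp add: side_line_def)
  show "side_line j \<inter> interior R = {}"
  proof (intro equals0I)
    fix y assume "y \<in> side_line j \<inter> interior R"
    then have "side_normal n j \<bullet> y = cos \<alpha>" "y \<bullet> side_normal n j < cos \<alpha>"
      unfolding side_line_def interior_polygon by blast+
    then show False by (simp add: inner_commute)
  qed
qed

text \<open>
  The lines through the two sides that meet at a corner are different.
\<close>
lemma corner_not_smooth: "\<not> smooth_point R (corner n j)"
proof
  assume "smooth_point R (corner n j)"
  moreover have "corner n j \<in> side_line j"
    unfolding corner_side(1) by (simp add: side_line_def inner_simps)
  moreover have "corner n (j - 1 + 1) \<in> side_line (j - 1)"
    unfolding corner_side(2) by (simp add: side_line_def inner_simps)
  then have "corner n j \<in> side_line (j - 1)" by simp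
  ultimately have "side_line j = side_line (j - 1)"
    using side_line unfolding smooth_point_def by metis
  moreover have "corner n (j + 1) \<in> side_line j"
    unfolding corner_side(2) by (simp add: side_line_def inner_simps)
  ultimately have "corner n (j + 1) \<bullet> side_normal n (j - 1) = cos \<alpha>"
    by (simp add: side_line_def inner_commute)
  moreover have "corner n (j + 1) \<bullet> side_normal n (j - 1) = cos (3 * \<alpha>)"
    unfolding corner_def side_normal_def inner_dir
    by (rule arg_cong[of _ _ cos]) (simp add: side_angle_def algebra_simps)
  moreover have "cos (3 * \<alpha>) < cos \<alpha>"
    using angle_bounds by (intro cos_monotone_0_pi) auto
  ultimately show False by simp
qed

text \<open>
  All sides but one are inactive at a point inside a side.  A line through the point which is not
  parallel to that side has a direction that points strictly inwards, and a small step in this direction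
  reaches the interior.
\<close>
lemma side_point_smooth:
  assumes t: "\<bar>t\<bar> < sin \<alpha>"
  shows "smooth_point R (cos \<alpha> *\<^sub>R side_normal n j + t *\<^sub>R side_tangent n j)" (is "smooth_point R ?q")
proof -
  let ?N = "side_normal n j" and ?T = "side_tangent n j"
  have s: "0 < sin \<alpha>" by (rule sin_angle_pos)
  define a where "a = (sin \<alpha> - t) / (2 * sin \<alpha>)"
  define b where "b = (sin \<alpha> + t) / (2 * sin \<alpha>)"
  have ab: "0 < a" "0 < b" "a + b = 1" "b * sin \<alpha> - a * sin \<alpha> = t"
    using t s by (auto simp: a_def b_def field_simps)
  have q: "?q = a *\<^sub>R corner n j + b *\<^sub>R corner n (j + 1)"
  proof -
    have "a *\<^sub>R corner n j + b *\<^sub>R corner n (j + 1) = ((a + b) * cos \<alpha>) *\<^sub>R ?N + (b * sin \<alpha> - a * sin \<alpha>) *\<^sub>R ?T"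
      unfolding corner_side[of j] by (simp add: algebra_simps)
    then show ?thesis by (simp add: ab)
  qed
  have qR: "?q \<in> R"
    unfolding q using convex_polygon corner_in ab by (intro convexD) auto
  have qN: "?q \<bullet> ?N = cos \<alpha>" by (simp add: inner_add_left)
  have strict: "?q \<bullet> side_normal n i < cos \<alpha>" if "side_normal n i \<noteq> ?N" for i
  proof (rule ccontr)
    let ?M = "side_normal n i"
    assume "\<not> ?q \<bullet> ?M < cos \<alpha>"
    then have "cos \<alpha> \<le> a * (corner n j \<bullet> ?M) + b * (corner n (j + 1) \<bullet> ?M)"
      by (simp add: q inner_add_left)
    moreover have "a * (corner n j \<bullet> ?M) \<le> a * cos \<alpha>" "b * (corner n (j + 1) \<bullet> ?M) \<le> b * cos \<alpha>"
      using corner_inner_side ab by simp_all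
    moreover have "a * cos \<alpha> + b * cos \<alpha> = cos \<alpha>" using ab(3) by (simp flip: distrib_right)
    ultimately have "a * (corner n j \<bullet> ?M) = a * cos \<alpha>" "b * (corner n (j + 1) \<bullet> ?M) = b * cos \<alpha>"
      by linarith+
    then have e: "corner n j \<bullet> ?M = cos \<alpha>" "corner n (j + 1) \<bullet> ?M = cos \<alpha>" using ab by simp_all
    have "?T \<bullet> ?M = 0" "?N \<bullet> ?M = 1"
    proof -
      have "cos \<alpha> * (?N \<bullet> ?M) - sin \<alpha> * (?T \<bullet> ?M) = cos \<alpha>" "cos \<alpha> * (?N \<bullet> ?M) + sin \<alpha> * (?T \<bullet> ?M) = cos \<alpha>"
        using e unfolding corner_side[of j] by (simp_all add: inner_simps)
      then have "sin \<alpha> * (?T \<bullet> ?M) = 0" "cos \<alpha> * (?N \<bullet> ?M) = cos \<alpha>" by linarith+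
      then show "?T \<bullet> ?M = 0" "?N \<bullet> ?M = 1" using s cos_angle_pos by simp_all
    qed
    then have "?M = ?N" using side_frame[of ?M n j] by (simp add: inner_commute)
    then show False using that by simp
  qed
  have unique: "L = side_line j" if L: "affine L" "aff_dim L = 1" "?q \<in> L" "L \<inter> interior R = {}" for L
  proof -
    have "\<exists>v c. v \<noteq> 0 \<and> affine hull L = {y. v \<bullet> y = c}"
      using L(2) by (intro iffD1[OF aff_dim_eq_hyperplane]) simp
    then obtain v c where v: "v \<noteq> 0" "L = {y. v \<bullet> y = c}"
      unfolding hull_same[of affine, OF L(1)] by blast
    \<comment> \<open>a direction vector of the line \<open>L\<close>\<close>
    define d where "d = (v \<bullet> ?N) *\<^sub>R ?T - (v \<bullet> ?T) *\<^sub>R ?N"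
    have vd: "v \<bullet> d = 0" by (simp add: d_def inner_simps)
    have "v \<bullet> ?T = 0"
    proof (rule ccontr)
      assume vT: "v \<bullet> ?T \<noteq> 0"
      let ?O = "\<Inter>i\<in>{i\<in>{0..<int n}. side_normal n i \<noteq> ?N}. {y. side_normal n i \<bullet> y < cos \<alpha>}"
      have "finite {i \<in> {0..<int n}. side_normal n i \<noteq> ?N}" by (rule finite_Collect_conjI) simp
      then have "open ?O" by (intro open_INT ballI open_halfspace_lt)
      moreover have "?q \<in> ?O" using strict by (auto simp: inner_commute simp del: inner_simps)
      ultimately obtain r where r: "r > 0" "ball ?q r \<subseteq> ?O" using openE by blast
      define e where "e = r / (2 * (norm d + 1))"
      have "e > 0" using r by (simp add: e_def add_nonneg_pos)
      \<comment> \<open>the sign makes the step point into the polygon\<close>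
      define y where "y = ?q + (e * sgn (v \<bullet> ?T)) *\<^sub>R d"
      have "norm ((e * sgn (v \<bullet> ?T)) *\<^sub>R d) = e * norm d" using vT \<open>e > 0\<close> by (simp add: abs_mult abs_sgn_eq)
      also have "\<dots> < r"
      proof -
        have "r / (2 * K) * K = r / 2" if "K \<noteq> 0" for K using that by simp
        then have "e * (norm d + 1) = r / 2"
          unfolding e_def using norm_ge_zero[of d] by (metis add_nonneg_pos less_irrefl zero_less_one)
        moreover have "e * norm d \<le> e * (norm d + 1)" using \<open>e > 0\<close> by (intro mult_left_mono) auto
        ultimately show ?thesis using r(1) by simp
      qed
      finally have "y \<in> ball ?q r" by (simp add: y_def dist_norm)
      then have O: "y \<in> ?O" using r by blast
      have "y \<bullet> ?N = cos \<alpha> - e * (sgn (v \<bullet> ?T) * (v \<bullet> ?T))"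
        by (simp add: y_def d_def inner_simps)
      also have "sgn (v \<bullet> ?T) * (v \<bullet> ?T) = \<bar>v \<bullet> ?T\<bar>" by (simp add: abs_sgn mult.commute)
      also have "cos \<alpha> - e * \<bar>v \<bullet> ?T\<bar> < cos \<alpha>" using \<open>e > 0\<close> vT by simp
      finally have yN: "y \<bullet> ?N < cos \<alpha>" .
      have "y \<bullet> side_normal n i < cos \<alpha>" for i
      proof -
        have "i mod int n \<in> {0..<int n}" using n3 by simp
        then have "y \<bullet> side_normal n (i mod int n) < cos \<alpha>"
          using O yN by (cases "side_normal n (i mod int n) = ?N") (auto simp: inner_commute)
        then show ?thesis by (simp add: side_normal_mod)
      qed
      then have "y \<in> interior R" by (simp add: interior_polygon)
      moreover have "y \<in> L" using L(3) vd by (simp add: v(2) y_def inner_add_right)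
      ultimately show False using L(4) by blast
    qed
    then have "v = (v \<bullet> ?N) *\<^sub>R ?N" using side_frame[of v n j] by simp
    moreover from this have "v \<bullet> ?N \<noteq> 0" using v(1) by auto
    moreover have "v \<bullet> ?q = c" using L(3) v(2) by simp
    ultimately obtain k where k: "k \<noteq> 0" "v = k *\<^sub>R ?N" "v \<bullet> ?q = c" by blast
    then have "c = k * cos \<alpha>" using qN by (simp add: inner_commute)
    then show ?thesis using v(2) k by (simp add: side_line_def)
  qed
  have "?q \<in> frontier R" using qR qN by (auto simp: frontier_polygon)
  moreover have "?q \<in> side_line j" using qN by (simp add: side_line_def inner_commute)
  ultimately show ?thesis
    unfolding smooth_point_def
  proof (intro conjI ex1I[of _ "side_line j"])
    fix L assume "affine L \<and> aff_dim L = 1 \<and> ?q \<in> L \<and> L \<inter> interior R = {}"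
    then show "L = side_line j" using unique by (elim conjE)
  qed (use side_line[of j] in simp_all)
qed

section \<open>Minimal orbits of polygons with an odd number of sides\<close>

lemma vertex_orbit_pair:
  assumes "odd n"
  shows "vertex_orbit n j = cyclic_seq [vertex n j, - cos \<alpha> *\<^sub>R vertex n j]"
  using opposite_side_odd[OF assms, of "int j"]
  by (simp add: vertex_orbit_def edge_midpoint_eq vertex_corner)

lemma vertex_orbit_properties:
  assumes "odd n"
  shows "vertex_orbit n j \<in> bounce_orbits R 2" "orbit_length (vertex_orbit n j) = 2 * (1 + cos \<alpha>)"
    "singular_orbit R (vertex_orbit n j)"
    "orbit_trace (vertex_orbit n j) = closed_segment (vertex n j) (- cos \<alpha> *\<^sub>R vertex n j)"
proof -
  let ?v = "vertex n j" and ?w = "- cos \<alpha> *\<^sub>R vertex n j"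
  have nv: "norm ?v = 1" by (simp add: vertex_corner corner_def)
  have vv: "?v \<bullet> ?v = 1" using nv by (simp add: dot_square_norm)
  have N: "side_normal n (int j + int (n div 2)) = - ?v"
    using opposite_side_odd[OF assms, of "int j"] by (simp add: vertex_corner)
  have w: "?w = edge_midpoint n (j + n div 2)" using N by (simp add: edge_midpoint_eq)
  have vw: "?v - ?w = (1 + cos \<alpha>) *\<^sub>R ?v" "?w - ?v = (1 + cos \<alpha>) *\<^sub>R (- ?v)"
    by (simp_all add: algebra_simps)
  have "corner n (int j) \<bullet> side_normal n (int j) = cos \<alpha>"
    unfolding corner_side(1) by (simp add: inner_simps)
  then have fv: "?v \<in> frontier R"
    using corner_in[of "int j"] unfolding frontier_polygon vertex_corner by blast
  have fw: "?w \<in> frontier R" unfolding w using edge_midpoint_in_edge edge_frontier by blast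
  have c: "0 < cos \<alpha>" by (rule cos_angle_pos)
  have "?v \<noteq> ?w"
  proof
    assume "?v = ?w"
    then have "(1 + cos \<alpha>) *\<^sub>R ?v = 0" using vw(1) by simp
    then show False using c nv by auto
  qed
  moreover have "y \<bullet> (?v - ?w) \<le> ?v \<bullet> (?v - ?w)" if "y \<in> R" for y
  proof -
    have "y \<bullet> ?v \<le> norm y * norm ?v" by (rule norm_cauchy_schwarz)
    also have "\<dots> \<le> 1" using polygon_norm_le[OF that] nv by simp
    finally show ?thesis unfolding vw using c vv by simp
  qed
  moreover have "y \<bullet> (?w - ?v) \<le> ?w \<bullet> (?w - ?v)" if "y \<in> R" for y
  proof -
    have "y \<bullet> (- ?v) \<le> ?w \<bullet> (- ?v)"
      using polygon_below_side[OF that, of "int j + int (n div 2)"] vv unfolding N by simp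
    then show ?thesis unfolding vw inner_scaleR_right using c by (intro mult_left_mono) auto
  qed
  ultimately show b: "vertex_orbit n j \<in> bounce_orbits R 2" and "orbit_length (vertex_orbit n j) = 2 * (1 + cos \<alpha>)"
    unfolding vertex_orbit_pair[OF assms] using closed_orbits_pair[of ?v R ?w] fv fw vw(1) nv c by auto
  have "\<not> smooth_point R (vertex_orbit n j 0)"
    unfolding vertex_orbit_pair[OF assms] cyclic_seq_pair using corner_not_smooth by (simp add: vertex_corner)
  then show "singular_orbit R (vertex_orbit n j)"
    using b by (auto simp: singular_orbit_def bounce_orbits_def closed_orbits_def)
  show "orbit_trace (vertex_orbit n j) = closed_segment ?v ?w"
    unfolding vertex_orbit_pair[OF assms] by (rule orbit_trace_pair)
qed

lemma cos_angle_less_1: "cos \<alpha> < 1"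
  using cos_monotone_0_pi[of 0 \<alpha>] angle_bounds by simp

lemma vertex_orbit_trace_inj:
  assumes "odd n" "i < n" "j < n" "orbit_trace (vertex_orbit n i) = orbit_trace (vertex_orbit n j)"
  shows "i = j"
proof -
  have "{vertex n i, - cos \<alpha> *\<^sub>R vertex n i} = {vertex n j, - cos \<alpha> *\<^sub>R vertex n j}"
    using assms(4) unfolding vertex_orbit_properties(4)[OF assms(1)] by simp
  moreover have "vertex n i \<noteq> - cos \<alpha> *\<^sub>R vertex n j"
  proof
    assume "vertex n i = - cos \<alpha> *\<^sub>R vertex n j"
    then have "norm (vertex n i) = cos \<alpha> * norm (vertex n j)" using cos_angle_pos by simp
    then show False using cos_angle_less_1 by (simp add: vertex_corner corner_def)
  qed
  ultimately have "vertex n i = vertex n j" by (auto simp: doubleton_eq_iff)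
  then show ?thesis using vertex_inj assms by blast
qed

lemma odd_length_ge:
  assumes "odd n" "5 \<le> n" "c \<in> closed_orbits R"
  shows "2 * (1 + cos \<alpha>) \<le> orbit_length c"
  using closed_billiard.length_lower_bound(1)[OF closed_billiardI[OF assms(3)], of "1 + cos \<alpha>"]
    odd_width_bound[OF assms(1)] odd_triple_bound[OF assms(1,2)] by simp

lemma unit_polygon_point:
  assumes "norm v = 1" "v \<in> R" "A \<in> R" "A \<bullet> v = h v"
  shows "A = v"
proof -
  have "v \<bullet> v \<le> h v" using support_fun_ge[OF compact_polygon assms(2)] .
  then have "1 \<le> A \<bullet> v" using assms by (simp add: dot_square_norm)
  moreover have "A \<bullet> A \<le> 1"
    using polygon_norm_le[OF assms(3)] by (simp add: dot_square_norm power_le_one)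
  moreover have "v \<bullet> v = 1" using assms(1) by (simp add: dot_square_norm)
  moreover have "(A - v) \<bullet> (A - v) = A \<bullet> A - 2 * (A \<bullet> v) + v \<bullet> v"
    by (simp add: inner_diff_left inner_diff_right inner_commute)
  ultimately have "(A - v) \<bullet> (A - v) \<le> 0" by linarith
  then have "(A - v) \<bullet> (A - v) = 0" using inner_ge_zero[of "A - v"] by linarith
  then show ?thesis by simp
qed

text \<open>
  One turning point is the corner in the common direction, because no other point of the polygon
  supports this direction; the other one is then determined by the width.
\<close>
lemma odd_min_trace:
  assumes "odd n" "5 \<le> n" "c \<in> closed_orbits R" "orbit_length c = 2 * (1 + cos \<alpha>)"
  obtains j where "j < n" "orbit_trace c = orbit_trace (vertex_orbit n j)"
proof -
  interpret closed_billiard R c using assms(3) by (rule closed_billiardI)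
  obtain v where v: "norm v = 1" "range u = {v, - v}" "h v + h (- v) = 1 + cos \<alpha>"
    using length_lower_bound(2)[of "1 + cos \<alpha>"] odd_width_bound[OF assms(1)] odd_triple_bound[OF assms(1,2)] assms(4)
    by blast
  obtain A B where AB: "A \<in> R" "B \<in> R" "A \<bullet> v = h v" "B \<bullet> (- v) = h (- v)"
    "A - B = (1 + cos \<alpha>) *\<^sub>R v" "orbit_trace c = closed_segment A B"
    using v(1,2) unfolding v(3)[symmetric] by (rule bouncing_ball_trace)
  obtain i where i: "v = corner n i \<or> - v = corner n i"
    using odd_width_equality[OF assms(1) v(1,3)] by blast
  obtain j where j: "j < n" "corner n i = vertex n j" by (rule corner_nat)
  have vR: "vertex n j \<in> R" unfolding vertex_corner by (rule corner_in)
  have "orbit_trace c = closed_segment (vertex n j) (- cos \<alpha> *\<^sub>R vertex n j)"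
    using i
  proof
    assume "v = corner n i"
    then have vj: "v = vertex n j" using j by simp
    then have A: "A = v" using unit_polygon_point[OF v(1) _ AB(1,3)] vR by simp
    have "B = A - (A - B)" by simp
    then have "B = v - (1 + cos \<alpha>) *\<^sub>R v" unfolding AB(5) unfolding A .
    then have "B = - cos \<alpha> *\<^sub>R v" by (simp add: scaleR_add_left)
    then show ?thesis using AB(6) A vj by simp
  next
    assume "- v = corner n i"
    then have vj: "- v = vertex n j" using j by simp
    have "norm (- v) = 1" using v(1) by simp
    moreover have "- v \<in> R" unfolding vj by (rule vR)
    ultimately have B: "B = - v" by (rule unit_polygon_point[OF _ _ AB(2,4)])
    have "A = (A - B) + B" by simp
    then have "A = (1 + cos \<alpha>) *\<^sub>R v + - v" unfolding AB(5) unfolding B .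
    then have "A = - cos \<alpha> *\<^sub>R (- v)" by (simp add: scaleR_add_left)
    then show ?thesis using AB(6) B vj by (simp add: closed_segment_commute)
  qed
  then show thesis using that j(1) vertex_orbit_properties(4)[OF assms(1)] by metis
qed

theorem odd_width:
  assumes "odd n"
  shows "width R = 1 + cos \<alpha>"
proof (rule width_eqI[OF compact_polygon polygon_nonempty odd_width_bound[OF assms], where u = "corner n 0"])
  have u: "norm (corner n 0) = 1" by (simp add: corner_def)
  show "norm (corner n 0) = 1" by (rule u)
  have "h (corner n 0) = corner n 0 \<bullet> corner n 0"
  proof (rule support_fun_eq[OF corner_in])
    fix y assume "y \<in> R"
    have "y \<bullet> corner n 0 \<le> norm y * norm (corner n 0)" by (rule norm_cauchy_schwarz)
    also have "\<dots> \<le> 1" using polygon_norm_le[OF \<open>y \<in> R\<close>] u by simp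
    finally show "y \<bullet> corner n 0 \<le> corner n 0 \<bullet> corner n 0" using u by (simp add: dot_square_norm)
  qed
  moreover have "h (- corner n 0) = cos \<alpha>"
    using h_side_normal[of "int (n div 2)"] opposite_side_odd[OF assms, of 0] by simp
  ultimately show "h (corner n 0) + h (- corner n 0) = 1 + cos \<alpha>" using u by (simp add: dot_square_norm)
qed

theorem odd_case:
  assumes "odd n" "5 \<le> n"
  defines "C \<equiv> vertex_orbit n ` {..<n}"
  shows "C \<subseteq> bounce_orbits R 2" "C \<subseteq> min_orbits R" "\<forall>c\<in>C. singular_orbit R c"
    "P_min R = C // same_trace R" "card (P_min R) = n"
    "\<forall>c\<in>C. orbit_length c = 2 * (1 + cos \<alpha>)"
proof -
  show 1: "C \<subseteq> bounce_orbits R 2" and 3: "\<forall>c\<in>C. singular_orbit R c"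
    and 6: "\<forall>c\<in>C. orbit_length c = 2 * (1 + cos \<alpha>)"
    using vertex_orbit_properties[OF assms(1)] by (auto simp: C_def)
  show 2: "C \<subseteq> min_orbits R"
    using 1 6 odd_length_ge[OF assms(1,2)] by (auto intro!: min_orbitsI bounce_orbits_closed)
  have m: "vertex_orbit n 0 \<in> C" unfolding C_def using n3 by simp
  show P: "P_min R = C // same_trace R"
    unfolding P_min_def
  proof (rule trace_quotient_eq[OF 2 min_orbits_closed])
    fix c assume c: "c \<in> min_orbits R"
    then have "orbit_length c = 2 * (1 + cos \<alpha>)" using min_orbits_length_eq[OF c] 2 6 m by (metis subsetD)
    then obtain j where "j < n" "orbit_trace c = orbit_trace (vertex_orbit n j)"
      using odd_min_trace assms(1,2) c min_orbits_closed by blast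
    then show "\<exists>d\<in>C. orbit_trace c = orbit_trace d" by (auto simp: C_def)
  qed
  have "P_min R = (\<lambda>j. same_trace R `` {vertex_orbit n j}) ` {..<n}"
    unfolding P by (auto simp: quotient_def C_def)
  moreover have "inj_on (\<lambda>j. same_trace R `` {vertex_orbit n j}) {..<n}"
  proof (rule inj_onI)
    fix i j assume ij: "i \<in> {..<n}" "j \<in> {..<n}" "same_trace R `` {vertex_orbit n i} = same_trace R `` {vertex_orbit n j}"
    have "vertex_orbit n i \<in> closed_orbits R"
      using vertex_orbit_properties(1)[OF assms(1)] by (rule bounce_orbits_closed)
    then have "orbit_trace (vertex_orbit n i) = orbit_trace (vertex_orbit n j)"
      using ij(3) trace_class_eq_iff by blast
    then show "i = j" using vertex_orbit_trace_inj[OF assms(1)] ij by simp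
  qed
  ultimately show "card (P_min R) = n" by (simp add: card_image)
qed

end

section \<open>Three-bounce orbits along equilateral triangles\<close>

lemma cyclic_seq_triple:
  "cyclic_seq [a, b, c] i = (if i mod 3 = 0 then a else if i mod 3 = 1 then b else c)"
proof -
  have "i mod 3 = 0 \<or> i mod 3 = 1 \<or> i mod 3 = 2" by presburger
  then show ?thesis by (auto simp: cyclic_seq_def)
qed

lemma period_three_seq:
  assumes "\<And>i. c (i + 3) = c i"
  shows "c = cyclic_seq [c 0, c 1, c 2]"
proof
  fix i :: int
  have "c i = c (i mod 3)" using periodic_mod[of c 3 i] assms by simp
  moreover have "i mod 3 = 0 \<or> i mod 3 = 1 \<or> i mod 3 = 2" by presburger
  ultimately show "c i = cyclic_seq [c 0, c 1, c 2] i" by (auto simp: cyclic_seq_triple)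
qed

lemma three_successors:
  fixes i :: int
  obtains "i mod 3 = 0" "(i - 1) mod 3 = 2" "(i + 1) mod 3 = 1"
  | "i mod 3 = 1" "(i - 1) mod 3 = 0" "(i + 1) mod 3 = 2"
  | "i mod 3 = 2" "(i - 1) mod 3 = 1" "(i + 1) mod 3 = 0"
proof -
  have "i mod 3 = 0 \<or> i mod 3 = 1 \<or> i mod 3 = 2" by presburger
  then consider "i mod 3 = 0" | "i mod 3 = 1" | "i mod 3 = 2" by blast
  then show thesis
  proof cases
    case 1
    from this have "(i - 1) mod 3 = 2" "(i + 1) mod 3 = 1" by presburger+
    with 1 show thesis by (rule that(1))
  next
    case 2
    from this have "(i - 1) mod 3 = 0" "(i + 1) mod 3 = 2" by presburger+
    with 2 show thesis by (rule that(2))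
  next
    case 3
    from this have "(i - 1) mod 3 = 1" "(i + 1) mod 3 = 0" by presburger+
    with 3 show thesis by (rule that(3))
  qed
qed

text \<open>
  Written as a function of the vertex set, so that traces do not depend on the order of the vertices; the
  degenerate segments from a vertex to itself do no harm.
\<close>
definition triangle_trace :: "plane set \<Rightarrow> plane set" where
  "triangle_trace S = (\<Union>a\<in>S. \<Union>b\<in>S. closed_segment a b)"

lemma orbit_trace_triple: "orbit_trace (cyclic_seq [a, b, c]) = triangle_trace {a, b, c}"
proof
  let ?q = "cyclic_seq [a, b, c]"
  have "?q i \<in> {a, b, c}" for i by (simp add: cyclic_seq_triple)
  then show "orbit_trace ?q \<subseteq> triangle_trace {a, b, c}"
    unfolding orbit_trace_def triangle_trace_def by blast
  have e: "closed_segment (?q i) (?q (i + 1)) \<subseteq> orbit_trace ?q" for i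
    unfolding orbit_trace_def by blast
  have ab: "closed_segment a b \<subseteq> orbit_trace ?q" using e[of 0] by (simp add: cyclic_seq_triple)
  have bc: "closed_segment b c \<subseteq> orbit_trace ?q" using e[of 1] by (simp add: cyclic_seq_triple)
  have ca: "closed_segment c a \<subseteq> orbit_trace ?q" using e[of 2] by (simp add: cyclic_seq_triple)
  have "closed_segment b a \<subseteq> orbit_trace ?q" "closed_segment c b \<subseteq> orbit_trace ?q"
    "closed_segment a c \<subseteq> orbit_trace ?q"
    using ab bc ca by (simp_all only: closed_segment_commute[of b a] closed_segment_commute[of c b] closed_segment_commute[of a c])
  moreover have "a \<in> orbit_trace ?q" "b \<in> orbit_trace ?q" "c \<in> orbit_trace ?q"
    using ab bc ca ends_in_segment by blast+
  ultimately show "triangle_trace {a, b, c} \<subseteq> orbit_trace ?q"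
    unfolding triangle_trace_def using ab bc ca by simp
qed

text \<open>
  If the vertices lie on a sphere around 0, the trace determines them: other points of a chord have
  smaller norm.
\<close>
lemma triangle_trace_sphere:
  assumes "\<And>a. a \<in> S \<Longrightarrow> norm a = r"
  shows "{y \<in> triangle_trace S. norm y = r} = S"
proof
  show "S \<subseteq> {y \<in> triangle_trace S. norm y = r}"
    unfolding triangle_trace_def using assms ends_in_segment by blast
  show "{y \<in> triangle_trace S. norm y = r} \<subseteq> S"
  proof clarify
    fix y assume y: "y \<in> triangle_trace S" "r = norm y"
    then obtain a b where ab: "a \<in> S" "b \<in> S" "y \<in> closed_segment a b" by (auto simp: triangle_trace_def)
    have "y \<notin> open_segment a b"
      using dist_decreases_open_segment[of y a b 0] assms[OF ab(1)] assms[OF ab(2)] y(2) by auto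
    then show "y \<in> S" using ab by (auto simp: open_segment_def)
  qed
qed

text \<open>
  For an equilateral triangle centred at 0 the bounce vector at a vertex is a positive multiple of that
  vertex.
\<close>
lemma equilateral_orbit:
  assumes front: "a \<in> frontier T" "b \<in> frontier T" "c \<in> frontier T"
    and dist: "dist a b = d" "dist b c = d" "dist c a = d" "d > 0" and sum: "a + b + c = 0"
    and supp: "\<And>y p. y \<in> T \<Longrightarrow> p \<in> {a, b, c} \<Longrightarrow> y \<bullet> p \<le> p \<bullet> p"
  shows "cyclic_seq [a, b, c] \<in> bounce_orbits T 3" "orbit_length (cyclic_seq [a, b, c]) = 3 * d"
proof -
  let ?q = "cyclic_seq [a, b, c]"
  have support: "outward_support_vector T p ((p - p1) /\<^sub>R norm (p - p1) + (p - p2) /\<^sub>R norm (p - p2))"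
    if "p \<in> {a, b, c}" "norm (p - p1) = d" "norm (p - p2) = d" "p + p1 + p2 = 0" for p p1 p2
  proof -
    have "p1 + p2 = - p" using that(4) by (simp add: eq_neg_iff_add_eq_0 add.commute add.left_commute)
    moreover have "(p - p1) + (p - p2) = 2 *\<^sub>R p - (p1 + p2)" by (simp add: scaleR_2)
    moreover have "2 *\<^sub>R p - - p = 3 *\<^sub>R p" by (rule plane_eqI) simp_all
    ultimately have e: "(p - p1) + (p - p2) = 3 *\<^sub>R p" by (simp only:)
    have "(p - p1) /\<^sub>R norm (p - p1) + (p - p2) /\<^sub>R norm (p - p2) = (3 / d) *\<^sub>R p"
      unfolding that(2,3) scaleR_add_right[symmetric] e by (simp add: divide_inverse mult.commute)
    moreover have "(y - p) \<bullet> ((3 / d) *\<^sub>R p) \<le> 0" if "y \<in> T" for y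
      using supp[OF that \<open>p \<in> {a, b, c}\<close>] dist(4)
      by (simp add: inner_diff_left mult_nonneg_nonpos divide_nonpos_pos)
    ultimately show ?thesis using that(1) front by (auto simp: outward_support_vector_def)
  qed
  have n: "norm (a - b) = d" "norm (b - a) = d" "norm (b - c) = d" "norm (c - b) = d"
    "norm (c - a) = d" "norm (a - c) = d"
    using dist by (simp_all add: dist_norm norm_minus_commute)
  have ne: "a \<noteq> b" "b \<noteq> c" "c \<noteq> a" using dist by auto
  have "?q i \<in> frontier T \<and> ?q i \<noteq> ?q (i + 1) \<and> outward_support_vector T (?q i)
      ((?q i - ?q (i - 1)) /\<^sub>R norm (?q i - ?q (i - 1)) + (?q i - ?q (i + 1)) /\<^sub>R norm (?q i - ?q (i + 1)))" for i
  proof (cases i rule: three_successors)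
    case 1
    then show ?thesis using support[of a c b] front ne n sum
      by (simp add: cyclic_seq_triple add.commute add.left_commute)
  next
    case 2
    then show ?thesis using support[of b a c] front ne n sum
      by (simp add: cyclic_seq_triple add.commute add.left_commute)
  next
    case 3
    then show ?thesis using support[of c b a] front ne n sum
      by (simp add: cyclic_seq_triple add.commute add.left_commute)
  qed
  then have bo: "billiard_orbit T ?q" by (simp add: billiard_orbit_def)
  have c3: "closes_after ?q 3" by (simp add: closes_after_def cyclic_seq_triple)
  have b: "bounces ?q = 3"
  proof (rule bounces_eq[OF c3])
    fix k assume k: "closes_after ?q k"
    then have "k \<ge> 2" by (simp add: closes_after_def)
    moreover have "k \<noteq> 2"
    proof
      assume "k = 2"
      then have "?q (0 + int 2) = ?q 0" using k unfolding closes_after_def by blast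
      then show False using ne by (simp add: cyclic_seq_triple)
    qed
    ultimately show "3 \<le> k" by simp
  qed
  show "?q \<in> bounce_orbits T 3" using bo c3 b by (auto simp: bounce_orbits_def closed_orbits_def)
  have "{..<3::nat} = {0, 1, 2}" by auto
  then show "orbit_length ?q = 3 * d"
    unfolding orbit_length_def b using n by (simp add: cyclic_seq_triple)
qed

lemma inner_of_dist:
  fixes p q :: "'a::real_inner"
  assumes "norm p = r" "norm q = r"
  shows "p \<bullet> q = r\<^sup>2 - (dist p q)\<^sup>2 / 2"
  using assms dot_norm_neg[of p q] by (simp add: dist_norm field_simps)

text \<open>
  The sum of the three points is orthogonal to all sides of the triangle.  Were it not 0, the points would
  lie on one line, which equal distances exclude.
\<close>
lemma equilateral_sum_zero:
  fixes a b c :: plane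
  assumes n: "norm a = r" "norm b = r" "norm c = r"
    and d: "a \<noteq> b" "dist a b = dist b c" "dist b c = dist c a"
  shows "a + b + c = 0"
proof (rule ccontr)
  assume s: "a + b + c \<noteq> 0"
  have i: "b \<bullet> c = a \<bullet> b" "c \<bullet> a = a \<bullet> b"
    using inner_of_dist[OF n(1,2)] inner_of_dist[OF n(2,3)] inner_of_dist[OF n(3,1)] d by simp_all
  have rr: "a \<bullet> a = r\<^sup>2" "b \<bullet> b = r\<^sup>2" "c \<bullet> c = r\<^sup>2" using n by (simp_all add: dot_square_norm)
  have orth: "(a + b + c) \<bullet> (a - b) = 0" "(a + b + c) \<bullet> (b - c) = 0"
    using i rr by (simp_all add: inner_simps inner_commute)
  obtain t where t: "a + b + c = norm (a + b + c) *\<^sub>R dir t" by (rule polar_form)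
  have line: "w = (w \<bullet> dir (t + pi / 2)) *\<^sub>R dir (t + pi / 2)" if "(a + b + c) \<bullet> w = 0" for w
  proof -
    have "norm (a + b + c) * (dir t \<bullet> w) = 0" using that t by (metis inner_scaleR_left)
    then have "w \<bullet> dir t = 0" using s by (simp add: inner_commute)
    then show ?thesis using dir_frame[of w t] by simp
  qed
  define k where "k = (a - b) \<bullet> dir (t + pi / 2)"
  define l where "l = (b - c) \<bullet> dir (t + pi / 2)"
  have ab: "a - b = k *\<^sub>R dir (t + pi / 2)" and bc: "b - c = l *\<^sub>R dir (t + pi / 2)"
    unfolding k_def l_def using line orth by blast+
  have "c - a = - ((a - b) + (b - c))" by simp
  then have ca: "c - a = (- (k + l)) *\<^sub>R dir (t + pi / 2)"
    unfolding ab bc by (simp only: scaleR_minus_left scaleR_add_left)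
  have "\<bar>k\<bar> = \<bar>l\<bar>" "\<bar>l\<bar> = \<bar>k + l\<bar>"
    using d(2,3) unfolding dist_norm ab bc ca norm_scaleR norm_dir by simp_all
  then have "k = 0" by linarith
  then show False using ab d(1) by simp
qed

context regular_ngon
begin

section \<open>Triangles of edge midpoints\<close>

lemma norm_edge_midpoint: "norm (edge_midpoint n j) = cos \<alpha>"
  unfolding edge_midpoint_eq using cos_angle_pos by simp

lemma midpoint_triangles_iff:
  "c \<in> midpoint_triangles n \<longleftrightarrow> (\<exists>i j k. c = cyclic_seq [edge_midpoint n i, edge_midpoint n j, edge_midpoint n k]
     \<and> i < n \<and> j < n \<and> k < n \<and> edge_midpoint n i \<noteq> edge_midpoint n j
     \<and> dist (edge_midpoint n i) (edge_midpoint n j) = dist (edge_midpoint n j) (edge_midpoint n k)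
     \<and> dist (edge_midpoint n j) (edge_midpoint n k) = dist (edge_midpoint n k) (edge_midpoint n i))"
  by (auto simp: midpoint_triangles_def)

lemma edge_midpoint_support:
  assumes "y \<in> R"
  shows "y \<bullet> edge_midpoint n j \<le> edge_midpoint n j \<bullet> edge_midpoint n j"
  unfolding edge_midpoint_eq using polygon_below_side[OF assms, of "int j"] cos_angle_pos by simp

lemma equilateral_inner:
  fixes a b c :: plane
  assumes "norm a = r" "norm b = r" "norm c = r" "a \<noteq> b" "dist a b = dist b c" "dist b c = dist c a"
  shows "a \<bullet> b = - r\<^sup>2 / 2" "dist a b = sqrt 3 * r"
proof -
  have "a \<bullet> (a + b + c) = 0" using equilateral_sum_zero[OF assms] by simp
  moreover have "a \<bullet> c = a \<bullet> b"
    using inner_of_dist[OF assms(1,2)] inner_of_dist[OF assms(3,1)] assms(5,6) by (simp add: inner_commute)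
  moreover have "a \<bullet> a = r\<^sup>2" using assms by (simp add: dot_square_norm)
  ultimately show ab: "a \<bullet> b = - r\<^sup>2 / 2" by (simp add: inner_add_right)
  have "(dist a b)\<^sup>2 = 3 * r\<^sup>2" using inner_of_dist[OF assms(1,2)] ab by simp
  also have "\<dots> = (sqrt 3 * r)\<^sup>2" by (simp add: power_mult_distrib)
  finally show "dist a b = sqrt 3 * r"
    by (rule power2_eq_imp_eq) (use assms(1) norm_ge_zero[of a] in auto)
qed

lemma midpoint_triangles_orbit:
  assumes "c \<in> midpoint_triangles n"
  shows "c \<in> bounce_orbits R 3" "c \<in> reg3_orbits R" "orbit_length c = 3 * sqrt 3 * cos \<alpha>"
proof -
  obtain i j k where c: "c = cyclic_seq [edge_midpoint n i, edge_midpoint n j, edge_midpoint n k]"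
    and ne: "edge_midpoint n i \<noteq> edge_midpoint n j"
    and d: "dist (edge_midpoint n i) (edge_midpoint n j) = dist (edge_midpoint n j) (edge_midpoint n k)"
      "dist (edge_midpoint n j) (edge_midpoint n k) = dist (edge_midpoint n k) (edge_midpoint n i)"
    using assms unfolding midpoint_triangles_iff by blast
  note nm = norm_edge_midpoint[of i] norm_edge_midpoint[of j] norm_edge_midpoint[of k]
  have D: "dist (edge_midpoint n i) (edge_midpoint n j) = sqrt 3 * cos \<alpha>"
    by (rule equilateral_inner(2)[OF nm ne d])
  have f: "edge_midpoint n l \<in> frontier R" for l using edge_midpoint_in_edge edge_frontier by blast
  have sup: "y \<bullet> p \<le> p \<bullet> p" if "y \<in> R" "p \<in> {edge_midpoint n i, edge_midpoint n j, edge_midpoint n k}" for y p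
    using that edge_midpoint_support by blast
  note eq = equilateral_orbit[OF f f f D d(1)[unfolded D, symmetric] d(2)[unfolded d(1)[symmetric] D, symmetric] _
    equilateral_sum_zero[OF nm ne d] sup]
  have "0 < sqrt 3 * cos \<alpha>" using cos_angle_pos by simp
  then show b: "c \<in> bounce_orbits R 3" and "orbit_length c = 3 * sqrt 3 * cos \<alpha>"
    unfolding c using eq by simp_all
  have "smooth_point R (edge_midpoint n l)" for l
    using side_point_smooth[of 0 "int l"] sin_angle_pos by (simp add: edge_midpoint_eq)
  then have "smooth_point R (c l)" for l unfolding c by (simp add: cyclic_seq_triple)
  then show "c \<in> reg3_orbits R"
    using b by (auto simp: reg3_orbits_def regular_orbit_def bounce_orbits_def closed_orbits_def)
qed

section \<open>Regular three-bounce orbits\<close>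

lemma smooth_side_coordinate:
  assumes "smooth_point R y" "y \<in> R" "y \<bullet> side_normal n j = cos \<alpha>"
  obtains t where "\<bar>t\<bar> < sin \<alpha>" "y = cos \<alpha> *\<^sub>R side_normal n j + t *\<^sub>R side_tangent n j"
proof -
  obtain t where t: "\<bar>t\<bar> \<le> sin \<alpha>" "y = cos \<alpha> *\<^sub>R side_normal n j + t *\<^sub>R side_tangent n j"
    using side_coordinate assms(2,3) by blast
  have "t \<noteq> sin \<alpha>" "t \<noteq> - sin \<alpha>"
    using assms(1) corner_not_smooth[of j] corner_not_smooth[of "j + 1"] unfolding t(2) corner_side[of j] by auto
  then have "\<bar>t\<bar> < sin \<alpha>" using t(1) by linarith
  then show thesis using that t(2) by blast
qed

text \<open>
  The two corners of the side leave no tangential component, and 0 fixes the sign.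
\<close>
lemma smooth_point_normal:
  assumes t: "\<bar>t\<bar> < sin \<alpha>" and q: "q = cos \<alpha> *\<^sub>R side_normal n j + t *\<^sub>R side_tangent n j"
    and \<nu>: "\<And>y. y \<in> R \<Longrightarrow> y \<bullet> \<nu> \<le> q \<bullet> \<nu>"
  obtains c where "0 \<le> c" "\<nu> = c *\<^sub>R side_normal n j"
proof -
  let ?N = "side_normal n j \<bullet> \<nu>" and ?T = "side_tangent n j \<bullet> \<nu>"
  have "(sin \<alpha> - t) * ?T \<le> 0" "(- sin \<alpha> - t) * ?T \<le> 0" "0 \<le> cos \<alpha> * ?N + t * ?T"
    using \<nu>[OF corner_in[of "j + 1"]] \<nu>[OF corner_in[of j]] \<nu>[OF zero_in_polygon]
    unfolding q corner_side[of j] by (simp_all add: inner_add_left inner_diff_left algebra_simps)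
  moreover from this have "?T = 0"
    using t by (auto simp: mult_le_0_iff abs_if split: if_splits)
  ultimately have "0 \<le> ?N" using cos_angle_pos by (simp add: zero_le_mult_iff)
  moreover have "\<nu> = ?N *\<^sub>R side_normal n j"
    using side_frame[of \<nu> n j] \<open>?T = 0\<close> by (simp add: inner_commute)
  ultimately show thesis using that by blast
qed

lemma reflection_direction:
  assumes "norm w = 1" "dir p - w = c *\<^sub>R dir t" "c \<noteq> 0"
  shows "w = dir (2 * t - p + pi)"
proof -
  have "w = dir p - (dir p - w)" by simp
  then have w: "w = dir p - c *\<^sub>R dir t" unfolding assms(2) .
  have "1 = w \<bullet> w" using assms(1) by (simp add: dot_square_norm)
  also have "\<dots> = 1 - 2 * c * cos (p - t) + c * c"
    unfolding w by (simp add: inner_simps inner_dir cos_diff algebra_simps)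
  finally have "c * c - 2 * c * cos (p - t) = 0" by simp
  moreover have "c * (c - 2 * cos (p - t)) = c * c - 2 * c * cos (p - t)" by (simp add: algebra_simps)
  ultimately have "c * (c - 2 * cos (p - t)) = 0" by simp
  then have "c - 2 * cos (p - t) = 0" using assms(3) unfolding mult_eq_0_iff by blast
  then have c: "c = 2 * cos (p - t)" by simp
  have d: "dir (2 * t - p) + dir p = c *\<^sub>R dir t"
  proof -
    have "(p - (2 * t - p)) / 2 = p - t" "(p + (2 * t - p)) / 2 = t" by (simp_all add: field_simps)
    then show ?thesis using dir_sum[of p "2 * t - p"] by (simp only: c add.commute)
  qed
  have "w = - dir (2 * t - p)" unfolding w d[symmetric] by simp
  then show ?thesis using dir_plus_pi[of "2 * t - p"] by simp
qed

text \<open>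
  The hypothesis says that \<open>\<bar>tan (m * \<alpha>)\<bar> < tan \<alpha>\<close>.  Among the multiples of \<open>\<alpha> = pi / n\<close> only those with
  vanishing tangent satisfy this.
\<close>
lemma slope_below_side:
  assumes "cos \<alpha> * \<bar>sin (of_int m * \<alpha>)\<bar> < sin \<alpha> * \<bar>cos (of_int m * \<alpha>)\<bar>"
  shows "int n dvd m"
proof -
  let ?a = "of_int m * \<alpha>"
  have e: "(2 * of_int m + 1) * \<alpha> = 2 * ?a + \<alpha>" "(2 * of_int (m - 1) + 1) * \<alpha> = 2 * ?a - \<alpha>"
    by (simp_all add: algebra_simps)
  have "cos (2 * ?a + \<alpha>) \<le> cos \<alpha>" "cos (2 * ?a - \<alpha>) \<le> cos \<alpha>"
    using cos_odd_multiple_le[of m] cos_odd_multiple_le[of "m - 1"] unfolding e by blast+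
  then have "cos (2 * ?a) * cos \<alpha> + \<bar>sin (2 * ?a) * sin \<alpha>\<bar> \<le> cos \<alpha>"
    unfolding cos_add[of "2 * ?a"] cos_diff[of "2 * ?a"] by linarith
  then have "2 * \<bar>sin ?a\<bar> * (sin \<alpha> * \<bar>cos ?a\<bar>) \<le> 2 * \<bar>sin ?a\<bar> * (cos \<alpha> * \<bar>sin ?a\<bar>)"
    unfolding cos_double_sin sin_double using sin_angle_pos
    by (simp add: abs_mult algebra_simps power2_eq_square)
  then have "\<not> 0 < 2 * \<bar>sin ?a\<bar>" using assms by (metis mult_le_cancel_left_pos not_less)
  then have "sin ?a = 0" by simp
  then show ?thesis by (simp only: sin_multiple_eq_0)
qed

end

text \<open>
  Let \<open>\<theta> i\<close> be the angle of the normal at the bounce point \<open>q i\<close>.  The composition of the three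
  reflections at the bounce points is again a reflection, and a direction of the orbit is fixed by it;
  hence the chord from \<open>q i\<close> to \<open>q (i + 1)\<close> is orthogonal to the unit vector at the angle
  \<open>\<theta> i + \<theta> (i + 1) - \<theta> (i + 2)\<close>.  This is a linear equation between the positions of the two bounce
  points on their sides.  As the positions are less than half a side away from the midpoints, the equation
  forces the normals at \<open>q i\<close> and \<open>q (i + 1)\<close> to be symmetric with respect to the third one.
\<close>
locale regular_three_orbit = regular_ngon +
  fixes q :: "int \<Rightarrow> plane"
  assumes reg3: "q \<in> reg3_orbits (regular_polygon n)"

sublocale regular_three_orbit \<subseteq> closed_billiard "regular_polygon n" q
  using reg3 by unfold_locales (auto simp: compact_polygon reg3_orbits_def bounce_orbits_def)

context regular_three_orbit
begin

lemma period_three: "q (i + 3) = q i" "u (i + 3) = u i"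
proof -
  have "m = 3" using reg3 by (simp add: reg3_orbits_def bounce_orbits_def)
  then show "q (i + 3) = q i" "u (i + 3) = u i"
    using q_periodic[of i] u_periodic[of i] by simp_all
qed

lemma smooth: "smooth_point R (q i)"
  using reg3 by (simp add: reg3_orbits_def regular_orbit_def)

text \<open>
  The index is chosen as a function of the point, so that it inherits the periodicity of the orbit.
\<close>
definition side_of :: "plane \<Rightarrow> int" where
  "side_of y = (SOME j. y \<bullet> side_normal n j = cos \<alpha>)"

abbreviation N :: "int \<Rightarrow> plane" where "N i \<equiv> side_normal n (side_of (q i))"
abbreviation \<theta> :: "int \<Rightarrow> real" where "\<theta> i \<equiv> side_angle n (side_of (q i))"

definition offset :: "int \<Rightarrow> real" where
  "offset i = q i \<bullet> side_tangent n (side_of (q i))"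

lemma on_side: "q i \<bullet> N i = cos \<alpha>"
proof -
  obtain j where "q i \<bullet> side_normal n j = cos \<alpha>" using q_frontier[of i] by (auto simp: frontier_polygon)
  then show ?thesis unfolding side_of_def by (rule someI)
qed

lemma q_offset: "q i = cos \<alpha> *\<^sub>R N i + offset i *\<^sub>R side_tangent n (side_of (q i))"
  using side_frame[of "q i" n "side_of (q i)"] on_side[of i] by (simp add: offset_def)

lemma offset_less: "\<bar>offset i\<bar> < sin \<alpha>"
proof -
  obtain t where t: "\<bar>t\<bar> < sin \<alpha>" "q i = cos \<alpha> *\<^sub>R N i + t *\<^sub>R side_tangent n (side_of (q i))"
    using smooth_side_coordinate[OF smooth q_in on_side] by blast
  have "q i \<bullet> side_tangent n (side_of (q i)) = t"
    using arg_cong[OF t(2), of "\<lambda>y. y \<bullet> side_tangent n (side_of (q i))"] by (simp add: inner_add_left)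
  then show ?thesis using t(1) by (simp add: offset_def)
qed

lemma normal_multiple:
  assumes "q i \<bullet> side_normal n j = cos \<alpha>"
  obtains c where "0 \<le> c" "u (i - 1) - u i = c *\<^sub>R side_normal n j"
proof -
  obtain t where t: "\<bar>t\<bar> < sin \<alpha>" "q i = cos \<alpha> *\<^sub>R side_normal n j + t *\<^sub>R side_tangent n j"
    using smooth_side_coordinate[OF smooth q_in assms] by blast
  show thesis by (rule smooth_point_normal[OF t support_vector that])
qed

text \<open>
  At a smooth point of the side a bounce vector is normal to the side.  Hence an orbit that runs along the
  side would keep its direction forever and never close.
\<close>
lemma no_gliding:
  assumes "u i \<bullet> side_normal n j = 0" "q i \<bullet> side_normal n j = cos \<alpha>"
  shows False
proof -
  have "u (i + int k) = u i \<and> q (i + int k) \<bullet> side_normal n j = cos \<alpha>" for k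
  proof (induction k)
    case (Suc k)
    have q: "q (i + int k + 1) = q (i + int k) + norm (q (i + int k + 1) - q (i + int k)) *\<^sub>R u i"
      using step[of "i + int k"] Suc by (simp add: algebra_simps)
    have on: "q (i + int k + 1) \<bullet> side_normal n j = cos \<alpha>"
      by (subst q) (simp add: inner_add_left Suc assms)
    obtain c where c: "u (i + int k) - u (i + int k + 1) = c *\<^sub>R side_normal n j"
      using normal_multiple[OF on] by auto
    have "u (i + int k + 1) = u (i + int k) - (u (i + int k) - u (i + int k + 1))" by simp
    then have w: "u (i + int k + 1) = u i - c *\<^sub>R side_normal n j" unfolding c using Suc by simp
    have "1 = u (i + int k + 1) \<bullet> u (i + int k + 1)" using norm_u by (simp add: dot_square_norm)
    also have "\<dots> = u i \<bullet> u i + c * c"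
      unfolding w using assms(1) by (simp add: inner_simps inner_commute)
    finally have "c = 0" using norm_u[of i] by (simp add: dot_square_norm)
    then show ?case using w on by (simp add: algebra_simps)
  qed (use assms in simp)
  then have same: "u (i + int k) = u i" for k by blast
  have grow: "q (i + int k) \<bullet> u i < q (i + int k + 1) \<bullet> u i" for k
  proof -
    have "(q (i + int k + 1) - q (i + int k)) \<bullet> u i = norm (q (i + int k + 1) - q (i + int k)) * (u i \<bullet> u i)"
      using step[of "i + int k"] same[of k] by (metis inner_scaleR_left)
    moreover have "0 < norm (q (i + int k + 1) - q (i + int k))" using q_distinct[of "i + int k"] by simp
    moreover have "u i \<bullet> u i = 1" using norm_u[of i] by (simp add: dot_square_norm)
    ultimately have "0 < (q (i + int k + 1) - q (i + int k)) \<bullet> u i" by (simp only: mult_1_right)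
    then show ?thesis unfolding inner_diff_left by linarith
  qed
  show False using grow[of 0] grow[of 1] grow[of 2] period_three(1)[of i] by (simp add: add.assoc)
qed

text \<open>
  The length of the bounce vector at \<open>q i\<close>.
\<close>
definition turn :: "int \<Rightarrow> real" where
  "turn i = (u (i - 1) - u i) \<bullet> N i"

lemma turn: "u (i - 1) - u i = turn i *\<^sub>R N i" "0 < turn i"
proof -
  obtain c where c: "0 \<le> c" "u (i - 1) - u i = c *\<^sub>R N i" using normal_multiple[OF on_side] by blast
  then have "turn i = c" by (simp add: turn_def)
  then show t: "u (i - 1) - u i = turn i *\<^sub>R N i" using c by simp
  have "turn i \<noteq> 0"
  proof
    assume "turn i = 0"
    then have eq: "u (i - 1) = u i" using t by simp
    have "norm (q (i + 1) - q i) * (u i \<bullet> N i) = (q (i + 1) - q i) \<bullet> N i"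
      using step[of i] by (metis inner_scaleR_left)
    also have "\<dots> \<le> 0" using polygon_below_side[OF q_in, of "i + 1" "side_of (q i)"] on_side[of i]
      by (simp add: inner_diff_left)
    \<comment> \<open>without a turn, both neighbours lie on the inner side of the side of \<open>q i\<close>, hence on its line\<close>
    finally have 1: "u i \<bullet> N i \<le> 0" using q_distinct[of i] by (simp add: mult_le_0_iff)
    have "0 \<le> (q i - q (i - 1)) \<bullet> N i" using polygon_below_side[OF q_in, of "i - 1" "side_of (q i)"] on_side[of i]
      by (simp add: inner_diff_left)
    also have "\<dots> = norm (q i - q (i - 1)) * (u i \<bullet> N i)"
      using step[of "i - 1"] eq by (metis diff_add_cancel inner_scaleR_left)
    finally have "0 \<le> u i \<bullet> N i" using q_distinct[of "i - 1"] by (simp add: zero_le_mult_iff)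
    then show False using no_gliding[of i "side_of (q i)"] 1 on_side by simp
  qed
  then show "0 < turn i" using c \<open>turn i = c\<close> by simp
qed

lemma direction_orthogonal: "u i \<bullet> dir (\<theta> i + \<theta> (i + 1) - \<theta> (i + 2)) = 0"
proof -
  have refl: "u (k + 1) = dir (2 * \<theta> (k + 1) - p + pi)" if "u k = dir p" for k p
    using turn[of "k + 1"] norm_u[of "k + 1"] that
    by (intro reflection_direction[of _ p "turn (k + 1)"]) (auto simp: side_normal_def)
  obtain p where p: "u i = dir p" using norm_u by (rule unit_vector_dir)
  define \<phi> where "\<phi> = \<theta> i + \<theta> (i + 1) - \<theta> (i + 2)"
  have "u (i + 2) = dir (2 * \<theta> (i + 2) - (2 * \<theta> (i + 1) - p + pi) + pi)"
    using refl[OF refl[OF p]] by (simp add: add.assoc)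
  then have "u (i + 2 + 1) = dir (2 * \<theta> (i + 2 + 1) - (2 * \<theta> (i + 2) - (2 * \<theta> (i + 1) - p + pi) + pi) + pi)"
    by (rule refl)
  then have "u i = dir (2 * \<phi> - p + pi)"
    using period_three[of i] by (simp add: add.assoc \<phi>_def algebra_simps)
  then have "u i \<bullet> dir \<phi> = cos (2 * \<phi> - p + pi - \<phi>)" by (simp add: inner_dir)
  also have "2 * \<phi> - p + pi - \<phi> = \<phi> - p + pi" by simp
  also have "cos (\<phi> - p + pi) = - cos (p - \<phi>)" by (metis cos_minus cos_periodic_pi minus_diff_eq)
  also have "cos (p - \<phi>) = u i \<bullet> dir \<phi>" using p by (simp add: inner_dir)
  finally show ?thesis by (simp add: \<phi>_def)
qed

text \<open>
  The orthogonality relation, evaluated in the coordinates of \<open>q i\<close> and \<open>q (i + 1)\<close> along their sides.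
\<close>
lemma chord_equation:
  "cos \<alpha> * (cos (\<theta> i - \<theta> (i + 2)) - cos (\<theta> (i + 1) - \<theta> (i + 2)))
     = offset i * sin (\<theta> (i + 1) - \<theta> (i + 2)) - offset (i + 1) * sin (\<theta> i - \<theta> (i + 2))"
proof -
  define \<phi> where "\<phi> = \<theta> i + \<theta> (i + 1) - \<theta> (i + 2)"
  have "(q (i + 1) - q i) \<bullet> dir \<phi> = norm (q (i + 1) - q i) * (u i \<bullet> dir \<phi>)"
    using step[of i] by (metis inner_scaleR_left)
  then have eq: "q (i + 1) \<bullet> dir \<phi> = q i \<bullet> dir \<phi>"
    using direction_orthogonal[of i] by (simp add: \<phi>_def inner_diff_left)
  have inner: "q k \<bullet> dir \<phi> = cos \<alpha> * cos (\<theta> k - \<phi>) - offset k * sin (\<theta> k - \<phi>)" for k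
  proof -
    have "q k \<bullet> dir \<phi> = cos \<alpha> * cos (\<theta> k - \<phi>) + offset k * cos (\<theta> k + pi / 2 - \<phi>)"
      by (subst q_offset) (simp add: inner_add_left side_normal_def side_tangent_def inner_dir)
    moreover have "cos (\<theta> k + pi / 2 - \<phi>) = - sin (\<theta> k - \<phi>)"
      by (simp add: cos_add cos_diff sin_diff sin_add)
    ultimately show ?thesis by simp
  qed
  have e: "\<theta> (i + 1) - \<phi> = - (\<theta> i - \<theta> (i + 2))" "\<theta> i - \<phi> = - (\<theta> (i + 1) - \<theta> (i + 2))"
    by (simp_all add: \<phi>_def)
  show ?thesis using eq unfolding inner e cos_minus sin_minus by (simp add: algebra_simps)
qed

lemma shift: "i + 2 - 1 = i + 1" "i + 3 - 1 = i + 2" "i - 1 + 3 = i + 2" for i :: int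
  by simp_all

lemma sum_turns: "turn i *\<^sub>R N i + turn (i + 1) *\<^sub>R N (i + 1) + turn (i + 2) *\<^sub>R N (i + 2) = 0"
proof -
  have "turn i *\<^sub>R N i + turn (i + 1) *\<^sub>R N (i + 1) + turn (i + 2) *\<^sub>R N (i + 2)
      = (u (i - 1) - u i) + (u i - u (i + 1)) + (u (i + 1) - u (i + 2))"
    using turn(1)[of i] turn(1)[of "i + 1"] turn(1)[of "i + 2"]
    unfolding shift by (simp only: add_diff_cancel_right')
  also have "\<dots> = 0" using period_three(2)[of "i - 1"] unfolding shift by simp
  finally show ?thesis .
qed

lemma opposite_sines:
  "turn i * sin (\<theta> i - \<theta> (i + 2)) + turn (i + 1) * sin (\<theta> (i + 1) - \<theta> (i + 2)) = 0"
proof -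
  have "(turn i *\<^sub>R N i + turn (i + 1) *\<^sub>R N (i + 1) + turn (i + 2) *\<^sub>R N (i + 2)) \<bullet> dir (\<theta> (i + 2) + pi / 2) = 0"
    unfolding sum_turns by simp
  moreover have "cos (p - (t + pi / 2)) = sin (p - t)" for p t :: real
    by (simp add: cos_add sin_add cos_diff sin_diff)
  ultimately show ?thesis by (simp add: inner_add_left side_normal_def inner_dir)
qed

text \<open>
  Otherwise all three normals are parallel, the whole orbit lies on a line in this direction, and each
  bounce reverses the direction: impossible for an odd number of bounces.
\<close>
lemma sine_nonzero: "sin (\<theta> i - \<theta> (i + 2)) \<noteq> 0"
proof
  assume 0: "sin (\<theta> i - \<theta> (i + 2)) = 0"
  then have 1: "sin (\<theta> (i + 1) - \<theta> (i + 2)) = 0"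
    using opposite_sines[of i] turn(2)[of "i + 1"] by simp
  let ?T = "side_tangent n (side_of (q (i + 2)))"
  have par: "N k \<bullet> ?T = 0" if "sin (\<theta> k - \<theta> (i + 2)) = 0" for k
  proof -
    have "cos (p - (t + pi / 2)) = sin (p - t)" for p t :: real
      by (simp add: cos_add sin_add cos_diff sin_diff)
    then show ?thesis using that by (simp add: side_normal_def side_tangent_def inner_dir)
  qed
  have orth: "N i \<bullet> ?T = 0" "N (i + 1) \<bullet> ?T = 0" "N (i + 2) \<bullet> ?T = 0"
    using par 0 1 by simp_all
  have step_T: "u (k - 1) \<bullet> ?T = u k \<bullet> ?T" if "N k \<bullet> ?T = 0" for k
  proof -
    have "(u (k - 1) - u k) \<bullet> ?T = 0" unfolding turn(1) using that by simp
    then show ?thesis by (simp add: inner_diff_left)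
  qed
  have const: "u (i + 1) \<bullet> ?T = u i \<bullet> ?T" "u (i + 2) \<bullet> ?T = u i \<bullet> ?T"
    using step_T[OF orth(2)] step_T[OF orth(3)] unfolding shift by simp_all
  have "(q (k + 1) - q k) \<bullet> ?T = norm (q (k + 1) - q k) * (u k \<bullet> ?T)" for k
    using step[of k] by (metis inner_scaleR_left)
  note adv = this[of i] this[of "i + 1"] this[of "i + 2"]
  have "(norm (q (i + 1) - q i) + norm (q (i + 2) - q (i + 1)) + norm (q (i + 3) - q (i + 2))) * (u i \<bullet> ?T)
      = (q (i + 1) - q i) \<bullet> ?T + (q (i + 2) - q (i + 1)) \<bullet> ?T + (q (i + 3) - q (i + 2)) \<bullet> ?T"
    using adv const by (simp add: add.assoc distrib_right)
  also have "\<dots> = 0" using period_three(1)[of i] by (simp add: inner_diff_left)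
  finally have "u i \<bullet> ?T = 0" using q_distinct[of i] by (simp add: add_nonneg_eq_0_iff)
  then have zero: "u i \<bullet> ?T = 0" "u (i + 1) \<bullet> ?T = 0" "u (i + 2) \<bullet> ?T = 0" using const by simp_all
  let ?M = "N (i + 2)"
  have sgn: "u k = ?M \<or> u k = - ?M" if "u k \<bullet> ?T = 0" for k
  proof -
    define s where "s = u k \<bullet> ?M"
    have w: "u k = s *\<^sub>R ?M" using side_frame[of "u k" n "side_of (q (i + 2))"] that by (simp add: s_def)
    have "\<bar>s\<bar> = 1" using norm_u[of k] unfolding w by simp
    then have "s = 1 \<or> s = - 1" by linarith
    then show ?thesis unfolding w by auto
  qed
  have flip: "u (k - 1) \<noteq> u k" for k
  proof
    assume "u (k - 1) = u k"
    then have "turn k *\<^sub>R N k = 0" using turn(1)[of k] by simp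
    then show False using turn(2)[of k] by (simp add: side_normal_def)
  qed
  have "u (i + 1) \<noteq> u i" "u (i + 2) \<noteq> u (i + 1)" "u i \<noteq> u (i + 2)"
    using flip[of "i + 1"] flip[of "i + 2"] flip[of "i + 3"] period_three(2)[of i] unfolding shift by auto
  then show False using sgn[OF zero(1)] sgn[OF zero(2)] sgn[OF zero(3)] by metis
qed

text \<open>
  With \<open>e\<close> and \<open>f\<close> the half sum and half difference of the angles \<open>a\<close> and \<open>b\<close> that the two normals make
  with the third, the chord equation and the bound on the offsets give \<open>\<bar>tan e\<bar> < tan \<alpha>\<close>, because \<open>sin a\<close>
  and \<open>sin b\<close> have opposite signs.  As \<open>e\<close> is a multiple of \<open>\<alpha>\<close>, its sine vanishes, that is,
  \<open>b = - a\<close> up to full turns; then the chord equation says that the offsets are opposite.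
\<close>
lemma symmetric_normals:
  "int n dvd side_of (q i) + side_of (q (i + 1)) - 2 * side_of (q (i + 2))"
  "N (i + 1) \<bullet> N (i + 2) = N i \<bullet> N (i + 2)"
  "offset i + offset (i + 1) = 0"
proof -
  define a where "a = \<theta> i - \<theta> (i + 2)"
  define b where "b = \<theta> (i + 1) - \<theta> (i + 2)"
  define m where "m = side_of (q i) + side_of (q (i + 1)) - 2 * side_of (q (i + 2))"
  define e where "e = (a + b) / 2"
  define f where "f = (a - b) / 2"
  have "a + b = 2 * (of_int m * \<alpha>)"
    by (simp add: a_def b_def m_def side_angle_def algebra_simps)
  then have em: "e = of_int m * \<alpha>" by (simp add: e_def)
  have sa: "sin a \<noteq> 0" using sine_nonzero by (simp add: a_def)
  have opp: "turn i * sin a + turn (i + 1) * sin b = 0" using opposite_sines[of i] by (simp add: a_def b_def)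
  have sb: "sin b \<noteq> 0" using opp sa turn(2)[of i] by auto
  have "sin a * sin b < 0"
  proof -
    have "turn (i + 1) * (sin a * sin b) = - (turn i * (sin a * sin a))"
    proof -
      have "turn (i + 1) * sin b = - (turn i * sin a)" using opp by linarith
      then show ?thesis by (simp add: algebra_simps)
    qed
    moreover have "0 < sin a * sin a" using sa by (auto simp: zero_less_mult_iff)
    then have "0 < turn i * (sin a * sin a)" using turn(2)[of i] by simp
    ultimately have "turn (i + 1) * (sin a * sin b) < 0" by linarith
    then show ?thesis using turn(2)[of "i + 1"] by (simp only: mult_less_0_iff) auto
  qed
  then have abs: "\<bar>sin a\<bar> + \<bar>sin b\<bar> = \<bar>sin a - sin b\<bar>" by (auto simp: mult_less_0_iff)
  have "cos \<alpha> * \<bar>cos a - cos b\<bar> = \<bar>offset i * sin b - offset (i + 1) * sin a\<bar>"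
    using arg_cong[OF chord_equation[of i], of abs] cos_angle_pos by (simp add: abs_mult a_def b_def)
  also have "\<dots> \<le> \<bar>offset i\<bar> * \<bar>sin b\<bar> + \<bar>offset (i + 1)\<bar> * \<bar>sin a\<bar>"
    by (metis abs_mult abs_triangle_ineq4)
  also have "\<dots> < sin \<alpha> * \<bar>sin b\<bar> + sin \<alpha> * \<bar>sin a\<bar>"
    using offset_less sa sb by (intro add_strict_mono mult_strict_right_mono) auto
  also have "\<dots> = sin \<alpha> * \<bar>sin a - sin b\<bar>" by (simp add: distrib_left flip: abs)
  finally have "cos \<alpha> * \<bar>cos a - cos b\<bar> < sin \<alpha> * \<bar>sin a - sin b\<bar>" .
  moreover have "\<bar>cos a - cos b\<bar> = 2 * \<bar>sin e\<bar> * \<bar>sin f\<bar>"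
  proof -
    have "sin ((b - a) / 2) = - sin f" unfolding f_def by (metis minus_diff_eq minus_divide_left sin_minus)
    then show ?thesis using cos_diff_cos[of a b] by (simp add: e_def abs_mult)
  qed
  moreover have "\<bar>sin a - sin b\<bar> = 2 * \<bar>cos e\<bar> * \<bar>sin f\<bar>"
    using sin_diff_sin[of a b] by (simp add: e_def f_def abs_mult mult.commute mult.left_commute)
  ultimately have "2 * \<bar>sin f\<bar> * (cos \<alpha> * \<bar>sin e\<bar>) < 2 * \<bar>sin f\<bar> * (sin \<alpha> * \<bar>cos e\<bar>)"
    by (simp add: algebra_simps)
  then have "cos \<alpha> * \<bar>sin e\<bar> < sin \<alpha> * \<bar>cos e\<bar>"
    by (rule mult_left_less_imp_less) simp
  then show dvd: "int n dvd m" unfolding em by (rule slope_below_side)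
  then have "sin e = 0" unfolding em by (simp only: sin_multiple_eq_0)
  moreover have "b = 2 * e - a" by (simp add: e_def field_simps)
  ultimately have "sin b = - sin a" "cos b = cos a"
    by (simp_all add: sin_diff cos_diff sin_double cos_double_sin)
  then show "N (i + 1) \<bullet> N (i + 2) = N i \<bullet> N (i + 2)"
    by (simp add: side_normal_def inner_dir a_def b_def)
  have "sin a * (offset i + offset (i + 1)) = 0"
  proof -
    have "cos \<alpha> * (cos a - cos b) = offset i * sin b - offset (i + 1) * sin a"
      unfolding a_def b_def by (rule chord_equation)
    then show ?thesis
      unfolding \<open>sin b = - sin a\<close> \<open>cos b = cos a\<close> by (simp add: distrib_left mult.commute)
  qed
  then show "offset i + offset (i + 1) = 0" using sa by simp
qed

text \<open>
  A function of odd period that changes its sign in every step vanishes.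
\<close>
lemma offset_zero: "offset i = 0"
proof -
  have "offset (i + 3) = offset i" using period_three(1)[of i] by (simp add: offset_def)
  then show ?thesis
    using symmetric_normals(3)[of i] symmetric_normals(3)[of "i + 1"] symmetric_normals(3)[of "i + 2"]
    by (simp add: add.assoc)
qed

lemma at_midpoint: "q i = cos \<alpha> *\<^sub>R N i"
  using q_offset[of i] offset_zero[of i] by simp

text \<open>
  Subtracting two of the symmetry relations gives three times the difference of two side indices, while
  the sides are different.
\<close>
lemma three_dvd: "3 dvd n"
proof (rule ccontr)
  assume "\<not> 3 dvd n"
  then have "coprime (int n) 3"
    using prime_imp_coprime[of "3::nat" n] by (simp add: coprime_commute flip: coprime_int_iff)
  moreover have "int n dvd 3 * (side_of (q 0) - side_of (q 2))"
  proof -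
    have "int n dvd (side_of (q 0) + side_of (q 1) - 2 * side_of (q 2)) - (side_of (q 1) + side_of (q 2) - 2 * side_of (q 3))"
      using dvd_diff[OF symmetric_normals(1)[of 0] symmetric_normals(1)[of 1]] by simp
    moreover have "q 3 = q 0" using period_three(1)[of 0] by simp
    ultimately show ?thesis by (simp add: algebra_simps)
  qed
  ultimately have "int n dvd side_of (q 0) - side_of (q 2)"
    by (simp only: coprime_dvd_mult_right_iff)
  then have "sin (of_int (2 * (side_of (q 0) - side_of (q 2))) * \<alpha>) = 0"
    by (subst sin_multiple_eq_0) (rule dvd_mult)
  moreover have "of_int (2 * (side_of (q 0) - side_of (q 2))) * \<alpha> = \<theta> 0 - \<theta> 2"
    by (simp add: side_angle_def algebra_simps)
  ultimately show False using sine_nonzero[of 0] by simp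
qed

lemma in_midpoint_triangles: "q \<in> midpoint_triangles n"
proof -
  have mid: "\<exists>j<n. q i = edge_midpoint n j" for i
  proof -
    obtain j where "j < n" "N i = side_normal n (int j)" by (rule side_normal_nat)
    then show ?thesis using at_midpoint[of i] by (auto simp: edge_midpoint_eq)
  qed
  have "q 3 = q 0" "q 4 = q 1" using period_three(1)[of 0] period_three(1)[of 1] by simp_all
  then have "N 1 \<bullet> N 2 = N 0 \<bullet> N 2" "N 2 \<bullet> N 0 = N 1 \<bullet> N 0"
    using symmetric_normals(2)[of 0] symmetric_normals(2)[of 1] by simp_all
  moreover have "q i \<bullet> q k = cos \<alpha> * (cos \<alpha> * (N i \<bullet> N k))" for i k
    using arg_cong2[OF at_midpoint[of i] at_midpoint[of k], of inner]
    by (simp only: inner_scaleR_left inner_scaleR_right)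
  ultimately have inner: "q 1 \<bullet> q 2 = q 0 \<bullet> q 2" "q 2 \<bullet> q 0 = q 1 \<bullet> q 0" by (simp_all only:)
  have n: "norm (q i) = cos \<alpha>" for i
    using arg_cong[OF at_midpoint[of i], of norm] cos_angle_pos by simp
  have "(dist (q 0) (q 1))\<^sup>2 = (dist (q 1) (q 2))\<^sup>2" "(dist (q 1) (q 2))\<^sup>2 = (dist (q 2) (q 0))\<^sup>2"
    using inner_of_dist[OF n n, of 0 1] inner_of_dist[OF n n, of 1 2] inner_of_dist[OF n n, of 2 0] inner
    by (simp_all add: inner_commute)
  then have "dist (q 0) (q 1) = dist (q 1) (q 2)" "dist (q 1) (q 2) = dist (q 2) (q 0)"
    by (simp_all add: power2_eq_iff_nonneg)
  moreover have "q 0 \<noteq> q 1" using q_distinct[of 0] by simp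
  moreover have "q = cyclic_seq [q 0, q 1, q 2]" using period_three(1) by (rule period_three_seq)
  ultimately show ?thesis unfolding midpoint_triangles_def using mid by blast
qed

end

context regular_ngon
begin

lemma reg3_orbits_eq: "reg3_orbits R = midpoint_triangles n"
proof
  show "reg3_orbits R \<subseteq> midpoint_triangles n"
  proof
    fix c assume "c \<in> reg3_orbits R"
    then interpret regular_three_orbit n c by unfold_locales
    show "c \<in> midpoint_triangles n" by (rule in_midpoint_triangles)
  qed
qed (use midpoint_triangles_orbit(2) in blast)

lemma reg3_orbits_three_dvd: "c \<in> reg3_orbits R \<Longrightarrow> 3 dvd n"
proof -
  assume "c \<in> reg3_orbits R"
  then interpret regular_three_orbit n c by unfold_locales
  show "3 dvd n" by (rule three_dvd)
qed

theorem P_3reg_empty: "\<not> 3 dvd n \<Longrightarrow> P_3reg R = {}"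
  using reg3_orbits_three_dvd by (auto simp: P_3reg_def quotient_def)

end

context regular_ngon
begin

section \<open>The number of midpoint triangles\<close>

lemma edge_midpoint_inj: "i < n \<Longrightarrow> j < n \<Longrightarrow> edge_midpoint n i = edge_midpoint n j \<longleftrightarrow> i = j"
  unfolding edge_midpoint_eq using cos_angle_pos int_dvd_diff_less by (auto simp: side_normal_inj)

lemma side_normals_inner: "side_normal n i \<bullet> side_normal n j = cos (2 * of_int (i - j) * \<alpha>)"
  unfolding side_normal_def inner_dir
  by (rule arg_cong[of _ _ cos]) (simp add: side_angle_def algebra_simps)

lemma cos_double_diff: "cos (2 * a) - cos (2 * b) = 2 * sin (a + b) * sin (b - a)" for a b :: real
proof -
  have "(2 * a + 2 * b) / 2 = a + b" "(2 * b - 2 * a) / 2 = b - a" by simp_all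
  then show ?thesis using cos_diff_cos[of "2 * a" "2 * b"] by (simp only:)
qed

text \<open>
  The inner product is \<open>cos (2 * pi / 3)\<close> exactly if the angle between the normals is a third of a turn.
\<close>
lemma third_turn_inner:
  assumes "n = 3 * k"
  shows "side_normal n i \<bullet> side_normal n j = - 1 / 2 \<longleftrightarrow> int n dvd i - j - int k \<or> int n dvd i - j + int k"
proof -
  have k: "of_int (int k) * \<alpha> = pi / 3" using n_times_angle assms by simp
  let ?a = "of_int (i - j) * \<alpha>"
  have e: "2 * of_int (i - j) * \<alpha> = 2 * ?a" "- 1 / 2 = cos (2 * (pi / 3))"
    using cos_120 by (simp_all add: field_simps)
  have "cos (2 * ?a) - cos (2 * (pi / 3)) = 2 * sin (?a + pi / 3) * sin (pi / 3 - ?a)"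
    by (rule cos_double_diff)
  then have "cos (2 * ?a) = cos (2 * (pi / 3)) \<longleftrightarrow> sin (?a + pi / 3) = 0 \<or> sin (pi / 3 - ?a) = 0"
    by (metis eq_iff_diff_eq_0 mult_eq_0_iff zero_neq_numeral)
  moreover have "sin (pi / 3 - ?a) = - sin (?a - pi / 3)" by (metis minus_diff_eq sin_minus)
  moreover have "?a + pi / 3 = of_int (i - j + int k) * \<alpha>" "?a - pi / 3 = of_int (i - j - int k) * \<alpha>"
    using k by (simp_all add: algebra_simps)
  ultimately show ?thesis
    unfolding side_normals_inner e by (simp only: neg_equal_0_iff_equal sin_multiple_eq_0) blast
qed

definition midpoint_triangle :: "nat \<Rightarrow> nat \<Rightarrow> int \<Rightarrow> plane" where
  "midpoint_triangle k j = cyclic_seq [edge_midpoint n j, edge_midpoint n (j + k), edge_midpoint n (j + 2 * k)]"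

definition midpoint_set :: "nat \<Rightarrow> nat \<Rightarrow> plane set" where
  "midpoint_set k j = edge_midpoint n ` {j, j + k, j + 2 * k}"

lemma midpoint_triangle_trace_eq: "orbit_trace (midpoint_triangle k j) = triangle_trace (midpoint_set k j)"
  by (simp add: midpoint_triangle_def orbit_trace_triple midpoint_set_def)

lemma dist_edge_midpoint:
  assumes "n = 3 * k" "int n dvd int i - int j - int k \<or> int n dvd int i - int j + int k"
  shows "dist (edge_midpoint n i) (edge_midpoint n j) = sqrt 3 * cos \<alpha>"
proof -
  have "side_normal n (int i) \<bullet> side_normal n (int j) = - 1 / 2"
    using third_turn_inner[OF assms(1)] assms(2) by blast
  then have "edge_midpoint n i \<bullet> edge_midpoint n j = - (cos \<alpha>)\<^sup>2 / 2"
    by (simp add: edge_midpoint_eq power2_eq_square)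
  then have "(dist (edge_midpoint n i) (edge_midpoint n j))\<^sup>2 = (sqrt 3 * cos \<alpha>)\<^sup>2"
    using inner_of_dist[OF norm_edge_midpoint norm_edge_midpoint, of i j] by (simp add: power_mult_distrib)
  then show ?thesis by (rule power2_eq_imp_eq) (use cos_angle_pos in simp_all)
qed

lemma midpoint_triangle_in:
  assumes "n = 3 * k" "j < k"
  shows "midpoint_triangle k j \<in> midpoint_triangles n"
proof -
  have D: "dist (edge_midpoint n j) (edge_midpoint n (j + k)) = sqrt 3 * cos \<alpha>"
    "dist (edge_midpoint n (j + k)) (edge_midpoint n (j + 2 * k)) = sqrt 3 * cos \<alpha>"
    "dist (edge_midpoint n (j + 2 * k)) (edge_midpoint n j) = sqrt 3 * cos \<alpha>"
    using assms(1) by (intro dist_edge_midpoint[OF assms(1)]; simp)+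
  then show ?thesis
    unfolding midpoint_triangles_iff midpoint_triangle_def
    using assms cos_angle_pos
    by (intro exI[of _ j] exI[of _ "j + k"] exI[of _ "j + 2 * k"]) auto
qed

lemma midpoint_triangles_trace:
  assumes k: "n = 3 * k" and c: "c \<in> midpoint_triangles n"
  obtains j where "j < k" "orbit_trace c = orbit_trace (midpoint_triangle k j)"
proof -
  obtain p q r where pqr: "c = cyclic_seq [edge_midpoint n p, edge_midpoint n q, edge_midpoint n r]"
    "p < n" "q < n" "r < n" and ne: "edge_midpoint n p \<noteq> edge_midpoint n q"
    and d: "dist (edge_midpoint n p) (edge_midpoint n q) = dist (edge_midpoint n q) (edge_midpoint n r)"
      "dist (edge_midpoint n q) (edge_midpoint n r) = dist (edge_midpoint n r) (edge_midpoint n p)"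
    using c unfolding midpoint_triangles_iff by blast
  have ne2: "edge_midpoint n q \<noteq> edge_midpoint n r" "edge_midpoint n r \<noteq> edge_midpoint n p"
    using ne d by auto
  note nm = norm_edge_midpoint[of p] norm_edge_midpoint[of q] norm_edge_midpoint[of r]
  have inner: "side_normal n (int a) \<bullet> side_normal n (int b) = - 1 / 2"
    if "edge_midpoint n a \<bullet> edge_midpoint n b = - (cos \<alpha>)\<^sup>2 / 2" for a b
  proof -
    have "(cos \<alpha> * cos \<alpha>) * (2 * (side_normal n (int a) \<bullet> side_normal n (int b)) + 1) = 0"
      using that by (simp add: edge_midpoint_eq power2_eq_square algebra_simps)
    then have "2 * (side_normal n (int a) \<bullet> side_normal n (int b)) + 1 = 0" using cos_angle_pos by simp
    then show ?thesis by linarith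
  qed
  have "edge_midpoint n p \<bullet> edge_midpoint n q = - (cos \<alpha>)\<^sup>2 / 2"
    by (rule equilateral_inner(1)[OF nm ne d])
  then have pq: "int n dvd int p - int q - int k \<or> int n dvd int p - int q + int k"
    using inner third_turn_inner[OF k] by blast
  have "edge_midpoint n r \<bullet> edge_midpoint n p = - (cos \<alpha>)\<^sup>2 / 2"
    by (rule equilateral_inner(1)[OF nm(3,1,2) ne2(2) d(2)[symmetric, unfolded d(1)[symmetric]] d(1)])
  then have rp: "int n dvd int r - int p - int k \<or> int n dvd int r - int p + int k"
    using inner third_turn_inner[OF k] by blast
  have qr: "q \<noteq> r" "p \<noteq> q" "r \<noteq> p" using ne ne2 by auto
  define j where "j = p mod k"
  have k0: "k > 0" using k n3 by simp
  then have j: "j < k" by (simp add: j_def)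
  have pj: "p \<in> {j, j + k, j + 2 * k}"
  proof -
    have "p div k < 3" using pqr(2) k by (simp add: less_mult_imp_div_less mult.commute)
    then have "p div k = 0 \<or> p div k = 1 \<or> p div k = 2" by linarith
    moreover have "p = (p div k) * k + j" by (simp add: j_def)
    ultimately show ?thesis by (metis add.commute insert_iff mult_1 mult_zero_left add_0)
  qed
  \<comment> \<open>a congruence modulo \<open>n\<close> between indices below \<open>n\<close> leaves only a few cases\<close>
  have shifts: "a \<in> {b + k, b + 2 * k} \<or> b \<in> {a + k, a + 2 * k}"
    if "a < n" "b < n" "int n dvd int a - int b - int k \<or> int n dvd int a - int b + int k" for a b
    using that(3)
  proof
    assume "int n dvd int a - int b - int k"
    then obtain t where t: "int a - int b - int k = int n * t" by (auto simp: dvd_def)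
    have "int n * t < int n * 1" "int n * (-2) < int n * t" using that(1,2) t k by linarith+
    then have "t < 1" "-2 < t" using n3 by (simp_all only: mult_less_cancel_left_pos)
    then have "t = 0 \<or> t = - 1" by linarith
    then show ?thesis using t k by auto
  next
    assume "int n dvd int a - int b + int k"
    then obtain t where t: "int a - int b + int k = int n * t" by (auto simp: dvd_def)
    have "int n * t < int n * 2" "int n * (-1) < int n * t" using that(1,2) t k by linarith+
    then have "t < 2" "-1 < t" using n3 by (simp_all only: mult_less_cancel_left_pos)
    then have "t = 0 \<or> t = 1" by linarith
    then show ?thesis using t k by auto
  qed
  have stay: "b \<in> {j, j + k, j + 2 * k}"
    if "a \<in> {j, j + k, j + 2 * k}" "b < n" "a \<in> {b + k, b + 2 * k} \<or> b \<in> {a + k, a + 2 * k}" for a b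
    using that j k by auto
  have "q \<in> {j, j + k, j + 2 * k}"
    by (rule stay[OF pj pqr(3) shifts[OF pqr(2,3) pq]])
  moreover have "r \<in> {j, j + k, j + 2 * k}"
    using shifts[OF pqr(4,2) rp] by (intro stay[OF pj pqr(4)]) blast
  ultimately have "{p, q, r} \<subseteq> {j, j + k, j + 2 * k}" using pj by blast
  moreover have "card {p, q, r} = card {j, j + k, j + 2 * k}" using qr k0 by simp
  ultimately have "{p, q, r} = {j, j + k, j + 2 * k}" by (intro card_subset_eq) auto
  then have "orbit_trace c = triangle_trace (edge_midpoint n ` {j, j + k, j + 2 * k})"
    unfolding pqr(1) orbit_trace_triple by (metis image_empty image_insert)
  then have "orbit_trace c = orbit_trace (midpoint_triangle k j)" unfolding midpoint_triangle_trace_eq midpoint_set_def .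
  then show thesis using that j by blast
qed

lemma midpoint_triangle_trace_inj:
  assumes "n = 3 * k" "i < k" "j < k" "orbit_trace (midpoint_triangle k i) = orbit_trace (midpoint_triangle k j)"
  shows "i = j"
proof -
  have "{y \<in> triangle_trace (midpoint_set k l). norm y = cos \<alpha>} = midpoint_set k l" for l
    by (rule triangle_trace_sphere) (auto simp: midpoint_set_def norm_edge_midpoint)
  then have "midpoint_set k i = midpoint_set k j" using assms(4) unfolding midpoint_triangle_trace_eq by metis
  moreover have "edge_midpoint n i \<in> midpoint_set k i" by (simp add: midpoint_set_def)
  ultimately obtain l where "l \<in> {j, j + k, j + 2 * k}" "edge_midpoint n i = edge_midpoint n l"
    by (auto simp: midpoint_set_def)
  then show ?thesis using edge_midpoint_inj[of i l] assms(1-3) by auto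
qed

theorem midpoint_triangle_count:
  assumes k: "n = 3 * k"
  shows "P_3reg R = midpoint_triangles n // same_trace R" "card (P_3reg R) = k"
proof -
  show P: "P_3reg R = midpoint_triangles n // same_trace R" by (simp add: P_3reg_def reg3_orbits_eq)
  let ?f = "\<lambda>j. same_trace R `` {midpoint_triangle k j}"
  have closed: "midpoint_triangles n \<subseteq> closed_orbits R"
    using midpoint_triangles_orbit(1) bounce_orbits_closed by blast
  have "midpoint_triangles n // same_trace R = (midpoint_triangle k ` {..<k}) // same_trace R"
  proof (rule trace_quotient_eq[OF _ closed])
    show "midpoint_triangle k ` {..<k} \<subseteq> midpoint_triangles n" using midpoint_triangle_in[OF k] by auto
    show "\<exists>d\<in>midpoint_triangle k ` {..<k}. orbit_trace c = orbit_trace d" if "c \<in> midpoint_triangles n" for c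
      using midpoint_triangles_trace[OF k that] by (metis imageI lessThan_iff)
  qed
  also have "\<dots> = ?f ` {..<k}" by (auto simp: quotient_def)
  finally have "P_3reg R = ?f ` {..<k}" using P by simp
  moreover have "inj_on ?f {..<k}"
  proof (rule inj_onI)
    fix i j assume ij: "i \<in> {..<k}" "j \<in> {..<k}" "?f i = ?f j"
    then have "midpoint_triangle k i \<in> closed_orbits R" using midpoint_triangle_in[OF k] closed by auto
    then have "orbit_trace (midpoint_triangle k i) = orbit_trace (midpoint_triangle k j)" using ij(3) trace_class_eq_iff by blast
    then show "i = j" using midpoint_triangle_trace_inj[OF k] ij by simp
  qed
  ultimately show "card (P_3reg R) = k" by (simp add: card_image)
qed

text \<open>
  The ratio of the two lengths is \<open>3 * sqrt 3 / 4 > 1\<close> for even \<open>n\<close>, and for odd \<open>n\<close> it suffices that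
  \<open>cos \<alpha> \<ge> 4 / 5\<close>.
\<close>
lemma width_less_triangle:
  assumes "6 \<le> n"
  shows "2 * width R < 3 * sqrt 3 * cos \<alpha>"
proof -
  have "(17 / 10)\<^sup>2 \<le> (3::real)" by (simp add: power2_eq_square)
  then have "17 / 10 \<le> sqrt 3" by (rule real_le_rsqrt)
  then have s: "5.1 * cos \<alpha> \<le> 3 * sqrt 3 * cos \<alpha>" using cos_angle_pos by (intro mult_right_mono) auto
  have "\<alpha> \<le> pi / 5" unfolding half_angle_def using assms by (intro divide_left_mono) auto
  then have "cos (pi / 5) \<le> cos \<alpha>" using angle_bounds by (intro cos_monotone_0_pi_le) auto
  then have "4 / 5 \<le> cos \<alpha>" using cos_pi_5_ge by simp
  then have "2 * (2 * cos \<alpha>) < 5.1 * cos \<alpha>" "2 * (1 + cos \<alpha>) < 5.1 * cos \<alpha>" by simp_all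
  moreover have "width R = 2 * cos \<alpha> \<or> width R = 1 + cos \<alpha>"
    using even_case(6) odd_width by blast
  ultimately have "2 * width R < 5.1 * cos \<alpha>" by (elim disjE) (simp_all only:)
  then show ?thesis using s by (rule less_le_trans)
qed

end

section \<open>Fagnano's inequality for the equilateral triangle\<close>

lemma altitude_foot_isosceles:
  assumes "dist a b = dist a c" "b \<noteq> c"
  shows "altitude_foot a b c = midpoint b c"
  unfolding altitude_foot_def
proof (rule the_equality)
  have "(a - midpoint b c) \<bullet> (c - b) = ((dist a b)\<^sup>2 - (dist a c)\<^sup>2) / 2"
    by (simp add: midpoint_def dist_norm power2_norm_eq_inner inner_simps inner_commute field_simps)
  then have orth: "(a - midpoint b c) \<bullet> (c - b) = 0" using assms by simp
  have "midpoint b c = (1 / 2) *\<^sub>R b + (1 / 2) *\<^sub>R c" by (simp add: midpoint_def scaleR_add_right)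
  then have "midpoint b c \<in> affine hull {b, c}"
    unfolding affine_hull_2 by (intro CollectI exI[of _ "1 / 2"]) auto
  then show "midpoint b c \<in> affine hull {b, c} \<and> orthogonal (a - midpoint b c) (c - b)"
    using orth by (simp add: orthogonal_def)
  fix f assume f: "f \<in> affine hull {b, c} \<and> orthogonal (a - f) (c - b)"
  then obtain s t where st: "s + t = 1" "f = s *\<^sub>R b + t *\<^sub>R c" by (auto simp: affine_hull_2)
  then have s: "s = 1 - t" by simp
  have fm: "f = midpoint b c + (t - 1 / 2) *\<^sub>R (c - b)"
    unfolding st(2) midpoint_def s by (intro plane_eqI) (simp_all add: field_simps)
  have "(a - f) \<bullet> (c - b) = 0" using f by (simp add: orthogonal_def)
  then have "(t - 1 / 2) * ((c - b) \<bullet> (c - b)) = 0"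
    using orth unfolding fm by (simp add: inner_diff_left inner_add_left)
  then have "t - 1 / 2 = 0" using assms(2) by simp
  then show "f = midpoint b c" unfolding fm by simp
qed

locale equilateral = regular_ngon 3

context equilateral
begin

lemma angle_value: "half_angle 3 = pi / 3"
  by (simp add: half_angle_def)

lemma side_shift_3: "side_normal 3 (i + 3) = side_normal 3 i" "side_tangent 3 (i + 3) = side_tangent 3 i"
  using dir_shift[of "side_angle 3 i" 1] dir_shift[of "side_angle 3 i + pi / 2" 1]
  by (simp_all add: side_normal_def side_tangent_def side_angle_def algebra_simps)

lemma frame_products:
  "side_normal 3 i \<bullet> side_normal 3 (i + 2) = - 1 / 2"
  "side_normal 3 (i + 1) \<bullet> side_normal 3 (i + 2) = - 1 / 2"
  "side_normal 3 i \<bullet> side_tangent 3 (i + 2) = sqrt 3 / 2"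
  "side_normal 3 (i + 1) \<bullet> side_tangent 3 (i + 2) = - sqrt 3 / 2"
  "side_tangent 3 i \<bullet> side_tangent 3 (i + 2) = - 1 / 2"
  "side_tangent 3 (i + 1) \<bullet> side_tangent 3 (i + 2) = - 1 / 2"
  "side_tangent 3 i \<bullet> side_normal 3 (i + 2) = - sqrt 3 / 2"
  "side_tangent 3 (i + 1) \<bullet> side_normal 3 (i + 2) = sqrt 3 / 2"
proof -
  have a: "side_angle 3 (i + 2) = side_angle 3 i + 4 * (pi / 3)" "side_angle 3 (i + 2) = side_angle 3 (i + 1) + 2 * (pi / 3)"
    by (simp_all add: side_angle_def angle_value algebra_simps)
  have c2: "cos (2 * (pi / 3)) = - 1 / 2" "sin (2 * (pi / 3)) = sqrt 3 / 2"
    using cos_120 sin_120 by simp_all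
  have "4 * (pi / 3) = pi / 3 + pi" by simp
  then have c4: "cos (4 * (pi / 3)) = - 1 / 2" "sin (4 * (pi / 3)) = - sqrt 3 / 2"
    by (simp_all only: cos_periodic_pi sin_periodic_pi cos_60 sin_60 minus_divide_left)
  have d1: "cos (p - (p + t)) = cos t" "cos (p - (p + t + pi / 2)) = - sin t"
    "cos (p + pi / 2 - (p + t)) = sin t" "cos (p + pi / 2 - (p + t + pi / 2)) = cos t" for p t :: real
  proof -
    have "p - (p + t) = - t" "p - (p + t + pi / 2) = - (t + pi / 2)" "p + pi / 2 - (p + t) = pi / 2 - t"
      "p + pi / 2 - (p + t + pi / 2) = - t" by simp_all
    then show "cos (p - (p + t)) = cos t" "cos (p - (p + t + pi / 2)) = - sin t"
    "cos (p + pi / 2 - (p + t)) = sin t" "cos (p + pi / 2 - (p + t + pi / 2)) = cos t"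
      by (simp_all add: cos_add cos_diff)
  qed
  show "side_normal 3 i \<bullet> side_normal 3 (i + 2) = - 1 / 2"
    "side_normal 3 i \<bullet> side_tangent 3 (i + 2) = sqrt 3 / 2"
    "side_tangent 3 i \<bullet> side_tangent 3 (i + 2) = - 1 / 2"
    "side_tangent 3 i \<bullet> side_normal 3 (i + 2) = - sqrt 3 / 2"
    unfolding side_normal_def side_tangent_def inner_dir a(1) d1 c4 by simp_all
  show "side_normal 3 (i + 1) \<bullet> side_normal 3 (i + 2) = - 1 / 2"
    "side_normal 3 (i + 1) \<bullet> side_tangent 3 (i + 2) = - sqrt 3 / 2"
    "side_tangent 3 (i + 1) \<bullet> side_tangent 3 (i + 2) = - 1 / 2"
    "side_tangent 3 (i + 1) \<bullet> side_normal 3 (i + 2) = sqrt 3 / 2"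
    unfolding side_normal_def side_tangent_def inner_dir a(2) d1 c2 by simp_all
qed

lemma inradius: "cos (half_angle 3) = 1 / 2"
  unfolding angle_value by (rule cos_60)

text \<open>
  The chord between two sides is at least as long as its projection to the third side, and equality
  forces it to be parallel to that side.
\<close>
lemma chord_bound:
  assumes "a = (1 / 2) *\<^sub>R side_normal 3 i + s *\<^sub>R side_tangent 3 i"
    and "b = (1 / 2) *\<^sub>R side_normal 3 (i + 1) + t *\<^sub>R side_tangent 3 (i + 1)"
  shows "sqrt 3 / 2 - s / 2 + t / 2 \<le> norm (a - b)"
    and "norm (a - b) = sqrt 3 / 2 - s / 2 + t / 2 \<Longrightarrow> s + t = 0"
proof -
  have T: "(a - b) \<bullet> side_tangent 3 (i + 2) = sqrt 3 / 2 - s / 2 + t / 2"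
    unfolding assms by (simp add: inner_add_left inner_diff_left frame_products)
  have N: "(a - b) \<bullet> side_normal 3 (i + 2) = - (sqrt 3 / 2) * (s + t)"
    unfolding assms by (simp add: inner_add_left inner_diff_left frame_products) (simp add: field_simps)
  have unit: "norm (side_tangent 3 (i + 2)) = 1" by (simp add: side_tangent_def)
  show "sqrt 3 / 2 - s / 2 + t / 2 \<le> norm (a - b)"
    using norm_cauchy_schwarz[of "a - b" "side_tangent 3 (i + 2)"] T unit by simp
  assume eq: "norm (a - b) = sqrt 3 / 2 - s / 2 + t / 2"
  let ?N = "(a - b) \<bullet> side_normal 3 (i + 2)" and ?T = "(a - b) \<bullet> side_tangent 3 (i + 2)"
  have "(norm (a - b))\<^sup>2 = (a - b) \<bullet> (?N *\<^sub>R side_normal 3 (i + 2) + ?T *\<^sub>R side_tangent 3 (i + 2))"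
    using side_frame[of "a - b" 3 "i + 2"] by (simp add: power2_norm_eq_inner)
  also have "\<dots> = ?N\<^sup>2 + ?T\<^sup>2" by (simp add: inner_add_right power2_eq_square)
  finally have "?N\<^sup>2 = 0" using eq T by simp
  then show "s + t = 0" using N by simp
qed

text \<open>
  In the sum of the three projections the coordinates of the points cancel.  If all chords are parallel
  to the sides, the coordinates change their sign from each side to the next, so they vanish.
\<close>
lemma inscribed_triangle:
  assumes p: "\<And>i. i \<in> {0, 1, 2} \<Longrightarrow> p i \<in> R \<and> p i \<bullet> side_normal 3 i = 1 / 2"
  shows "3 * sqrt 3 / 2 \<le> norm (p 0 - p 1) + norm (p 1 - p 2) + norm (p 2 - p 0)"
    and "norm (p 0 - p 1) + norm (p 1 - p 2) + norm (p 2 - p 0) = 3 * sqrt 3 / 2 \<Longrightarrow>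
      i \<in> {0, 1, 2} \<Longrightarrow> p i = (1 / 2) *\<^sub>R side_normal 3 i"
proof -
  define t where "t i = p i \<bullet> side_tangent 3 i" for i
  have c: "p i = (1 / 2) *\<^sub>R side_normal 3 i + t i *\<^sub>R side_tangent 3 i" if "i \<in> {0, 1, 2}" for i
    using side_frame[of "p i" 3 i] p[OF that] by (simp add: t_def)
  have c1: "p 1 = (1 / 2) *\<^sub>R side_normal 3 (0 + 1) + t 1 *\<^sub>R side_tangent 3 (0 + 1)" using c[of 1] by simp
  have c2: "p 2 = (1 / 2) *\<^sub>R side_normal 3 (1 + 1) + t 2 *\<^sub>R side_tangent 3 (1 + 1)" using c[of 2] by simp
  have c0: "p 0 = (1 / 2) *\<^sub>R side_normal 3 (2 + 1) + t 0 *\<^sub>R side_tangent 3 (2 + 1)"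
    using c[of 0] side_shift_3[of 0] by simp
  note b0 = chord_bound[OF c[of 0] c1] and b1 = chord_bound[OF c[of 1] c2] and b2 = chord_bound[OF c[of 2] c0]
  show "3 * sqrt 3 / 2 \<le> norm (p 0 - p 1) + norm (p 1 - p 2) + norm (p 2 - p 0)"
    using b0(1) b1(1) b2(1) by simp
  assume eq: "norm (p 0 - p 1) + norm (p 1 - p 2) + norm (p 2 - p 0) = 3 * sqrt 3 / 2" and i: "i \<in> {0, 1, 2}"
  have "t 0 + t 1 = 0" "t 1 + t 2 = 0" "t 2 + t 0 = 0"
    using eq b0(1) b1(1) b2(1) by (intro b0(2) b1(2) b2(2); simp)+
  then have "t 0 = 0" "t 1 = 0" "t 2 = 0" by linarith+
  then have "t i = 0" using i by auto
  then show "p i = (1 / 2) *\<^sub>R side_normal 3 i" using c[OF i] by simp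
qed

lemma opposite_corner:
  "corner 3 (j + 2) = - side_normal 3 j"
  "i \<noteq> j \<Longrightarrow> i \<in> {0, 1, 2} \<Longrightarrow> j \<in> {0, 1, 2} \<Longrightarrow> corner 3 (j + 2) \<bullet> side_normal 3 i = 1 / 2"
proof -
  have "side_normal 3 (j + 2 + 1) = - corner 3 (j + 2)"
    using opposite_side_odd[of "j + 2"] by simp
  then show e: "corner 3 (j + 2) = - side_normal 3 j" using side_shift_3(1)[of j] by (simp add: add.assoc)
  assume ij: "i \<noteq> j" "i \<in> {0, 1, 2}" "j \<in> {0, 1, 2}"
  have "side_normal 3 0 \<bullet> side_normal 3 2 = - 1 / 2" "side_normal 3 1 \<bullet> side_normal 3 2 = - 1 / 2"
    "side_normal 3 1 \<bullet> side_normal 3 0 = - 1 / 2"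
    using frame_products(1,2)[of 0] frame_products(1)[of 1] side_shift_3(1)[of 0] by simp_all
  then show "corner 3 (j + 2) \<bullet> side_normal 3 i = 1 / 2"
    unfolding e using ij by (auto simp: inner_commute)
qed

lemma side_cases: obtains j where "j \<in> {0, 1, 2}" "side_normal 3 i = side_normal 3 j"
proof
  show "i mod 3 \<in> {0, 1, 2}" using pos_mod_bound[of 3 i] pos_mod_sign[of 3 i] by auto
  show "side_normal 3 i = side_normal 3 (i mod 3)" using side_normal_mod[of i] by simp
qed

text \<open>
  If an orbit misses a side, the opposite corner maximises the inner product with every bounce vector
  over the triangle: each bounce point may be pushed a little further away from this corner.  Summation by parts then
  makes the length the inner product of this corner with the sum of all bounce vectors, which is 0.
\<close>
lemma touches_every_side:
  assumes c: "c \<in> closed_orbits R" and j: "j \<in> {0, 1, 2}"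
  obtains i where "c i \<bullet> side_normal 3 j = 1 / 2"
proof (rule ccontr)
  assume no: "\<not> thesis"
  interpret closed_billiard R c using c by (rule closed_billiardI)
  have le: "c i \<bullet> side_normal 3 k \<le> 1 / 2" for i k
    using polygon_below_side[OF q_in] inradius by simp
  then have lt: "c i \<bullet> side_normal 3 j < 1 / 2" for i using no that by (metis order_less_le)
  let ?V = "corner 3 (j + 2)"
  have max: "?V \<bullet> (u (i - 1) - u i) = c i \<bullet> (u (i - 1) - u i)" for i
  proof -
    let ?w = "u (i - 1) - u i"
    \<comment> \<open>the distance from \<open>c i\<close> to the missed side, divided by the altitude of the triangle\<close>
    define e where "e = (1 / 2 - c i \<bullet> side_normal 3 j) / (3 / 2)"
    have e: "e > 0" using lt[of i] by (simp add: e_def)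
    have "c i + e *\<^sub>R (c i - ?V) \<in> R"
      unfolding in_polygon_iff
    proof
      fix l
      obtain k where k: "k \<in> {0, 1, 2}" "side_normal 3 l = side_normal 3 k" by (rule side_cases)
      have "(c i + e *\<^sub>R (c i - ?V)) \<bullet> side_normal 3 k \<le> 1 / 2"
      proof (cases "k = j")
        case True
        have "?V \<bullet> side_normal 3 j = - 1" unfolding opposite_corner(1) by simp
        then have "(c i - ?V) \<bullet> side_normal 3 j \<le> 3 / 2" using le[of i j] by (simp add: inner_diff_left)
        then have "e * ((c i - ?V) \<bullet> side_normal 3 j) \<le> e * (3 / 2)" using e by (intro mult_left_mono) auto
        then show ?thesis unfolding True by (simp add: inner_add_left e_def)
      next
        case False
        then have "(c i - ?V) \<bullet> side_normal 3 k \<le> 0"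
          using opposite_corner(2)[OF False k(1) j] le[of i k] by (simp add: inner_diff_left)
        then have "e * ((c i - ?V) \<bullet> side_normal 3 k) \<le> 0" using e by (simp add: mult_le_0_iff)
        then show ?thesis using le[of i k] by (simp add: inner_add_left)
      qed
      then show "(c i + e *\<^sub>R (c i - ?V)) \<bullet> side_normal 3 l \<le> cos (half_angle 3)"
        using k inradius by simp
    qed
    then have "(c i + e *\<^sub>R (c i - ?V)) \<bullet> ?w \<le> c i \<bullet> ?w" by (rule support_vector)
    then have "e * ((c i - ?V) \<bullet> ?w) \<le> 0" by (simp add: inner_add_left)
    then have "(c i - ?V) \<bullet> ?w \<le> 0" using e by (simp add: mult_le_0_iff)
    moreover have "?V \<bullet> ?w \<le> c i \<bullet> ?w" by (rule support_vector[OF corner_in])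
    ultimately show ?thesis by (simp add: inner_diff_left)
  qed
  have "orbit_length c = ?V \<bullet> (\<Sum>i<m. u (int i - 1) - u (int i))"
    unfolding length_support inner_sum_right by (simp add: max)
  then show False using length_pos sum_normals by simp
qed

lemma three_points_length:
  assumes "c \<in> closed_orbits R"
  shows "norm (c i - c j) + norm (c j - c k) + norm (c k - c i) \<le> orbit_length c"
proof -
  interpret closed_billiard R c using assms by (rule closed_billiardI)
  interpret primal: closed_polygon "\<lambda>a b. norm (a - b)" "\<lambda>i. c (int i)" m
    using norm_diff_triangle_ineq q_periodic[of 0]
    by unfold_locales (auto intro: norm_diff_triangle_le)
  obtain i' where i: "i' < m" "c i = c (int i')" using periodic_index[of c m i, OF q_periodic] m_ge by auto
  obtain j' where j: "j' < m" "c j = c (int j')" using periodic_index[of c m j, OF q_periodic] m_ge by auto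
  obtain k' where k: "k' < m" "c k = c (int k')" using periodic_index[of c m k, OF q_periodic] m_ge by auto
  have "(\<Sum>i<m. norm (c (int i) - c (int (Suc i)))) = orbit_length c"
    by (simp add: orbit_length_def norm_minus_commute add.commute)
  then show ?thesis
    using primal.triple[of i' j' k'] i j k
    by (auto simp: norm_minus_commute)
qed

lemma side_points_length:
  assumes c: "c \<in> closed_orbits R"
    and i: "\<And>j. j \<in> {0, 1, 2} \<Longrightarrow> c (i j) \<bullet> side_normal 3 j = 1 / 2"
  shows "3 * sqrt 3 / 2 \<le> orbit_length c"
    and "orbit_length c = 3 * sqrt 3 / 2 \<Longrightarrow> j \<in> {0, 1, 2} \<Longrightarrow> c (i j) = (1 / 2) *\<^sub>R side_normal 3 j"
proof -
  interpret closed_billiard R c using c by (rule closed_billiardI)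
  have p: "c (i j) \<in> R \<and> c (i j) \<bullet> side_normal 3 j = 1 / 2" if "j \<in> {0, 1, 2}" for j
    using i[OF that] q_in by blast
  note tri = inscribed_triangle[of "\<lambda>j. c (i j)", OF p]
  show "3 * sqrt 3 / 2 \<le> orbit_length c"
    using tri(1) three_points_length[OF c, of "i 0" "i 1" "i 2"] by simp
  assume "orbit_length c = 3 * sqrt 3 / 2" "j \<in> {0, 1, 2}"
  then show "c (i j) = (1 / 2) *\<^sub>R side_normal 3 j"
    using tri three_points_length[OF c, of "i 0" "i 1" "i 2"] by simp
qed

lemma side_points:
  assumes "c \<in> closed_orbits R"
  obtains i where "\<And>j. j \<in> {0, 1, 2} \<Longrightarrow> c (i j) \<bullet> side_normal 3 j = 1 / 2"
proof -
  have "\<forall>j. \<exists>i. j \<in> {0, 1, 2} \<longrightarrow> c i \<bullet> side_normal 3 j = 1 / 2"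
    using touches_every_side[OF assms] by metis
  then obtain i where "\<forall>j. j \<in> {0, 1, 2} \<longrightarrow> c (i j) \<bullet> side_normal 3 j = 1 / 2" by metis
  then show thesis using that by blast
qed

lemma triangle_length_ge:
  "c \<in> closed_orbits R \<Longrightarrow> 3 * sqrt 3 / 2 \<le> orbit_length c"
  using side_points side_points_length(1) by metis

text \<open>
  Any bounce point may serve as the chosen point on its side, so in a minimal orbit every bounce point
  is an edge midpoint; then all steps have the same length, and there are three of them.
\<close>
lemma triangle_min_trace:
  assumes c: "c \<in> closed_orbits R" and len: "orbit_length c = 3 * sqrt 3 / 2"
  shows "orbit_trace c = triangle_trace (edge_midpoint 3 ` {0, 1, 2})"
proof -
  interpret closed_billiard R c using c by (rule closed_billiardI)
  obtain i where i: "\<And>j. j \<in> {0, 1, 2} \<Longrightarrow> c (i j) \<bullet> side_normal 3 j = 1 / 2"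
    using side_points[OF c] by blast
  have mid_eq: "edge_midpoint 3 j = (1 / 2) *\<^sub>R side_normal 3 (int j)" for j
    by (simp add: edge_midpoint_eq inradius)
  let ?M = "edge_midpoint 3 ` {0, 1, 2}"
  have M: "(1 / 2) *\<^sub>R side_normal 3 j \<in> ?M" if "j \<in> {0, 1, 2}" for j :: int
    using that mid_eq[of 0] mid_eq[of 1] mid_eq[of 2] by (auto simp: image_iff)
  have all: "c k \<in> ?M" for k
  proof -
    obtain l where "c k \<bullet> side_normal 3 l = 1 / 2"
      using q_frontier[of k] by (auto simp: frontier_polygon inradius)
    then obtain j where j: "j \<in> {0, 1, 2}" "c k \<bullet> side_normal 3 j = 1 / 2"
      using side_cases[of l] by metis
    \<comment> \<open>the bounce point \<open>c k\<close> replaces the chosen point on its side \<open>j\<close>\<close>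
    then have "c ((i(j := k)) j') \<bullet> side_normal 3 j' = 1 / 2" if "j' \<in> {0, 1, 2}" for j'
      using i[OF that] by auto
    from side_points_length(2)[OF c this len j(1)] have "c k = (1 / 2) *\<^sub>R side_normal 3 j" by simp
    then show ?thesis using M[OF j(1)] by simp
  qed
  have n31: "(3::nat) = 3 * 1" by simp
  have step_length: "norm (c (k + 1) - c k) = sqrt 3 / 2" for k
  proof -
    obtain a b where ab: "a \<in> {0, 1, 2::nat}" "b \<in> {0, 1, 2::nat}" "c (k + 1) = edge_midpoint 3 a" "c k = edge_midpoint 3 b"
      using all[of k] all[of "k + 1"] by blast
    then have "a \<noteq> b" using q_distinct[of k] by auto
    then have "int 3 dvd int a - int b - int 1 \<or> int 3 dvd int a - int b + int 1"
      using ab(1,2) by auto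
    then show ?thesis
      using dist_edge_midpoint[OF n31, of a b] ab(3,4) by (simp add: dist_norm inradius)
  qed
  have "orbit_length c = real m * (sqrt 3 / 2)" unfolding orbit_length_def step_length by simp
  then have m3: "m = 3" using len by simp
  have "c (k + 3) = c k" for k using q_periodic[of k] m3 by simp
  then have cyc: "c = cyclic_seq [c 0, c 1, c 2]" by (rule period_three_seq)
  have "?M \<subseteq> {c 0, c 1, c 2}"
  proof
    fix y assume "y \<in> ?M"
    then obtain j where j: "j \<in> {0, 1, 2::int}" "y = (1 / 2) *\<^sub>R side_normal 3 j" by (auto simp: mid_eq)
    have "y = c (i j)" using side_points_length(2)[OF c i len j(1)] j(2) by simp
    also have "\<dots> = cyclic_seq [c 0, c 1, c 2] (i j)" using cyc by simp
    finally show "y \<in> {c 0, c 1, c 2}" by (simp add: cyclic_seq_triple split: if_splits)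
  qed
  then have "{c 0, c 1, c 2} = ?M" using all by blast
  then show ?thesis using orbit_trace_triple[of "c 0" "c 1" "c 2"] cyc by simp
qed

lemma fagnano_eq:
  "fagnano_orbit (vertex 3 0) (vertex 3 1) (vertex 3 2)
     = cyclic_seq [edge_midpoint 3 1, edge_midpoint 3 2, edge_midpoint 3 0]"
proof -
  have V: "vertex 3 0 = - side_normal 3 1" "vertex 3 1 = - side_normal 3 2" "vertex 3 2 = - side_normal 3 0"
    using opposite_corner(1)[of "- 2"] opposite_corner(1)[of "- 1"] opposite_corner(1)[of 0]
      side_shift_3(1)[of "- 2"] side_shift_3(1)[of "- 1"] by (simp_all add: vertex_corner)
  have v3: "vertex 3 3 = vertex 3 0" using corner_shift[of 0 1] by (simp add: vertex_corner)
  have inner: "side_normal 3 0 \<bullet> side_normal 3 2 = - 1 / 2" "side_normal 3 1 \<bullet> side_normal 3 2 = - 1 / 2"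
    "side_normal 3 1 \<bullet> side_normal 3 0 = - 1 / 2"
    using frame_products(1,2)[of 0] frame_products(1)[of 1] side_shift_3(1)[of 0] by simp_all
  have d: "dist (side_normal 3 i) (side_normal 3 j) = sqrt 3" if "side_normal 3 i \<bullet> side_normal 3 j = - 1 / 2" for i j
    using that by (simp add: dist_norm norm_eq_sqrt_inner inner_diff_left inner_diff_right inner_commute)
  have D: "dist (vertex 3 0) (vertex 3 1) = sqrt 3" "dist (vertex 3 1) (vertex 3 2) = sqrt 3" "dist (vertex 3 2) (vertex 3 0) = sqrt 3"
    unfolding V dist_minus using inner by (auto intro!: d simp: inner_commute)
  then have ne: "vertex 3 0 \<noteq> vertex 3 1" "vertex 3 1 \<noteq> vertex 3 2" "vertex 3 2 \<noteq> vertex 3 0" by auto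
  have feet: "altitude_foot (vertex 3 0) (vertex 3 1) (vertex 3 2) = edge_midpoint 3 1"
    "altitude_foot (vertex 3 1) (vertex 3 2) (vertex 3 0) = edge_midpoint 3 2"
    "altitude_foot (vertex 3 2) (vertex 3 0) (vertex 3 1) = edge_midpoint 3 0"
    using D ne v3 by (simp_all add: altitude_foot_isosceles edge_midpoint_def dist_commute numeral_2_eq_2 numeral_3_eq_3)
  show ?thesis unfolding fagnano_orbit_def feet ..
qed

lemma fagnano_in: "fagnano_orbit (vertex 3 0) (vertex 3 1) (vertex 3 2) \<in> midpoint_triangles 3"
proof -
  have n31: "(3::nat) = 3 * 1" by simp
  have "dist (edge_midpoint 3 1) (edge_midpoint 3 2) = sqrt 3 * cos (half_angle 3)"
    "dist (edge_midpoint 3 2) (edge_midpoint 3 0) = sqrt 3 * cos (half_angle 3)"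
    "dist (edge_midpoint 3 0) (edge_midpoint 3 1) = sqrt 3 * cos (half_angle 3)"
    by (rule dist_edge_midpoint[OF n31]; simp)+
  then show ?thesis
    unfolding midpoint_triangles_iff fagnano_eq
    using cos_angle_pos by (intro exI[of _ 1] exI[of _ 2] exI[of _ 0]) auto
qed

theorem triangle_case:
  defines "F \<equiv> fagnano_orbit (vertex 3 0) (vertex 3 1) (vertex 3 2)"
  shows "F \<in> bounce_orbits R 3" "F \<in> min_orbits R"
    "P_min R = {F} // same_trace R"
    "orbit_length F = 3 * sqrt 3 / 2"
proof -
  show 1: "F \<in> bounce_orbits R 3" and 4: "orbit_length F = 3 * sqrt 3 / 2"
    using midpoint_triangles_orbit[OF fagnano_in] by (simp_all add: F_def inradius)
  show 2: "F \<in> min_orbits R"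
    using bounce_orbits_closed[OF 1] 4 triangle_length_ge by (rule min_orbitsI)
  show "P_min R = {F} // same_trace R"
    unfolding P_min_def
  proof (rule trace_quotient_eq[OF _ min_orbits_closed])
    show "{F} \<subseteq> min_orbits R" using 2 by simp
    fix c assume c: "c \<in> min_orbits R"
    then have len: "orbit_length c = 3 * sqrt 3 / 2" using min_orbits_length_eq[OF c 2] 4 by simp
    have "orbit_trace c = orbit_trace F"
      using triangle_min_trace[OF _ len] triangle_min_trace[OF _ 4] c 2 min_orbits_closed by blast
    then show "\<exists>d\<in>{F}. orbit_trace c = orbit_trace d" by simp
  qed
qed

end

section \<open>Minimal and regular orbits on regular polygons\<close>

theorem proposition4p2:
  fixes n :: nat
  assumes "n \<ge> 3"
  shows
    "let R = regular_polygon n in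
      (n = 3 \<longrightarrow>
         (let F = fagnano_orbit (vertex 3 0) (vertex 3 1) (vertex 3 2) in
            F \<in> bounce_orbits R 3 \<and> F \<in> min_orbits R \<and>
            P_min R = {F} // same_trace R \<and>
            orbit_length F = 3 * sqrt 3 / 2)) \<and>
      (n \<ge> 5 \<and> odd n \<longrightarrow>
         (let C = vertex_orbit n ` {..<n} in
            C \<subseteq> bounce_orbits R 2 \<and> C \<subseteq> min_orbits R \<and> (\<forall>c\<in>C. singular_orbit R c) \<and>
            P_min R = C // same_trace R \<and>
            card (P_min R) = n \<and>
            (\<forall>c\<in>C. orbit_length c = 2 * (1 + cos (pi / real n))) \<and>
            2 * (1 + cos (pi / real n)) = 2 * width R)) \<and>
      (even n \<longrightarrow>
         (let C = (\<Union>j<n div 2. band n j) in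
            C \<subseteq> bounce_orbits R 2 \<and> C \<subseteq> min_orbits R \<and>
            P_min R = C // same_trace R \<and>
            card ((\<lambda>j. band n j // same_trace R) ` {..<n div 2}) = n div 2 \<and>
            (\<forall>c\<in>C. orbit_length c = 4 * cos (pi / real n)) \<and>
            4 * cos (pi / real n) = 2 * width R)) \<and>
      (\<forall>k\<ge>1. n = 3 * k \<longrightarrow>
         (let C = midpoint_triangles n in
            C \<subseteq> reg3_orbits R \<and>
            P_3reg R = C // same_trace R \<and>
            card (P_3reg R) = k \<and>
            (\<forall>c\<in>C. orbit_length c = 3 * sqrt 3 * cos (pi / real n)) \<and>
            (k \<ge> 2 \<longrightarrow> 3 * sqrt 3 * cos (pi / real n) > 2 * width R))) \<and>
      (\<not> 3 dvd n \<longrightarrow> P_3reg R = {})"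
proof -
  interpret regular_ngon n using assms by unfold_locales
  have angle: "pi / real n = half_angle n" by (simp add: half_angle_def)
  show ?thesis
    unfolding Let_def angle
  proof (intro conjI impI allI)
    assume n: "n = 3"
    have "equilateral" by unfold_locales simp
    note triangle = equilateral.triangle_case[OF this]
    show "fagnano_orbit (vertex 3 0) (vertex 3 1) (vertex 3 2) \<in> bounce_orbits (regular_polygon n) 3"
      "fagnano_orbit (vertex 3 0) (vertex 3 1) (vertex 3 2) \<in> min_orbits (regular_polygon n)"
      "P_min (regular_polygon n) = {fagnano_orbit (vertex 3 0) (vertex 3 1) (vertex 3 2)} // same_trace (regular_polygon n)"
      "orbit_length (fagnano_orbit (vertex 3 0) (vertex 3 1) (vertex 3 2)) = 3 * sqrt 3 / 2"
      unfolding n by (rule triangle)+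
  next
    assume "5 \<le> n \<and> odd n"
    then have n: "odd n" "5 \<le> n" by auto
    note odd = odd_case[OF n]
    show "vertex_orbit n ` {..<n} \<subseteq> bounce_orbits (regular_polygon n) 2" by (rule odd)
    show "vertex_orbit n ` {..<n} \<subseteq> min_orbits (regular_polygon n)" by (rule odd)
    show "\<forall>c\<in>vertex_orbit n ` {..<n}. singular_orbit (regular_polygon n) c" by (rule odd)
    show "P_min (regular_polygon n) = vertex_orbit n ` {..<n} // same_trace (regular_polygon n)" by (rule odd)
    show "card (P_min (regular_polygon n)) = n" by (rule odd)
    show "\<forall>c\<in>vertex_orbit n ` {..<n}. orbit_length c = 2 * (1 + cos (half_angle n))" by (rule odd)
    show "2 * (1 + cos (half_angle n)) = 2 * width (regular_polygon n)" using odd_width[OF n(1)] by simp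
  next
    assume n: "even n"
    note even = even_case[OF n]
    show "(\<Union>j<n div 2. band n j) \<subseteq> bounce_orbits (regular_polygon n) 2" by (rule even)
    show "(\<Union>j<n div 2. band n j) \<subseteq> min_orbits (regular_polygon n)" by (rule even)
    show "P_min (regular_polygon n) = (\<Union>j<n div 2. band n j) // same_trace (regular_polygon n)" by (rule even)
    show "card ((\<lambda>j. band n j // same_trace (regular_polygon n)) ` {..<n div 2}) = n div 2" by (rule even)
    show "\<forall>c\<in>\<Union>j<n div 2. band n j. orbit_length c = 4 * cos (half_angle n)" by (rule even)
    show "4 * cos (half_angle n) = 2 * width (regular_polygon n)" using even(6) by simp
  next
    fix k :: nat
    assume k: "1 \<le> k" "n = 3 * k"
    show "midpoint_triangles n \<subseteq> reg3_orbits (regular_polygon n)" by (simp add: reg3_orbits_eq)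
    show "P_3reg (regular_polygon n) = midpoint_triangles n // same_trace (regular_polygon n)"
      "card (P_3reg (regular_polygon n)) = k"
      by (rule midpoint_triangle_count[OF k(2)])+
    show "\<forall>c\<in>midpoint_triangles n. orbit_length c = 3 * sqrt 3 * cos (half_angle n)"
      using midpoint_triangles_orbit(3) by blast
    show "2 * width (regular_polygon n) < 3 * sqrt 3 * cos (half_angle n)" if "2 \<le> k"
      using width_less_triangle that k by simp
  next
    assume "\<not> 3 dvd n"
    then show "P_3reg (regular_polygon n) = {}" by (rule P_3reg_empty)
  qed
qed

end
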